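(* Let $1\le q\le p<\infty$ and $1\le\alpha\le\beta<\infty$. Let $(S,\nu)$, $(X,\eta)$, $(T,\mu)$, $(Y,\sigma)$ be homogeneous spaces, let $U\subset S\times X$ and $U'\subset T\times Y$ be measurable, and let $\varphi:U\to U'$ be a mapping such that: (A1) $\varphi(s,x)=(\psi(s),\xi(s,x))$ preserves the priority of the variables; (A2) $\big\|J^{1/\alpha}_{\xi^{-1}(\psi^{-1}(t),\cdot)}\big\|_{L^\gamma(U'_t)}<\infty$ for every $t\in\psi(S)$, where $\gamma=\frac{\beta\alpha}{\beta-\alpha}$ if $\beta>\alpha$ and $\gamma=\infty$ if $\beta=\alpha$; (A3) $\psi:S\to T$ is injective and enjoys the Luzin $\mathcal N$-property. Then $\varphi$ induces a bounded operator $C_\varphi:L^{p,\beta}(U')\to L^{q,\alpha}(U)$, $C_\varphi f=f\circ\varphi$, if and only if $$J^{\frac1q}_{\psi^{-1}}(t)\,J^{\frac1\alpha}_{\xi^{-1}(\psi^{-1}(t),\cdot)}(y)\in L^{\kappa,\gamma}(U'),\qquad \kappa=\begin{cases}\frac{pq}{p-q},&p>q,\\ \infty,&p=q.\end{cases}$$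
   Context: Homogeneous space: a quasimetric space with a Borel measure such that (1) there is $c_1\ge1$ such that whenever balls $B(t_1,r)$, $B(t_2,r)$ intersect, $B(t_2,r)\subset B(t_1,c_1r)$; (2) balls of positive radius have positive finite measure and there is a constant $c_2$ with $\mu(B(t,c_1r))\le c_2\,\mu(B(t,r))$. Homogeneous spaces are assumed to be $\sigma$-finite measure spaces. Slices and mixed-norm Lebesgue spaces: $U_s=\{x\in X:(s,x)\in U\}$, $U'_t=\{y\in Y:(t,y)\in U'\}$. $L^{q,\alpha}(U)$ is the set of measurable functions $f(s,x)$ on $U$ with finite norm $\left(\int_S\left(\int_{U_s}|f(s,x)|^\alpha\,d\eta(x)\right)^{q/\alpha}d\nu(s)\right)^{1/q}$; $L^{p,\beta}(U')$ and $L^{\kappa,\gamma}(U')$ are defined analogously, with outer variable $t\in T$ (first exponent, measure $\mu$) and inner variable $y\in U'_t$ (second exponent, measure $\sigma$); infinite exponents mean essential supremum in the corresponding variable. Luzin properties: a mapping has the Luzin $\mathcal N^{-1}$-property if the inverse image of every set of measure zero has measure zero, and the Luzin $\mathcal N$-property if the image of every set of measure zero has measure zero. Preserving the priority of the variables: $\varphi(s,x)=(\psi(s),\xi(s,x))$, where $\psi:S\to T$ enjoys the Luzin $\mathcal N^{-1}$-property and $\xi(s,\cdot):U_s\to U'_{\psi(s)}$ enjoys the Luzin $\mathcal N^{-1}$-property for almost all $s\in S$. Volume derivatives of inverse mappings: $J_{\psi^{-1}}(t)=\lim_{r\to0}\frac{\nu(\psi^{-1}(B(t,r)))}{\mu(B(t,r))}$,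 the Radon–Nikodým derivative of $\nu\circ\psi^{-1}$ with respect to $\mu$; for $s\in S$, $J_{\xi^{-1}(s,\cdot)}(y)=\lim_{r\to0}\frac{\eta(\xi(s,\cdot)^{-1}(B(y,r)))}{\sigma(B(y,r))}$ for $y\in U'_{\psi(s)}$, the Radon–Nikodým derivative of $\eta\circ\xi(s,\cdot)^{-1}$ with respect to $\sigma$. The product in the conclusion is understood to be $0$ for $t\notin\psi(S)$.
   Formalization: The maps φ and ψ are assumed measurable, ψ is assumed to send measurable sets to measurable sets (otherwise the product can be non-measurable and the claim fails), and the limit J_{ψ^{-1}} is assumed to equal the Radon–Nikodym derivative almost everywhere. *)

theory Defs
  imports "HOL-Analysis.Analysis" "HOL-Probability.Essential_Supremum"
begin

section \<open>Homogeneous spaces\<close>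

definition quasimetric_on :: "'a set \<Rightarrow> ('a \<Rightarrow> 'a \<Rightarrow> real) \<Rightarrow> bool" where
  "quasimetric_on A d \<longleftrightarrow>
     (\<forall>x\<in>A. \<forall>y\<in>A. 0 \<le> d x y \<and> (d x y = 0 \<longleftrightarrow> x = y) \<and> d x y = d y x) \<and>
     (\<exists>K\<ge>1. \<forall>x\<in>A. \<forall>y\<in>A. \<forall>z\<in>A. d x y \<le> K * (d x z + d z y))"

definition qball :: "'a set \<Rightarrow> ('a \<Rightarrow> 'a \<Rightarrow> real) \<Rightarrow> 'a \<Rightarrow> real \<Rightarrow> 'a set" where
  "qball A d t r = {t' \<in> A. d t t' < r}"

definition qopen :: "'a set \<Rightarrow> ('a \<Rightarrow> 'a \<Rightarrow> real) \<Rightarrow> 'a set \<Rightarrow> bool" where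
  "qopen A d V \<longleftrightarrow> V \<subseteq> A \<and> (\<forall>t\<in>V. \<exists>r>0. qball A d t r \<subseteq> V)"

text \<open>
  The underlying set is the space of the measure, and the measure lives on the Borel
  sets of the quasimetric. Balls of a quasimetric need not be Borel, so
  their measurability is part of the requirement that they have positive finite measure.
\<close>

definition homogeneous_space :: "'a measure \<Rightarrow> ('a \<Rightarrow> 'a \<Rightarrow> real) \<Rightarrow> bool" where
  "homogeneous_space M d \<longleftrightarrow>
     quasimetric_on (space M) d \<and>
     sets M = sigma_sets (space M) {V. qopen (space M) d V} \<and>
     sigma_finite_measure M \<and>
     (\<exists>c1\<ge>1.
        (\<forall>t1\<in>space M. \<forall>t2\<in>space M. \<forall>r>0.
           qball (space M) d t1 r \<inter> qball (space M) d t2 r \<noteq> {} \<longrightarrow>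
           qball (space M) d t2 r \<subseteq> qball (space M) d t1 (c1 * r)) \<and>
        (\<forall>t\<in>space M. \<forall>r>0.
           qball (space M) d t r \<in> sets M \<and>
           0 < emeasure M (qball (space M) d t r) \<and>
           emeasure M (qball (space M) d t r) < \<infinity>) \<and>
        (\<exists>c2::real. \<forall>t\<in>space M. \<forall>r>0.
           emeasure M (qball (space M) d t (c1 * r))
             \<le> ennreal c2 * emeasure M (qball (space M) d t r)))"


section \<open>Mixed-norm Lebesgue spaces\<close>

text \<open>
  Measurability and sets of measure zero are always understood with respect to
  the completed measure, so that every subset of a null set is a null set.
\<close>

definition slice :: "('a \<times> 'b) set \<Rightarrow> 'a \<Rightarrow> 'b set" where
  "slice U s = {x. (s, x) \<in> U}"

text \<open>Power with a positive exponent on \<open>[0, \<infinity>]\<close>, where \<open>\<infinity>\<close> has power \<open>\<infinity>\<close>.\<close>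

definition epowr :: "ennreal \<Rightarrow> real \<Rightarrow> ennreal" where
  "epowr x a = (if x = \<infinity> then \<infinity> else ennreal (enn2real x powr a))"

definition Lnorm :: "ennreal \<Rightarrow> 'a measure \<Rightarrow> ('a \<Rightarrow> ennreal) \<Rightarrow> ennreal" where
  "Lnorm p M f =
     (if p = \<infinity> then esssup (completion M) f
      else epowr (\<integral>\<^sup>+x. epowr (f x) (enn2real p) \<partial>completion M) (1 / enn2real p))"

text \<open>
  Restriction of a nonnegative function to a set \<open>A\<close> is expressed by extending it by zero,
  which changes neither the integral nor the essential supremum.
\<close>

definition Lnorm_on :: "ennreal \<Rightarrow> 'a measure \<Rightarrow> 'a set \<Rightarrow> ('a \<Rightarrow> ennreal) \<Rightarrow> ennreal" where
  "Lnorm_on p M A f = Lnorm p M (\<lambda>x. f x * indicator A x)"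

definition mixed_norm ::
  "ennreal \<Rightarrow> ennreal \<Rightarrow> 'a measure \<Rightarrow> 'b measure \<Rightarrow> ('a \<times> 'b) set \<Rightarrow> ('a \<times> 'b \<Rightarrow> ennreal) \<Rightarrow> ennreal"
  where
  "mixed_norm p \<beta> M N U f = Lnorm p M (\<lambda>s. Lnorm_on \<beta> N (slice U s) (\<lambda>x. f (s, x)))"

text \<open>Membership of a \<open>[0, \<infinity>]\<close>-valued function in the mixed-norm space over \<open>U\<close>.\<close>

definition in_mixed_space ::
  "ennreal \<Rightarrow> ennreal \<Rightarrow> 'a measure \<Rightarrow> 'b measure \<Rightarrow> ('a \<times> 'b) set \<Rightarrow> ('a \<times> 'b \<Rightarrow> ennreal) \<Rightarrow> bool"
  where
  "in_mixed_space p \<beta> M N U f \<longleftrightarrow>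
     f \<in> borel_measurable (restrict_space (completion (M \<Otimes>\<^sub>M N)) U) \<and>
     mixed_norm p \<beta> M N U f < \<infinity>"

definition mixed_space ::
  "ennreal \<Rightarrow> ennreal \<Rightarrow> 'a measure \<Rightarrow> 'b measure \<Rightarrow> ('a \<times> 'b) set \<Rightarrow> ('a \<times> 'b \<Rightarrow> real) set"
  where
  "mixed_space p \<beta> M N U =
     {f. f \<in> borel_measurable (restrict_space (completion (M \<Otimes>\<^sub>M N)) U) \<and>
         mixed_norm p \<beta> M N U (\<lambda>z. ennreal \<bar>f z\<bar>) < \<infinity>}"

text \<open>
  The composition operator is given on representatives. By linearity of \<open>f \<mapsto> f \<circ> \<phi>\<close>, the
  norm estimate already implies that functions which agree almost everywhere on \<open>U'\<close>
  have compositions which agree almost everywhere on \<open>U\<close>.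
\<close>

definition induces_bounded_composition_operator ::
  "('a \<times> 'b \<Rightarrow> 'c \<times> 'd) \<Rightarrow>
   ennreal \<Rightarrow> ennreal \<Rightarrow> 'c measure \<Rightarrow> 'd measure \<Rightarrow> ('c \<times> 'd) set \<Rightarrow>
   ennreal \<Rightarrow> ennreal \<Rightarrow> 'a measure \<Rightarrow> 'b measure \<Rightarrow> ('a \<times> 'b) set \<Rightarrow> bool"
  where
  "induces_bounded_composition_operator \<phi> p \<beta> T Y U' q \<alpha> S X U \<longleftrightarrow>
     (\<exists>C::real. \<forall>f\<in>mixed_space p \<beta> T Y U'.
        f \<circ> \<phi> \<in> mixed_space q \<alpha> S X U \<and>
        mixed_norm q \<alpha> S X U (\<lambda>z. ennreal \<bar>(f \<circ> \<phi>) z\<bar>)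
          \<le> ennreal C * mixed_norm p \<beta> T Y U' (\<lambda>z. ennreal \<bar>f z\<bar>))"


section \<open>Luzin properties and volume derivatives\<close>

text \<open>Here \<open>f\<close> is a mapping from \<open>A \<subseteq> space M\<close> to \<open>space N\<close>.\<close>

definition luzin_Ninv :: "'a measure \<Rightarrow> 'a set \<Rightarrow> ('a \<Rightarrow> 'b) \<Rightarrow> 'b measure \<Rightarrow> bool" where
  "luzin_Ninv M A f N \<longleftrightarrow>
     (\<forall>Z\<in>null_sets (completion N). {x\<in>A. f x \<in> Z} \<in> null_sets (completion M))"

definition luzin_N :: "'a measure \<Rightarrow> 'a set \<Rightarrow> ('a \<Rightarrow> 'b) \<Rightarrow> 'b measure \<Rightarrow> bool" where
  "luzin_N M A f N \<longleftrightarrow>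
     (\<forall>Z\<in>null_sets (completion M). Z \<subseteq> A \<longrightarrow> f ` Z \<in> null_sets (completion N))"

definition preserves_priority ::
  "'s measure \<Rightarrow> 'x measure \<Rightarrow> ('s \<times> 'x) set \<Rightarrow> 't measure \<Rightarrow> 'y measure \<Rightarrow>
   ('s \<times> 'x \<Rightarrow> 't \<times> 'y) \<Rightarrow> ('s \<Rightarrow> 't) \<Rightarrow> ('s \<Rightarrow> 'x \<Rightarrow> 'y) \<Rightarrow> bool" where
  "preserves_priority S X U T Y \<phi> \<psi> \<xi> \<longleftrightarrow>
     (\<forall>(s, x)\<in>U. \<phi> (s, x) = (\<psi> s, \<xi> s x)) \<and>
     \<psi> \<in> space S \<rightarrow> space T \<and>
     luzin_Ninv S (space S) \<psi> T \<and>
     (AE s in S. luzin_Ninv X (slice U s) (\<xi> s) Y)"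

text \<open>
  The volume derivative at \<open>t\<close> of the inverse of \<open>f : A \<rightarrow> space N\<close>, where \<open>d\<close> is the
  quasimetric of \<open>N\<close>. Where the limit does not exist, the value is unspecified.
\<close>

definition volume_deriv_inv ::
  "'a measure \<Rightarrow> 'a set \<Rightarrow> ('a \<Rightarrow> 'b) \<Rightarrow> 'b measure \<Rightarrow> ('b \<Rightarrow> 'b \<Rightarrow> real) \<Rightarrow> 'b \<Rightarrow> ennreal" where
  "volume_deriv_inv M A f N d t =
     Lim (at_right 0)
       (\<lambda>r. emeasure (completion M) {x\<in>A. f x \<in> qball (space N) d t r}
             / emeasure N (qball (space N) d t r))"

end

theory Submission
  imports Defs
begin

text \<open>
  Since \<open>\<psi>\<close> is injective and preserves null sets in both directions, \<open>t \<mapsto> \<psi>\<^sup>-\<^sup>1 t\<close> transports null sets and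
  measurable functions from \<open>S \<times> Y\<close> to \<open>T \<times> Y\<close>. A change of variables in each fibre and then in the base turns the
  norm of \<open>f \<circ> \<phi>\<close> into the mixed \<open>(q, \<alpha>)\<close>-norm of \<open>f w\<close>, where the weight \<open>w\<close> is the product of
  the powers of the two densities. So \<open>C\<^sub>\<phi>\<close> is bounded iff multiplication by \<open>w\<close> is bounded from the
  \<open>(p, \<beta>)\<close>-norm to the \<open>(q, \<alpha>)\<close>-norm, which by Hoelder's inequality and its converse, applied first in the fibres and
  then in the base, means that \<open>w\<close> has finite \<open>(\<kappa>, \<gamma>)\<close>-norm; (A2) makes the fibre norms finite, so that
  extremal functions can be normalised.

  The volume derivatives of the fibre maps have to be identified with a jointly measurable density, outside a
  null set of the product and not merely fibrewise. This is Lebesgue differentiation with a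
  parameter: the exceptional set is covered by a set that is defined with countably many balls only. Where the fibre
  measure is not locally finite the volume derivative is infinite, which (A2) excludes almost everywhere.
\<close>

section \<open>Powers and norms of extended nonnegative functions\<close>

text \<open>Three obstacles shape the development. Quasimetric balls need not be open and no
  countable base is given: sigma-finiteness together with the positive mass of balls yields a
  countable dense set, the balls with rational radii around it replace a base, and engulfing and
  doubling compare arbitrary balls with these. Extremal functions for the converse of Hoelder's
  inequality have to be jointly measurable, so they are written down by formulas; for \<beta> =
  \<alpha> the essential supremum need not be attained, which costs a factor 2. The image of a fibre
  measure need not be sigma-finite, so its density may be infinite; it is obtained by cutting X into
  pieces of finite measure and differentiating one measure on the product instead of one measure per
  fibre. Differentiation is reduced to zeros of a function: a density \<open>k\<close> is compared
  with rational numbers \<open>c\<close> through the positive parts of \<open>k - c\<close> and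
  \<open>c - k\<close>, one of which vanishes at the given point. For the base map the equality of
  volume derivative and Radon-Nikodym derivative is a hypothesis, so this theorem is applied to the
  fibre maps.\<close>

lemma epowr_0 [simp]: "epowr 0 a = 0"
  by (simp add: epowr_def)

lemma epowr_top [simp]: "epowr top a = top"
  by (simp add: epowr_def)

lemma epowr_ennreal: "0 \<le> x \<Longrightarrow> epowr (ennreal x) a = ennreal (x powr a)"
  by (simp add: epowr_def)

lemma epowr_one [simp]: "epowr x 1 = x"
  by (cases x) (auto simp: epowr_ennreal)

lemma epowr_of_1 [simp]: "epowr 1 a = 1"
  by (simp add: epowr_def)

lemma epowr_eq_0_iff [simp]: "epowr x a = 0 \<longleftrightarrow> x = 0"
  by (cases x) (auto simp: epowr_ennreal ennreal_eq_0_iff)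

lemma epowr_eq_top_iff [simp]: "epowr x a = top \<longleftrightarrow> x = top"
  by (cases x) (auto simp: epowr_ennreal)

lemma epowr_less_top_iff [simp]: "epowr x a < top \<longleftrightarrow> x < top"
  using epowr_eq_top_iff[of x a] by (simp only: less_top[symmetric])

lemma epowr_mult: "epowr (x * y) a = epowr x a * epowr y a"
proof (cases "x = 0 \<or> y = 0 \<or> x = top \<or> y = top")
  case True
  then show ?thesis by (auto simp: ennreal_top_mult ennreal_mult_top)
next
  case False
  then obtain u v where "x = ennreal u" "u \<ge> 0" "y = ennreal v" "v \<ge> 0"
    by (cases x; cases y) auto
  then show ?thesis
    by (simp add: ennreal_mult[symmetric] epowr_ennreal powr_mult)
qed

lemma epowr_epowr: "epowr (epowr x a) b = epowr x (a * b)"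
  by (cases x) (auto simp: epowr_ennreal powr_powr)

lemma epowr_add: "epowr x (a + b) = epowr x a * epowr x b"
proof (cases x)
  case (real r)
  then show ?thesis by (simp add: epowr_ennreal powr_add ennreal_mult[symmetric])
qed simp

lemma epowr_mono: "0 \<le> a \<Longrightarrow> x \<le> y \<Longrightarrow> epowr x a \<le> epowr y a"
  by (cases x; cases y) (auto simp: epowr_ennreal intro!: powr_mono2 ennreal_leI simp: top_unique)

lemma epowr_inverse_cancel:
  "a \<noteq> 0 \<Longrightarrow> epowr (epowr x a) (1 / a) = x" "a \<noteq> 0 \<Longrightarrow> epowr (epowr x (1 / a)) a = x"
  by (simp_all add: epowr_epowr)

lemma epowr_le_iff: "0 < a \<Longrightarrow> epowr x a \<le> y \<longleftrightarrow> x \<le> epowr y (1 / a)"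
  using epowr_mono[of "1/a" "epowr x a" y] epowr_mono[of a x "epowr y (1/a)"]
  by (auto simp: epowr_inverse_cancel)

lemma epowr_minus_cancel: "x \<noteq> 0 \<Longrightarrow> x \<noteq> top \<Longrightarrow> epowr x a * epowr x (- a) = 1"
  by (cases x) (auto simp: epowr_ennreal ennreal_mult[symmetric] powr_minus field_simps)

lemma borel_measurable_epowr [measurable]: "(\<lambda>x. epowr x a) \<in> borel_measurable borel"
  unfolding epowr_def by measurable

lemma borel_measurable_epowr' [measurable (raw)]:
  "f \<in> borel_measurable M \<Longrightarrow> (\<lambda>x. epowr (f x) a) \<in> borel_measurable M"
  by measurable

lemma epowr_indicator: "epowr (indicator A x) a = indicator A x"
  by (auto simp: indicator_def)

text \<open>Young's inequality for \<open>u^b\<close> and \<open>v^c\<close> with the weights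
  \<open>a/b\<close> and \<open>a/c\<close>, which add up to 1. Keeping the exponent
  \<open>a\<close> on the left gives Hoelder's inequality for three exponents by one integration,
  without passing to conjugate exponents.\<close>

lemma epowr_young:
  assumes a: "0 < a" and b: "0 < b" and c: "0 < c" and abc: "1 / a = 1 / b + 1 / c"
  shows "epowr (x * y) a \<le> ennreal (a / b) * epowr x b + ennreal (a / c) * epowr y c"
proof (cases "x = 0 \<or> y = 0 \<or> x = top \<or> y = top")
  case True
  then show ?thesis using a b c by (auto simp: ennreal_mult_top ennreal_top_mult ennreal_eq_0_iff divide_le_0_iff)
next
  case False
  then obtain u v where uv: "x = ennreal u" "u > 0" "y = ennreal v" "v > 0"
    by (cases x; cases y) (auto simp: ennreal_zero_less_one less_le)
  have sum1: "a / b + a / c = 1"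
    using arg_cong[OF abc, of "\<lambda>z. a * z"] a by (simp add: distrib_left)
  have "(u powr b) powr (a/b) * (v powr c) powr (a/c) \<le> a/b * (u powr b) + a/c * (v powr c)"
    by (rule Youngs_inequality_0) (use a b c sum1 uv in auto)
  then have "(u * v) powr a \<le> a/b * (u powr b) + a/c * (v powr c)"
    using b c uv by (simp add: powr_powr powr_mult)
  then show ?thesis
    using uv a b c by (simp add: ennreal_mult[symmetric] epowr_ennreal ennreal_plus[symmetric] ennreal_leI del: ennreal_plus)
qed

section \<open>Norms with a possibly infinite exponent, and Hoelder's inequality\<close>

lemma Lnorm_ennreal:
  "0 < p \<Longrightarrow> Lnorm (ennreal p) M f = epowr (\<integral>\<^sup>+x. epowr (f x) p \<partial>M) (1 / p)"
  by (simp add: Lnorm_def nn_integral_completion)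

lemma Lnorm_top: "Lnorm top M f = esssup (completion M) f"
  by (simp add: Lnorm_def)

text \<open>Preimages under the two functions differ by a subset of a null set, and the completion
  contains all such subsets. This later yields measurability of volume derivatives from almost
  everywhere equality alone.\<close>

lemma measurable_completion_cong_AE:
  assumes "AE x in M. f x = g x" and f: "f \<in> borel_measurable (completion M)"
  shows "g \<in> borel_measurable (completion M)"
proof (rule measurableI)
  fix A :: "'b set" assume A: "A \<in> sets borel"
  show "g -` A \<inter> space (completion M) \<in> sets (completion M)"
  proof (rule completion.in_sets_AE[where A="f -` A \<inter> space (completion M)"])
    show "AE x in completion M. (x \<in> f -` A \<inter> space (completion M)) = (x \<in> g -` A \<inter> space (completion M))"
      using assms(1)[THEN AE_completion] by eventually_elim auto
  qed (use measurable_sets[OF f A] in auto)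
qed simp

lemma Lnorm_cong_AE:
  assumes "AE x in M. f x = g x"
  shows "Lnorm p M f = Lnorm p M g"
proof (cases "p = \<infinity>")
  case True
  have gf: "AE x in M. g x = f x" using assms by eventually_elim simp
  have "f \<in> borel_measurable (completion M) \<longleftrightarrow> g \<in> borel_measurable (completion M)"
    using measurable_completion_cong_AE[OF assms] measurable_completion_cong_AE[OF gf] by blast
  \<comment> \<open>\<open>esssup\<close> of a nonmeasurable function is \<open>top\<close> by
    convention, so the norms also agree when neither function is measurable.\<close>
  then show ?thesis
    using esssup_AE_cong[OF _ _ AE_completion[OF assms]] True
    by (cases "f \<in> borel_measurable (completion M)") (auto simp: Lnorm_top esssup_non_measurable)
next
  case False
  then show ?thesis
    using AE_completion[OF assms] by (auto simp: Lnorm_def intro!: arg_cong2[where f=epowr] nn_integral_cong_AE)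
qed

text \<open>Measurability is asked of the smaller function only: the integral is monotone for
  arbitrary functions, and a nonmeasurable \<open>g\<close> has \<open>esssup\<close> equal to
  \<open>top\<close>.\<close>

lemma Lnorm_mono_AE:
  assumes f: "f \<in> borel_measurable (completion M)" and "AE x in M. f x \<le> g x"
  shows "Lnorm p M f \<le> Lnorm p M g"
  using assms esssup_AE_mono[OF f AE_completion[OF assms(2)]] AE_completion[OF assms(2)]
  by (auto simp: Lnorm_def intro!: epowr_mono nn_integral_mono_AE)

lemma Lnorm_eq_0_iff:
  assumes f: "f \<in> borel_measurable (completion M)" and p: "p = \<infinity> \<or> (\<exists>a>0. p = ennreal a)"
  shows "Lnorm p M f = 0 \<longleftrightarrow> (AE x in M. f x = 0)"
proof (cases "p = \<infinity>")
  case True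
  show ?thesis
  proof
    assume "Lnorm p M f = 0"
    then show "AE x in M. f x = 0"
      using esssup_AE[of f "completion M"] True unfolding AE_completion_iff
      by (elim eventually_mono) (simp add: Lnorm_top)
  next
    assume "AE x in M. f x = 0"
    then have "AE x in completion M. f x \<le> 0" by (intro AE_completion) auto
    from esssup_I[OF f this] show "Lnorm p M f = 0" using True by (simp add: Lnorm_top)
  qed
next
  case False
  then obtain a where a: "a > 0" "p = ennreal a" using p by auto
  have "(\<integral>\<^sup>+x. epowr (f x) a \<partial>completion M) = 0 \<longleftrightarrow> (AE x in completion M. epowr (f x) a = 0)"
    by (rule nn_integral_0_iff_AE) (use f in measurable)
  then show ?thesis using a by (simp add: Lnorm_ennreal nn_integral_completion AE_completion_iff)
qed

lemma Lnorm_less_topD: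
  assumes f: "f \<in> borel_measurable (completion M)" and p: "p = \<infinity> \<or> (\<exists>a>0. p = ennreal a)"
    and fin: "Lnorm p M f < \<infinity>"
  shows "AE x in M. f x < \<infinity>"
proof (cases "p = \<infinity>")
  case True
  then have "esssup (completion M) f < \<infinity>" using fin by (simp add: Lnorm_top)
  then show ?thesis using esssup_AE[of f "completion M"] unfolding AE_completion_iff
    by (elim eventually_mono) (rule le_less_trans)
next
  case False
  then obtain a where a: "a > 0" "p = ennreal a" using p by auto
  have "AE x in completion M. epowr (f x) a \<noteq> \<infinity>"
    by (rule nn_integral_noteq_infinite) (use f fin a in \<open>auto simp: Lnorm_ennreal nn_integral_completion\<close>)
  then show ?thesis by (auto simp: AE_completion_iff less_top)
qed

lemma Lnorm_cmult_finite:
  assumes f: "f \<in> borel_measurable (completion M)" and a: "0 < a"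
  shows "Lnorm (ennreal a) M (\<lambda>x. c * f x) = c * Lnorm (ennreal a) M f"
proof -
  have "(\<integral>\<^sup>+x. epowr c a * epowr (f x) a \<partial>completion M) = epowr c a * (\<integral>\<^sup>+x. epowr (f x) a \<partial>completion M)"
    by (rule nn_integral_cmult) (use f in measurable)
  then show ?thesis
    using a by (simp add: Lnorm_ennreal epowr_mult nn_integral_completion epowr_inverse_cancel)
qed

lemma Lnorm_cmult_le:
  assumes f: "f \<in> borel_measurable (completion M)" and p: "p = \<infinity> \<or> (\<exists>a>0. p = ennreal a)"
  shows "Lnorm p M (\<lambda>x. c * f x) \<le> c * Lnorm p M f"
proof (cases "p = \<infinity>")
  case True
  have [measurable]: "(\<lambda>x. c * f x) \<in> borel_measurable (completion M)" using f by measurable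
  have "AE x in completion M. c * f x \<le> c * esssup (completion M) f"
    using esssup_AE[of f "completion M"] by eventually_elim (auto intro: mult_left_mono)
  from esssup_I[OF _ this] show ?thesis using True by (simp add: Lnorm_top)
next
  case False
  then show ?thesis using Lnorm_cmult_finite[OF f] p by auto
qed

text \<open>The exponent \<open>c\<close> solves \<open>1/a = 1/b + 1/c\<close>. For
  \<open>a < b\<close> both factors are scaled to norm 1 and \<open>epowr_young\<close> is
  integrated; for \<open>a = b\<close> the factor \<open>g\<close> is replaced by its essential
  supremum.\<close>

lemma Lnorm_holder:
  assumes f: "f \<in> borel_measurable (completion M)" and g: "g \<in> borel_measurable (completion M)"
    and ab: "0 < a" "a \<le> b"
    and c: "c = (if a < b then ennreal (b * a / (b - a)) else \<infinity>)"
  shows "Lnorm (ennreal a) M (\<lambda>x. f x * g x) \<le> Lnorm (ennreal b) M f * Lnorm c M g"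
proof (cases "a < b")
  case False
  then have [simp]: "b = a" "c = \<infinity>" using ab c by auto
  have "Lnorm (ennreal a) M (\<lambda>x. f x * g x) \<le> Lnorm (ennreal a) M (\<lambda>x. Lnorm c M g * f x)"
  proof (rule Lnorm_mono_AE)
    show "AE x in M. f x * g x \<le> Lnorm c M g * f x"
      using esssup_AE[of g "completion M"] unfolding AE_completion_iff
      by eventually_elim (auto simp: Lnorm_top mult.commute[of _ "f _"] intro!: mult_left_mono)
  qed (use f g in measurable)
  also have "\<dots> = Lnorm c M g * Lnorm (ennreal a) M f"
    using f ab by (intro Lnorm_cmult_finite)
  finally show ?thesis by (simp add: mult.commute)
next
  case True
  define c' where "c' = b * a / (b - a)"
  have c': "c' > 0" "c = ennreal c'" using True ab c by (auto simp: c'_def)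
  have abc: "1 / a = 1 / b + 1 / c'" using True ab by (simp add: c'_def field_simps)
  have b: "b > 0" using True ab by simp
  note Lf = Lnorm_eq_0_iff[OF f, of "ennreal b"] and Lg = Lnorm_eq_0_iff[OF g, of c]
  have fg: "(\<lambda>x. f x * g x) \<in> borel_measurable (completion M)" using f g by measurable
  let ?A = "Lnorm (ennreal b) M f" and ?B = "Lnorm c M g"
  \<comment> \<open>Vanishing norms are treated before infinite ones: the product of 0 and infinity
    is 0, so in those cases the left side itself has to be shown to vanish.\<close>
  consider "?A = 0" | "?B = 0" | "?A \<noteq> 0" "?B \<noteq> 0" "?A = \<infinity> \<or> ?B = \<infinity>" | "?A \<noteq> 0" "?B \<noteq> 0" "?A \<noteq> \<infinity>" "?B \<noteq> \<infinity>" by auto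
  then show ?thesis
  proof cases
    case 1
    then have "AE x in M. f x = 0" using Lf b by blast
    then have "AE x in M. f x * g x = 0" by eventually_elim simp
    then have "Lnorm (ennreal a) M (\<lambda>x. f x * g x) = 0"
      using Lnorm_eq_0_iff[OF fg, of "ennreal a"] ab by blast
    then show ?thesis by simp
  next
    case 2
    then have "AE x in M. g x = 0" using Lg c' by blast
    then have "AE x in M. f x * g x = 0" by eventually_elim simp
    then have "Lnorm (ennreal a) M (\<lambda>x. f x * g x) = 0"
      using Lnorm_eq_0_iff[OF fg, of "ennreal a"] ab by blast
    then show ?thesis by simp
  next
    case 3
    then show ?thesis by (auto simp: ennreal_mult_top ennreal_top_mult)
  next
    case 4
    define A B where "A = ?A" and "B = ?B"
    have AB: "A \<noteq> 0" "B \<noteq> 0" "A \<noteq> top" "B \<noteq> top" using 4 by (auto simp: A_def B_def)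
    have A1: "(\<integral>\<^sup>+x. epowr (f x) b \<partial>completion M) = epowr A b"
      and B1: "(\<integral>\<^sup>+x. epowr (g x) c' \<partial>completion M) = epowr B c'"
      using b c' by (simp_all add: A_def B_def Lnorm_ennreal epowr_inverse_cancel nn_integral_completion)
    \<comment> \<open>\<open>epowr A (-1)\<close> is a genuine inverse because \<open>A\<close> and
      \<open>B\<close> are neither 0 nor infinite at this point.\<close>
    let ?f = "\<lambda>x. epowr A (-1) * f x" and ?g = "\<lambda>x. epowr B (-1) * g x"
    have "(\<integral>\<^sup>+x. epowr (?f x * ?g x) a \<partial>completion M)
        \<le> (\<integral>\<^sup>+x. ennreal (a / b) * epowr (?f x) b + ennreal (a / c') * epowr (?g x) c' \<partial>completion M)"
      using ab b c' abc by (intro nn_integral_mono epowr_young) auto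
    also have "\<dots> = (\<integral>\<^sup>+x. (ennreal (a / b) * epowr A (-b)) * epowr (f x) b + (ennreal (a / c') * epowr B (-c')) * epowr (g x) c' \<partial>completion M)"
      by (simp add: epowr_mult epowr_epowr mult.assoc)
    also have "\<dots> = (ennreal (a / b) * epowr A (-b)) * epowr A b + (ennreal (a / c') * epowr B (-c')) * epowr B c'"
    proof -
      have [measurable]: "f \<in> borel_measurable (completion M)" "g \<in> borel_measurable (completion M)" by fact+
      show ?thesis by (subst nn_integral_add, measurable, subst (1 2) nn_integral_cmult, measurable) (simp only: A1 B1)
    qed
    also have "\<dots> = ennreal (a / b) + ennreal (a / c')"
      using epowr_minus_cancel[OF AB(1,3), of "-b"] epowr_minus_cancel[OF AB(2,4), of "-c'"]
      by (simp add: mult.assoc)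
    also have "\<dots> = 1"
      using arg_cong[OF abc, of "\<lambda>z. a * z"] ab b c' by (simp add: distrib_left ennreal_plus[symmetric] del: ennreal_plus)
    finally have "(\<integral>\<^sup>+x. epowr (?f x * ?g x) a \<partial>completion M) \<le> 1" .
    then have "Lnorm (ennreal a) M (\<lambda>x. ?f x * ?g x) \<le> 1"
      using ab by (simp add: Lnorm_ennreal nn_integral_completion epowr_le_iff)
    also have "Lnorm (ennreal a) M (\<lambda>x. ?f x * ?g x) = Lnorm (ennreal a) M (\<lambda>x. (epowr A (-1) * epowr B (-1)) * (f x * g x))"
      by (simp only: mult.assoc mult.commute mult.left_commute)
    also have "\<dots> = (epowr A (-1) * epowr B (-1)) * Lnorm (ennreal a) M (\<lambda>x. f x * g x)"
      using fg ab by (intro Lnorm_cmult_finite)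
    finally have le: "A * B * ((epowr A (-1) * epowr B (-1)) * Lnorm (ennreal a) M (\<lambda>x. f x * g x)) \<le> A * B * 1"
      by (rule mult_left_mono) simp
    have 1: "A * epowr A (-1) = 1" "B * epowr B (-1) = 1"
      using epowr_minus_cancel[OF AB(1,3), of 1] epowr_minus_cancel[OF AB(2,4), of 1] by (simp_all only: epowr_one)
    have "A * B * ((epowr A (-1) * epowr B (-1)) * z) = (A * epowr A (-1)) * (B * epowr B (-1)) * z" for z
      by (simp only: mult.assoc mult.commute mult.left_commute)
    from le[unfolded this 1] have "Lnorm (ennreal a) M (\<lambda>x. f x * g x) \<le> A * B"
      by (simp only: mult_1 mult_1_right)
    then show ?thesis unfolding A_def B_def .
  qed
qed

section \<open>The converse of Hoelder's inequality\<close>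

lemma esssup_completion:
  assumes f: "f \<in> borel_measurable M"
  shows "esssup (completion M) f = esssup M f"
  using f measurable_completion[OF f] by (simp add: esssup_eq_AE AE_completion_iff)

text \<open>For \<open>q < p\<close> the estimate is tested on truncations of the extremal function
  \<open>n^(c/p)\<close>; each gives a bound by \<open>D\<close> that does not depend on the
  truncation, and monotone convergence concludes. For \<open>q = p\<close> it is tested on
  indicators of superlevel sets of \<open>n\<close>.\<close>

lemma Lnorm_converse_holder:
  assumes M: "sigma_finite_measure M" and n[measurable]: "n \<in> borel_measurable M"
    and fin: "AE x in M. n x < \<infinity>" and D: "D < \<infinity>" and pq: "0 < q" "q \<le> p"
    and \<kappa>: "\<kappa> = (if q < p then ennreal (p * q / (p - q)) else \<infinity>)"
    and bound: "\<And>u. u \<in> borel_measurable M \<Longrightarrow> (\<And>x. 0 \<le> u x) \<Longrightarrow> Lnorm (ennreal p) M (\<lambda>x. ennreal (u x)) < \<infinity> \<Longrightarrow>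
        Lnorm (ennreal q) M (\<lambda>x. ennreal (u x) * n x) \<le> D * Lnorm (ennreal p) M (\<lambda>x. ennreal (u x))"
  shows "Lnorm \<kappa> M n < \<infinity>"
proof -
  interpret sigma_finite_measure M by (rule M)
  obtain A :: "nat \<Rightarrow> _" where A: "range A \<subseteq> sets M" "(\<Union>i. A i) = space M" "\<And>i. emeasure M (A i) \<noteq> \<infinity>" "incseq A"
    using sigma_finite_incseq by blast
  have [measurable]: "A i \<in> sets M" for i using A(1) by auto
  have p: "0 < p" using pq by simp
  show ?thesis
  proof (cases "q < p")
    case True
    define c where "c = p * q / (p - q)"
    have c: "0 < c" "\<kappa> = ennreal c" using True pq \<kappa> by (auto simp: c_def)
    have cq: "(c / p + 1) * q = c" using True pq by (simp add: c_def field_simps)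
    have cpq: "1 / q = 1 / c + 1 / p" using True pq by (simp add: c_def field_simps)
    \<comment> \<open>Truncating both the domain and the values makes \<open>I k\<close> finite, so
      that a power of it can be cancelled from the tested estimate.\<close>
    define B where "B k = A k \<inter> {x \<in> space M. n x \<le> of_nat k}" for k :: nat
    have [measurable]: "B k \<in> sets M" for k unfolding B_def by measurable
    define I where "I k = (\<integral>\<^sup>+x. epowr (n x) c * indicator (B k) x \<partial>M)" for k
    have bdd: "I k \<le> epowr D c" for k
    proof (cases "I k = 0")
      case False
      have "I k \<le> (\<integral>\<^sup>+x. epowr (of_nat k) c * indicator (A k) x \<partial>M)"
        unfolding I_def using c by (intro nn_integral_mono) (auto simp: B_def indicator_def intro: epowr_mono)
      also have "\<dots> = epowr (of_nat k) c * emeasure M (A k)"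
        by (simp add: nn_integral_cmult)
      also have "\<dots> < \<infinity>"
        using A(3)[of k] by (simp add: less_top[symmetric] ennreal_mult_eq_top_iff)
      finally have Ifin: "I k < \<infinity>" .
      \<comment> \<open>The exponent \<open>c/p\<close> turns both sides into powers of the same
        integral: on \<open>B k\<close> one has \<open>u^p = n^c\<close>, and
        \<open>(u n)^q = n^c\<close> because \<open>(c/p + 1) q = c\<close>.\<close>
      define u where "u x = enn2real (epowr (n x) (c / p)) * indicator (B k) x" for x
      have u: "ennreal (u x) = epowr (n x) (c / p) * indicator (B k) x" for x
      proof (cases "x \<in> B k")
        case True
        then have "n x \<le> of_nat k" by (auto simp: B_def)
        also have "\<dots> < top" by (rule of_nat_less_top)
        finally show ?thesis using True by (simp add: u_def)
      qed (simp add: u_def)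
      have u0: "0 \<le> u x" for x by (simp add: u_def)
      have [measurable]: "u \<in> borel_measurable M" unfolding u_def by measurable
      have up: "Lnorm (ennreal p) M (\<lambda>x. ennreal (u x)) = epowr (I k) (1 / p)"
        using p by (simp add: u Lnorm_ennreal epowr_mult epowr_indicator epowr_epowr I_def)
      have "(epowr (n x) (c / p) * indicator (B k) x) * n x = epowr (n x) (c / p + 1) * indicator (B k) x" for x
        by (simp add: epowr_add ac_simps)
      then have uq: "Lnorm (ennreal q) M (\<lambda>x. ennreal (u x) * n x) = epowr (I k) (1 / q)"
        using pq cq by (simp add: u Lnorm_ennreal epowr_mult epowr_indicator epowr_epowr I_def)
      have "epowr (I k) (1 / q) \<le> D * epowr (I k) (1 / p)"
        unfolding up[symmetric] uq[symmetric] by (rule bound) (use Ifin in \<open>simp_all add: up u0\<close>)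
      then have "epowr (I k) (1 / q) * epowr (I k) (- (1 / p)) \<le> (D * epowr (I k) (1 / p)) * epowr (I k) (- (1 / p))"
        by (rule mult_right_mono) simp
      also have "\<dots> = D"
        using epowr_minus_cancel[of "I k" "1/p"] False Ifin by (simp add: mult.assoc)
      also have "epowr (I k) (1 / q) * epowr (I k) (- (1 / p)) = epowr (I k) (1 / c)"
        using cpq by (simp add: epowr_add[symmetric])
      finally show ?thesis
        using epowr_le_iff[of "1/c" "I k" D] c by simp
    qed simp
    have "(\<integral>\<^sup>+x. epowr (n x) c \<partial>M) = (\<integral>\<^sup>+x. (SUP k. epowr (n x) c * indicator (B k) x) \<partial>M)"
    proof (rule nn_integral_cong_AE)
      show "AE x in M. epowr (n x) c = (SUP k. epowr (n x) c * indicator (B k) x)"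
        using fin AE_space
      proof eventually_elim
        case (elim x)
        obtain i where i: "x \<in> A i" using A(2) elim by auto
        obtain r where "n x = ennreal r" "0 \<le> r" using elim by (cases "n x") auto
        moreover obtain j where "r \<le> of_nat j" using real_arch_simple by blast
        ultimately have j: "n x \<le> of_nat j" by (metis ennreal_leI ennreal_of_nat_eq_real_of_nat)
        have "x \<in> B (max i j)"
          using i j incseqD[OF A(4), of i "max i j"] elim
          by (auto simp: B_def intro: order_trans)
        then have "epowr (n x) c \<le> (SUP k. epowr (n x) c * indicator (B k) x)"
          by (intro SUP_upper2[of "max i j"]) auto
        moreover have "(SUP k. epowr (n x) c * indicator (B k) x) \<le> epowr (n x) c"
          by (intro SUP_least) (auto simp: indicator_def)
        ultimately show ?case by (rule antisym)
      qed
    qed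
    also have "\<dots> = (SUP k. I k)"
      unfolding I_def
    proof (rule nn_integral_monotone_convergence_SUP)
      have "B k \<subseteq> B l" if "k \<le> l" for k l
        using incseqD[OF A(4) that] that by (auto simp: B_def intro: order_trans)
      then show "incseq (\<lambda>k x. epowr (n x) c * indicator (B k) x)"
        by (auto simp: incseq_def le_fun_def indicator_def)
    qed measurable
    also have "\<dots> \<le> epowr D c" using bdd by (rule SUP_least)
    also have "\<dots> < \<infinity>" using D by simp
    finally show ?thesis using c by (simp add: Lnorm_ennreal)
  next
    case False
    then have [simp]: "p = q" "\<kappa> = top" using pq \<kappa> by auto
    \<comment> \<open>The excess of \<open>D + 1\<close> over \<open>D\<close> does the work:
      testing on \<open>E\<close> gives \<open>(D + 1) m \<le> D m\<close> with
      \<open>m = epowr (emeasure M E) (1 / q)\<close> finite, hence \<open>m = 0\<close>.\<close>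
    have "AE x in M. x \<in> A k \<longrightarrow> n x \<le> D + 1" for k
    proof -
      define E where "E = A k \<inter> {x \<in> space M. D + 1 < n x}"
      have [measurable]: "E \<in> sets M" unfolding E_def by measurable
      have Efin: "emeasure M E < \<infinity>"
        using A(3)[of k] emeasure_mono[of E "A k" M] by (auto simp: E_def less_top[symmetric] top_unique)
      have e: "Lnorm (ennreal q) M (\<lambda>x. ennreal (indicator E x)) = epowr (emeasure M E) (1 / q)"
        using pq by (simp add: Lnorm_ennreal ennreal_indicator epowr_indicator)
      have "(D + 1) * epowr (emeasure M E) (1 / q) = Lnorm (ennreal q) M (\<lambda>x. (D + 1) * ennreal (indicator E x))"
        unfolding e[symmetric] using pq by (intro Lnorm_cmult_finite[symmetric]) (auto intro: measurable_completion)
      also have "\<dots> \<le> Lnorm (ennreal q) M (\<lambda>x. ennreal (indicator E x) * n x)"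
        by (rule Lnorm_mono_AE) (auto simp: E_def indicator_def intro!: measurable_completion)
      also have "\<dots> \<le> D * Lnorm (ennreal p) M (\<lambda>x. ennreal (indicator E x))"
        by (rule bound) (use e Efin in simp_all)
      also have "\<dots> = D * epowr (emeasure M E) (1 / q)" using e by simp
      finally have "D * epowr (emeasure M E) (1 / q) + epowr (emeasure M E) (1 / q) \<le> D * epowr (emeasure M E) (1 / q) + 0"
        by (simp add: distrib_right)
      then have "epowr (emeasure M E) (1 / q) = 0"
        using D Efin by (subst (asm) ennreal_add_left_cancel_le) (auto simp: ennreal_mult_eq_top_iff less_top[symmetric])
      then have "E \<in> null_sets M" by auto
      then show ?thesis
        by (rule AE_I') (auto simp: E_def not_le)
    qed
    then have "AE x in M. \<forall>k. x \<in> A k \<longrightarrow> n x \<le> D + 1" unfolding AE_all_countable by blast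
    with AE_space have "AE x in M. n x \<le> D + 1"
      by eventually_elim (use A(2) in auto)
    then have "esssup (completion M) n \<le> D + 1"
      by (intro esssup_I measurable_completion AE_completion) auto
    also have "\<dots> < top" using D by simp
    finally show ?thesis by (simp add: Lnorm_top)
  qed
qed

section \<open>Mixed norms over a product of two sigma-finite measures\<close>

context pair_sigma_finite
begin

text \<open>A function measurable for the completed product may have nonmeasurable slices. Replacing
  it by a version measurable for the product itself changes almost every slice only on a null set,
  which leaves all mixed norms unchanged.\<close>

lemma completion_pair_AE_version:
  fixes F :: "_ \<Rightarrow> ennreal"
  assumes "F \<in> borel_measurable (completion (M1 \<Otimes>\<^sub>M M2))"
  obtains F' where "F' \<in> borel_measurable (M1 \<Otimes>\<^sub>M M2)" "AE z in M1 \<Otimes>\<^sub>M M2. F z = F' z"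
    "AE s in M1. AE x in M2. F (s, x) = F' (s, x)"
  using completion_ex_borel_measurable[OF assms] AE_pair by blast

lemma Lnorm_Lnorm_cong_AE:
  assumes "AE s in M1. AE x in M2. F (s, x) = G (s, x)"
  shows "Lnorm p M1 (\<lambda>s. Lnorm b M2 (\<lambda>x. F (s, x))) = Lnorm p M1 (\<lambda>s. Lnorm b M2 (\<lambda>x. G (s, x)))"
proof (rule Lnorm_cong_AE)
  show "AE s in M1. Lnorm b M2 (\<lambda>x. F (s, x)) = Lnorm b M2 (\<lambda>x. G (s, x))"
    using assms by eventually_elim (rule Lnorm_cong_AE)
qed

lemma AE_measurable_slice:
  fixes F :: "_ \<Rightarrow> ennreal"
  assumes F: "F \<in> borel_measurable (completion (M1 \<Otimes>\<^sub>M M2))"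
  shows "AE s in M1. (\<lambda>x. F (s, x)) \<in> borel_measurable (completion M2)"
proof -
  obtain F' where [measurable]: "F' \<in> borel_measurable (M1 \<Otimes>\<^sub>M M2)" and "AE s in M1. AE x in M2. F (s, x) = F' (s, x)"
    using completion_pair_AE_version[OF F] by blast
  from this(2) AE_space show ?thesis
  proof eventually_elim
    case (elim s)
    from elim have *: "AE x in M2. F' (s, x) = F (s, x)" by (auto elim: eventually_mono)
    show ?case
      by (rule measurable_completion_cong_AE[OF *]) (use elim in \<open>intro measurable_completion, measurable\<close>)
  qed
qed

text \<open>For a finite exponent this is Tonelli's theorem. For the essential supremum, the fibre
  norm exceeds \<open>c\<close> exactly when the fibre of the superlevel set has positive measure,
  and the measure of a fibre depends measurably on the base point.\<close>

lemma borel_measurable_Lnorm_slice: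
  fixes F :: "_ \<Rightarrow> ennreal"
  assumes [measurable]: "F \<in> borel_measurable (M1 \<Otimes>\<^sub>M M2)" and p: "p = \<infinity> \<or> (\<exists>a>0. p = ennreal a)"
  shows "(\<lambda>s. Lnorm p M2 (\<lambda>x. F (s, x))) \<in> borel_measurable M1"
proof (cases "p = \<infinity>")
  case True
  show ?thesis
  proof (rule borel_measurableI_greater)
    fix c :: ennreal
    have "{s \<in> space M1. c < Lnorm p M2 (\<lambda>x. F (s, x))} = {s \<in> space M1. 0 < emeasure M2 {x \<in> space M2. c < F (s, x)}}"
    proof safe
      fix s assume s: "s \<in> space M1"
      have [measurable]: "(\<lambda>x. F (s, x)) \<in> borel_measurable M2" using s by measurable
      have L: "Lnorm p M2 (\<lambda>x. F (s, x)) = esssup M2 (\<lambda>x. F (s, x))"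
        using True by (simp add: Lnorm_top esssup_completion)
      {
        assume "c < Lnorm p M2 (\<lambda>x. F (s, x))"
        then show "0 < emeasure M2 {x \<in> space M2. c < F (s, x)}"
          unfolding L by (intro esssup_pos_measure) measurable
      next
        assume pos: "0 < emeasure M2 {x \<in> space M2. c < F (s, x)}"
        show "c < Lnorm p M2 (\<lambda>x. F (s, x))"
        proof (rule ccontr)
          assume "\<not> ?thesis"
          then have "AE x in M2. \<not> c < F (s, x)"
            using esssup_AE[of "\<lambda>x. F (s, x)" M2] unfolding L by (auto elim!: eventually_mono)
          then show False using pos by (subst (asm) AE_iff_measurable[OF _ refl]) auto
        qed
      }
    qed
    also have "\<dots> \<in> sets M1" by measurable
    finally show "{s \<in> space M1. c < Lnorm p M2 (\<lambda>x. F (s, x))} \<in> sets M1" .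
  qed
next
  case False
  then obtain a where "a > 0" "p = ennreal a" using p by auto
  then show ?thesis by (simp add: Lnorm_ennreal)
qed

lemma completion_measurable_Lnorm_slice:
  fixes F :: "_ \<Rightarrow> ennreal"
  assumes F: "F \<in> borel_measurable (completion (M1 \<Otimes>\<^sub>M M2))" and p: "p = \<infinity> \<or> (\<exists>a>0. p = ennreal a)"
  shows "(\<lambda>s. Lnorm p M2 (\<lambda>x. F (s, x))) \<in> borel_measurable (completion M1)"
proof -
  obtain F' where F': "F' \<in> borel_measurable (M1 \<Otimes>\<^sub>M M2)" and "AE s in M1. AE x in M2. F (s, x) = F' (s, x)"
    using completion_pair_AE_version[OF F] by blast
  then have "AE s in M1. Lnorm p M2 (\<lambda>x. F' (s, x)) = Lnorm p M2 (\<lambda>x. F (s, x))"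
    by (elim eventually_mono, intro Lnorm_cong_AE) (auto elim: eventually_mono)
  then show ?thesis
    by (rule measurable_completion_cong_AE) (intro measurable_completion borel_measurable_Lnorm_slice F' p)
qed

lemma Lnorm_Lnorm_holder:
  fixes F W :: "_ \<Rightarrow> ennreal"
  assumes F: "F \<in> borel_measurable (completion (M1 \<Otimes>\<^sub>M M2))" and W: "W \<in> borel_measurable (completion (M1 \<Otimes>\<^sub>M M2))"
    and pq: "0 < q" "q \<le> p" and ab: "0 < a" "a \<le> b"
    and \<kappa>: "\<kappa> = (if q < p then ennreal (p * q / (p - q)) else \<infinity>)"
    and \<gamma>: "\<gamma> = (if a < b then ennreal (b * a / (b - a)) else \<infinity>)"
  shows "Lnorm (ennreal q) M1 (\<lambda>s. Lnorm (ennreal a) M2 (\<lambda>x. F (s, x) * W (s, x)))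
    \<le> Lnorm (ennreal p) M1 (\<lambda>s. Lnorm (ennreal b) M2 (\<lambda>x. F (s, x)))
      * Lnorm \<kappa> M1 (\<lambda>s. Lnorm \<gamma> M2 (\<lambda>x. W (s, x)))"
proof -
  have \<gamma>': "\<gamma> = \<infinity> \<or> (\<exists>a>0. \<gamma> = ennreal a)" using \<gamma> ab by (auto intro!: exI[of _ "b * a / (b - a)"])
  have b: "ennreal b = \<infinity> \<or> (\<exists>a>0. ennreal b = ennreal a)" and a: "ennreal a = \<infinity> \<or> (\<exists>a'>0. ennreal a = ennreal a')"
    using ab by (auto intro: exI[of _ a] exI[of _ b])
  have FW: "(\<lambda>z. F z * W z) \<in> borel_measurable (completion (M1 \<Otimes>\<^sub>M M2))" using F W by measurable
  have "Lnorm (ennreal q) M1 (\<lambda>s. Lnorm (ennreal a) M2 (\<lambda>x. F (s, x) * W (s, x)))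
    \<le> Lnorm (ennreal q) M1 (\<lambda>s. Lnorm (ennreal b) M2 (\<lambda>x. F (s, x)) * Lnorm \<gamma> M2 (\<lambda>x. W (s, x)))"
  proof (rule Lnorm_mono_AE[OF completion_measurable_Lnorm_slice[OF FW a]])
    show "AE s in M1. Lnorm (ennreal a) M2 (\<lambda>x. F (s, x) * W (s, x))
      \<le> Lnorm (ennreal b) M2 (\<lambda>x. F (s, x)) * Lnorm \<gamma> M2 (\<lambda>x. W (s, x))"
      using AE_measurable_slice[OF F] AE_measurable_slice[OF W]
      by eventually_elim (rule Lnorm_holder[OF _ _ ab \<gamma>])
  qed
  also have "\<dots> \<le> Lnorm (ennreal p) M1 (\<lambda>s. Lnorm (ennreal b) M2 (\<lambda>x. F (s, x)))
      * Lnorm \<kappa> M1 (\<lambda>s. Lnorm \<gamma> M2 (\<lambda>x. W (s, x)))"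
    by (intro Lnorm_holder completion_measurable_Lnorm_slice F W b \<gamma>' pq \<kappa>)
  finally show ?thesis .
qed

end

text \<open>Choosing an extremal function separately in each fibre would lose joint measurability,
  hence the explicit formulas. For a finite \<open>\<gamma>\<close> they attain the fibre norm
  itself; the factor 1/2 in the conclusion is needed for the essential supremum.\<close>

lemma (in pair_sigma_finite) Lnorm_near_extremal:
  fixes w :: "_ \<Rightarrow> ennreal"
  assumes w[measurable]: "w \<in> borel_measurable (M1 \<Otimes>\<^sub>M M2)" and ab: "0 < a" "a \<le> b"
    and \<gamma>: "\<gamma> = (if a < b then ennreal (b * a / (b - a)) else \<infinity>)"
    and fin: "AE s in M1. Lnorm \<gamma> M2 (\<lambda>x. w (s, x)) < \<infinity>"
  obtains e :: "_ \<Rightarrow> real" where "e \<in> borel_measurable (M1 \<Otimes>\<^sub>M M2)" "\<And>z. 0 \<le> e z"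
    "AE s in M1. Lnorm (ennreal b) M2 (\<lambda>x. ennreal (e (s, x))) \<le> 1"
    "AE s in M1. Lnorm \<gamma> M2 (\<lambda>x. w (s, x)) / 2 \<le> Lnorm (ennreal a) M2 (\<lambda>x. ennreal (e (s, x)) * w (s, x))"
proof -
  define N where "N s = Lnorm \<gamma> M2 (\<lambda>x. w (s, x))" for s
  have \<gamma>': "\<gamma> = \<infinity> \<or> (\<exists>a>0. \<gamma> = ennreal a)" using \<gamma> ab by (auto intro!: exI[of _ "b * a / (b - a)"])
  have [measurable]: "N \<in> borel_measurable M1"
    unfolding N_def by (rule borel_measurable_Lnorm_slice[OF w \<gamma>'])
  have ex: "\<exists>e'. e' \<in> borel_measurable (M1 \<Otimes>\<^sub>M M2) \<and>
    (\<forall>s\<in>space M1. N s < \<infinity> \<longrightarrow> (AE x in M2. e' (s, x) < \<infinity>) \<and> Lnorm (ennreal b) M2 (\<lambda>x. e' (s, x)) \<le> 1 \<and>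
      N s / 2 \<le> Lnorm (ennreal a) M2 (\<lambda>x. e' (s, x) * w (s, x)))"
  proof (cases "a < b")
    case True
    define c where "c = b * a / (b - a)"
    have c: "0 < c" "\<gamma> = ennreal c" using True ab \<gamma> by (auto simp: c_def)
    have b: "0 < b" using ab by simp
    have ca: "(c / b + 1) * a = c" using True ab by (simp add: c_def field_simps)
    have cab: "1 / a = 1 / c + 1 / b" using True ab by (simp add: c_def field_simps)
    have Nc: "N s = epowr (\<integral>\<^sup>+x. epowr (w (s, x)) c \<partial>M2) (1 / c)" for s
      using c by (simp add: N_def Lnorm_ennreal)
    then have Nc': "(\<integral>\<^sup>+x. epowr (w (s, x)) c \<partial>M2) = epowr (N s) c" for s
      using c by (simp add: epowr_epowr)
    \<comment> \<open>The equality case of Hoelder's inequality, scaled to norm 1. Where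
      \<open>N\<close> vanishes, \<open>epowr 0\<close> is 0 for negative exponents too, so
      \<open>e'\<close> is 0 there and the claims hold trivially.\<close>
    define e' where "e' z = epowr (N (fst z)) (- (c / b)) * epowr (w z) (c / b)" for z
    have [measurable]: "e' \<in> borel_measurable (M1 \<Otimes>\<^sub>M M2)" unfolding e'_def by measurable
    show ?thesis
    proof (intro exI[of _ e'] conjI ballI impI)
      fix s assume s: "s \<in> space M1" and Ns: "N s < \<infinity>"
      have [measurable]: "(\<lambda>x. w (s, x)) \<in> borel_measurable M2" using s by measurable
      show "AE x in M2. e' (s, x) < \<infinity>"
      proof (cases "N s = 0")
        case False
        have "AE x in M2. w (s, x) < \<infinity>"
          by (rule Lnorm_less_topD[OF measurable_completion \<gamma>']) (use Ns in \<open>auto simp: N_def\<close>)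
        then show ?thesis
          using Ns False by (auto simp: e'_def ennreal_mult_less_top elim!: eventually_mono)
      qed (simp add: e'_def)
      have "Lnorm (ennreal b) M2 (\<lambda>x. e' (s, x)) = epowr (N s) (- (c / b)) * epowr (N s) (c / b)"
        unfolding e'_def using b
        by (simp add: Lnorm_cmult_finite measurable_completion) (simp add: Lnorm_ennreal epowr_epowr Nc')
      also have "\<dots> \<le> 1"
        using epowr_minus_cancel[of "N s" "- (c / b)"] Ns by (cases "N s = 0") auto
      finally show "Lnorm (ennreal b) M2 (\<lambda>x. e' (s, x)) \<le> 1" .
      have "e' (s, x) * w (s, x) = epowr (N s) (- (c / b)) * epowr (w (s, x)) (c / b + 1)" for x
        by (simp add: e'_def epowr_add mult.assoc)
      then have "Lnorm (ennreal a) M2 (\<lambda>x. e' (s, x) * w (s, x)) = epowr (N s) (- (c / b)) * epowr (N s) (c / a)"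
        using ab ca by (simp add: Lnorm_cmult_finite measurable_completion) (simp add: Lnorm_ennreal epowr_epowr Nc')
      also have "\<dots> = epowr (N s) (- (c / b) + c / a)" by (rule epowr_add[symmetric])
      also have "- (c / b) + c / a = 1"
        using arg_cong[OF cab, of "\<lambda>z. c * z"] c by (simp add: distrib_left)
      also have "epowr (N s) 1 = N s" by simp
      finally show "N s / 2 \<le> Lnorm (ennreal a) M2 (\<lambda>x. e' (s, x) * w (s, x))"
        by (cases "N s") (auto simp: ennreal_divide_numeral intro!: ennreal_leI)
    qed measurable
  next
    case False
    then have [simp]: "b = a" "\<gamma> = top" using ab \<gamma> by auto
    \<comment> \<open>A strictly positive integrable weight: the fibres of \<open>E\<close> below
      may have infinite measure, but their \<open>h\<close>-mass \<open>I\<close> is finite and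
      vanishes only if the fibre is null.\<close>
    obtain h where h[measurable]: "h \<in> borel_measurable M2" and hfin: "integral\<^sup>N M2 h \<noteq> \<infinity>"
      and hpos: "\<And>x. x \<in> space M2 \<Longrightarrow> 0 < h x \<and> h x < \<infinity>"
      using M2.Ex_finite_integrable_function by blast
    \<comment> \<open>Half of the essential supremum is exceeded on a set of positive measure as
      long as \<open>N\<close> is positive and finite; \<open>e'\<close> is concentrated there and
      normalised.\<close>
    define E where "E = {z \<in> space (M1 \<Otimes>\<^sub>M M2). N (fst z) / 2 < w z}"
    have [measurable]: "E \<in> sets (M1 \<Otimes>\<^sub>M M2)" unfolding E_def by measurable
    define I where "I s = (\<integral>\<^sup>+x. h x * indicator E (s, x) \<partial>M2)" for s
    have [measurable]: "I \<in> borel_measurable M1" unfolding I_def by measurable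
    define e' where "e' z = epowr (I (fst z)) (- (1 / a)) * epowr (h (snd z) * indicator E z) (1 / a)" for z
    have [measurable]: "e' \<in> borel_measurable (M1 \<Otimes>\<^sub>M M2)" unfolding e'_def by measurable
    show ?thesis
    proof (intro exI[of _ e'] conjI ballI impI)
      fix s assume s: "s \<in> space M1" and Ns: "N s < \<infinity>"
      have [measurable]: "(\<lambda>x. w (s, x)) \<in> borel_measurable M2" using s by measurable
      have [measurable]: "(\<lambda>x. h x * indicator E (s, x)) \<in> borel_measurable M2" using s by measurable
      have Ile: "I s \<le> integral\<^sup>N M2 h"
        unfolding I_def by (intro nn_integral_mono) (auto simp: indicator_def)
      have Ifin: "I s < \<infinity>" using Ile hfin by (simp add: less_top[symmetric] top_unique) (metis top_unique)
      have L: "Lnorm (ennreal a) M2 (\<lambda>x. e' (s, x)) = epowr (I s) (- (1 / a)) * epowr (I s) (1 / a)"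
        unfolding e'_def using ab
        by (simp add: Lnorm_cmult_finite measurable_completion) (simp add: Lnorm_ennreal epowr_epowr I_def)
      show "AE x in M2. e' (s, x) < \<infinity>"
        using AE_space
      proof eventually_elim
        case (elim x)
        then show ?case using hpos[OF elim] Ifin
          by (auto simp: e'_def ennreal_mult_less_top indicator_def)
      qed
      show "Lnorm (ennreal b) M2 (\<lambda>x. e' (s, x)) \<le> 1"
        using epowr_minus_cancel[of "I s" "- (1 / a)"] Ifin L by (cases "I s = 0") auto
      show "N s / 2 \<le> Lnorm (ennreal a) M2 (\<lambda>x. e' (s, x) * w (s, x))"
      proof (cases "N s = 0")
        case True
        then show ?thesis by simp
      next
        case False
        have "N s = esssup M2 (\<lambda>x. w (s, x))"
          by (simp add: N_def Lnorm_top esssup_completion)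
        moreover have "N s / 2 < N s"
          using False Ns by (cases "N s") (auto simp: ennreal_divide_numeral ennreal_less_iff)
        ultimately have "0 < emeasure M2 {x \<in> space M2. N s / 2 < w (s, x)}"
          by (intro esssup_pos_measure) auto
        then have "\<not> (AE x in M2. \<not> N s / 2 < w (s, x))"
          by (subst AE_iff_measurable[OF _ refl]) auto
        moreover have "I s = 0 \<Longrightarrow> AE x in M2. \<not> N s / 2 < w (s, x)"
        proof -
          assume "I s = 0"
          then have "AE x in M2. h x * indicator E (s, x) = 0"
            unfolding I_def by (subst (asm) nn_integral_0_iff_AE) auto
          then show ?thesis using AE_space
          proof eventually_elim
            case (elim x)
            then show ?case using hpos[of x] s by (auto simp: E_def space_pair_measure indicator_def split: if_splits)
          qed
        qed
        ultimately have "I s \<noteq> 0" by auto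
        then have L1: "Lnorm (ennreal a) M2 (\<lambda>x. e' (s, x)) = 1"
          using epowr_minus_cancel[of "I s" "- (1 / a)"] Ifin L by auto
        have "N s / 2 = Lnorm (ennreal a) M2 (\<lambda>x. (N s / 2) * e' (s, x))"
          using ab s by (simp add: Lnorm_cmult_finite measurable_completion L1)
        also have "\<dots> \<le> Lnorm (ennreal a) M2 (\<lambda>x. e' (s, x) * w (s, x))"
        proof (rule Lnorm_mono_AE)
          have "(N s / 2) * e' (s, x) \<le> e' (s, x) * w (s, x)" for x
            by (cases "(s, x) \<in> E") (auto simp: e'_def E_def mult.commute[of "N s / 2"] intro!: mult_left_mono)
          then show "AE x in M2. (N s / 2) * e' (s, x) \<le> e' (s, x) * w (s, x)" by simp
        qed (use s in \<open>intro measurable_completion, measurable\<close>)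
        finally show ?thesis .
      qed
    qed measurable
  qed
  then obtain e' where e'[measurable]: "e' \<in> borel_measurable (M1 \<Otimes>\<^sub>M M2)"
    and e'_props: "\<And>s. s \<in> space M1 \<Longrightarrow> N s < \<infinity> \<Longrightarrow> (AE x in M2. e' (s, x) < \<infinity>) \<and>
      Lnorm (ennreal b) M2 (\<lambda>x. e' (s, x)) \<le> 1 \<and> N s / 2 \<le> Lnorm (ennreal a) M2 (\<lambda>x. e' (s, x) * w (s, x))"
    by blast
  \<comment> \<open>The functions tested later are real-valued; since \<open>e'\<close> is finite
    almost everywhere in the fibre, \<open>enn2real\<close> changes neither norm.\<close>
  have key: "Lnorm (ennreal b) M2 (\<lambda>x. ennreal (enn2real (e' (s, x)))) \<le> 1 \<and>
      N s / 2 \<le> Lnorm (ennreal a) M2 (\<lambda>x. ennreal (enn2real (e' (s, x))) * w (s, x))"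
    if "s \<in> space M1" "N s < \<infinity>" for s
  proof -
    have fin: "AE x in M2. e' (s, x) < \<infinity>" using e'_props[OF that] by blast
    have "Lnorm (ennreal b) M2 (\<lambda>x. ennreal (enn2real (e' (s, x)))) = Lnorm (ennreal b) M2 (\<lambda>x. e' (s, x))"
      using fin by (intro Lnorm_cong_AE) (auto elim!: eventually_mono)
    moreover have "Lnorm (ennreal a) M2 (\<lambda>x. ennreal (enn2real (e' (s, x))) * w (s, x)) = Lnorm (ennreal a) M2 (\<lambda>x. e' (s, x) * w (s, x))"
      using fin by (intro Lnorm_cong_AE) (auto elim!: eventually_mono)
    ultimately show ?thesis using e'_props[OF that] by simp
  qed
  have AE1: "AE s in M1. s \<in> space M1 \<and> N s < \<infinity>" using fin AE_space unfolding N_def by eventually_elim auto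
  show ?thesis
  proof (rule that[of "\<lambda>z. enn2real (e' z)"])
    show "AE s in M1. Lnorm (ennreal b) M2 (\<lambda>x. ennreal (enn2real (e' (s, x)))) \<le> 1"
      using AE1 by eventually_elim (use key in auto)
    show "AE s in M1. Lnorm \<gamma> M2 (\<lambda>x. w (s, x)) / 2 \<le> Lnorm (ennreal a) M2 (\<lambda>x. ennreal (enn2real (e' (s, x))) * w (s, x))"
      using AE1 by eventually_elim (use key in \<open>auto simp: N_def\<close>)
  qed auto
qed

text \<open>Products \<open>u s * e (s, x)\<close>, with \<open>e\<close> nearly extremal in the
  fibres, turn the hypothesis into a one-variable estimate for the fibre norm \<open>N\<close> of
  the weight, to which \<open>Lnorm_converse_holder\<close> applies. The factor 1/2 from
  \<open>e\<close> turns the constant \<open>D\<close> into \<open>2 * D\<close>.\<close>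

lemma (in pair_sigma_finite) Lnorm_Lnorm_converse_holder:
  fixes W :: "_ \<Rightarrow> ennreal"
  assumes W: "W \<in> borel_measurable (completion (M1 \<Otimes>\<^sub>M M2))"
    and pq: "0 < q" "q \<le> p" and ab: "0 < a" "a \<le> b"
    and \<kappa>: "\<kappa> = (if q < p then ennreal (p * q / (p - q)) else \<infinity>)"
    and \<gamma>: "\<gamma> = (if a < b then ennreal (b * a / (b - a)) else \<infinity>)"
    and fin: "AE s in M1. Lnorm \<gamma> M2 (\<lambda>x. W (s, x)) < \<infinity>" and D: "D < \<infinity>"
    and bound: "\<And>f :: _ \<Rightarrow> real. f \<in> borel_measurable (M1 \<Otimes>\<^sub>M M2) \<Longrightarrow> (\<And>z. 0 \<le> f z) \<Longrightarrow>
      Lnorm (ennreal p) M1 (\<lambda>s. Lnorm (ennreal b) M2 (\<lambda>x. ennreal (f (s, x)))) < \<infinity> \<Longrightarrow>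
      Lnorm (ennreal q) M1 (\<lambda>s. Lnorm (ennreal a) M2 (\<lambda>x. ennreal (f (s, x)) * W (s, x)))
        \<le> D * Lnorm (ennreal p) M1 (\<lambda>s. Lnorm (ennreal b) M2 (\<lambda>x. ennreal (f (s, x))))"
  shows "Lnorm \<kappa> M1 (\<lambda>s. Lnorm \<gamma> M2 (\<lambda>x. W (s, x))) < \<infinity>"
proof -
  obtain w where w[measurable]: "w \<in> borel_measurable (M1 \<Otimes>\<^sub>M M2)" and Ww: "AE s in M1. AE x in M2. W (s, x) = w (s, x)"
    using completion_pair_AE_version[OF W] by blast
  have \<gamma>': "\<gamma> = \<infinity> \<or> (\<exists>a>0. \<gamma> = ennreal a)" using \<gamma> ab by (auto intro!: exI[of _ "b * a / (b - a)"])
  have a': "ennreal a = \<infinity> \<or> (\<exists>a'>0. ennreal a = ennreal a')" using ab by (auto intro: exI[of _ a])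
  have b': "ennreal b = \<infinity> \<or> (\<exists>a'>0. ennreal b = ennreal a')" using ab by (auto intro: exI[of _ b])
  define N where "N s = Lnorm \<gamma> M2 (\<lambda>x. w (s, x))" for s
  have [measurable]: "N \<in> borel_measurable M1"
    unfolding N_def by (rule borel_measurable_Lnorm_slice[OF w \<gamma>'])
  have WN: "AE s in M1. Lnorm \<gamma> M2 (\<lambda>x. W (s, x)) = N s"
    using Ww unfolding N_def by eventually_elim (rule Lnorm_cong_AE)
  have Nfin: "AE s in M1. N s < \<infinity>" using fin WN by eventually_elim simp
  obtain e :: "_ \<Rightarrow> real" where e[measurable]: "e \<in> borel_measurable (M1 \<Otimes>\<^sub>M M2)" and e0: "\<And>z. 0 \<le> e z"
    and e1: "AE s in M1. Lnorm (ennreal b) M2 (\<lambda>x. ennreal (e (s, x))) \<le> 1"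
    and e2: "AE s in M1. N s / 2 \<le> Lnorm (ennreal a) M2 (\<lambda>x. ennreal (e (s, x)) * w (s, x))"
    using Lnorm_near_extremal[OF w ab \<gamma> Nfin[unfolded N_def]] unfolding N_def[symmetric] by blast
  have "Lnorm \<kappa> M1 N < \<infinity>"
  proof (rule Lnorm_converse_holder[OF M1.sigma_finite_measure_axioms _ Nfin _ pq \<kappa>])
    show "2 * D < \<infinity>" using D by (simp add: ennreal_mult_less_top)
    fix u :: "'a \<Rightarrow> real" assume u[measurable]: "u \<in> borel_measurable M1" and u0: "\<And>x. 0 \<le> u x"
      and ufin: "Lnorm (ennreal p) M1 (\<lambda>x. ennreal (u x)) < \<infinity>"
    define f where "f z = u (fst z) * e z" for z
    have [measurable]: "f \<in> borel_measurable (M1 \<Otimes>\<^sub>M M2)" unfolding f_def by measurable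
    have f0: "0 \<le> f z" for z using u0 e0 by (simp add: f_def)
    have fe: "ennreal (f (s, x)) = ennreal (u s) * ennreal (e (s, x))" for s x
      using u0 e0 by (simp add: f_def ennreal_mult)
    have fp: "Lnorm (ennreal p) M1 (\<lambda>s. Lnorm (ennreal b) M2 (\<lambda>x. ennreal (f (s, x)))) \<le> Lnorm (ennreal p) M1 (\<lambda>x. ennreal (u x))"
    proof (rule Lnorm_mono_AE)
      show "AE s in M1. Lnorm (ennreal b) M2 (\<lambda>x. ennreal (f (s, x))) \<le> ennreal (u s)"
        using e1 AE_space
      proof eventually_elim
        case (elim s)
        then have "Lnorm (ennreal b) M2 (\<lambda>x. ennreal (f (s, x))) = ennreal (u s) * Lnorm (ennreal b) M2 (\<lambda>x. ennreal (e (s, x)))"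
          unfolding fe using ab by (intro Lnorm_cmult_finite measurable_completion) auto
        also have "\<dots> \<le> ennreal (u s) * 1" using elim by (intro mult_left_mono) auto
        finally show ?case by simp
      qed
    qed (intro measurable_completion borel_measurable_Lnorm_slice b', measurable)
    have "Lnorm (ennreal q) M1 (\<lambda>x. ennreal (u x) * N x)
        \<le> Lnorm (ennreal q) M1 (\<lambda>s. 2 * Lnorm (ennreal a) M2 (\<lambda>x. ennreal (f (s, x)) * w (s, x)))"
    proof (rule Lnorm_mono_AE)
      show "AE s in M1. ennreal (u s) * N s \<le> 2 * Lnorm (ennreal a) M2 (\<lambda>x. ennreal (f (s, x)) * w (s, x))"
        using e2 AE_space Nfin
      proof eventually_elim
        case (elim s)
        then have eq: "Lnorm (ennreal a) M2 (\<lambda>x. ennreal (f (s, x)) * w (s, x)) = ennreal (u s) * Lnorm (ennreal a) M2 (\<lambda>x. ennreal (e (s, x)) * w (s, x))"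
          unfolding fe mult.assoc using ab by (intro Lnorm_cmult_finite measurable_completion) auto
        have "ennreal (u s) * N s = 2 * (ennreal (u s) * (N s / 2))"
        proof -
          have "2 * (N s / 2) = N s"
            using elim by (cases "N s") (auto simp: ennreal_divide_numeral mult_2 ennreal_plus[symmetric] simp del: ennreal_plus)
          then show ?thesis by (metis mult.left_commute)
        qed
        also have "\<dots> \<le> 2 * (ennreal (u s) * Lnorm (ennreal a) M2 (\<lambda>x. ennreal (e (s, x)) * w (s, x)))"
          using elim by (intro mult_left_mono) auto
        finally show ?case unfolding eq .
      qed
    qed (intro measurable_completion, measurable)
    also have "\<dots> = 2 * Lnorm (ennreal q) M1 (\<lambda>s. Lnorm (ennreal a) M2 (\<lambda>x. ennreal (f (s, x)) * w (s, x)))"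
      using pq by (intro Lnorm_cmult_finite measurable_completion borel_measurable_Lnorm_slice a') auto
    also have "Lnorm (ennreal q) M1 (\<lambda>s. Lnorm (ennreal a) M2 (\<lambda>x. ennreal (f (s, x)) * w (s, x)))
      = Lnorm (ennreal q) M1 (\<lambda>s. Lnorm (ennreal a) M2 (\<lambda>x. ennreal (f (s, x)) * W (s, x)))"
      using Ww by (intro Lnorm_Lnorm_cong_AE[where F="\<lambda>z. ennreal (f z) * w z"]) (auto elim!: eventually_mono)
    also have "2 * \<dots> \<le> 2 * (D * Lnorm (ennreal p) M1 (\<lambda>s. Lnorm (ennreal b) M2 (\<lambda>x. ennreal (f (s, x)))))"
      using fp ufin f0 by (intro mult_left_mono bound) auto
    also have "\<dots> \<le> 2 * (D * Lnorm (ennreal p) M1 (\<lambda>x. ennreal (u x)))"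
      using fp by (intro mult_left_mono) auto
    finally show "Lnorm (ennreal q) M1 (\<lambda>x. ennreal (u x) * N x) \<le> 2 * D * Lnorm (ennreal p) M1 (\<lambda>x. ennreal (u x))"
      by (simp add: mult.assoc)
  qed measurable
  then show ?thesis using Lnorm_cong_AE[OF WN, of \<kappa>] by simp
qed

section \<open>Balls, regularity and differentiation in homogeneous spaces\<close>

lemma qopen_UN: "(\<And>i. i \<in> I \<Longrightarrow> qopen A d (V i)) \<Longrightarrow> qopen A d (\<Union>i\<in>I. V i)"
  unfolding qopen_def
proof (intro conjI ballI)
  fix t assume V: "\<And>i. i \<in> I \<Longrightarrow> V i \<subseteq> A \<and> (\<forall>t\<in>V i. \<exists>r>0. qball A d t r \<subseteq> V i)" and "t \<in> (\<Union>i\<in>I. V i)"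
  then obtain i r where "i \<in> I" "r > 0" "qball A d t r \<subseteq> V i" by blast
  then show "\<exists>r>0. qball A d t r \<subseteq> (\<Union>i\<in>I. V i)" by (intro exI[of _ r]) auto
qed auto

lemma qball_mono: "r \<le> r' \<Longrightarrow> qball A d t r \<subseteq> qball A d t r'"
  by (auto simp: qball_def)

lemma qopen_Int: "qopen A d V \<Longrightarrow> qopen A d W \<Longrightarrow> qopen A d (V \<inter> W)"
  unfolding qopen_def
proof safe
  fix t assume "\<forall>t\<in>V. \<exists>r>0. qball A d t r \<subseteq> V" "\<forall>t\<in>W. \<exists>r>0. qball A d t r \<subseteq> W" "t \<in> V" "t \<in> W"
  then obtain r r' where "r > 0" "qball A d t r \<subseteq> V" "r' > 0" "qball A d t r' \<subseteq> W" by blast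
  then show "\<exists>r>0. qball A d t r \<subseteq> V \<inter> W"
    using qball_mono[of "min r r'" r A d t] qball_mono[of "min r r'" r' A d t]
    by (intro exI[of _ "min r r'"]) auto
qed auto

lemma qopen_INT_atMost: "(\<And>i. qopen A d (V i)) \<Longrightarrow> qopen A d (\<Inter>i\<le>n::nat. V i)"
  by (induction n) (auto simp: atMost_Suc intro: qopen_Int)

locale homogeneous = sigma_finite_measure M for M :: "'a measure" +
  fixes d :: "'a \<Rightarrow> 'a \<Rightarrow> real" and c1 c2 :: real
  assumes d_refl: "x \<in> space M \<Longrightarrow> d x x = 0"
    and d_sym: "x \<in> space M \<Longrightarrow> y \<in> space M \<Longrightarrow> d x y = d y x"
    and c1_ge_1: "1 \<le> c1"
    and sets_eq_qopen: "sets M = sigma_sets (space M) {V. qopen (space M) d V}"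
    and qball_engulf: "t1 \<in> space M \<Longrightarrow> t2 \<in> space M \<Longrightarrow> 0 < r \<Longrightarrow>
      qball (space M) d t1 r \<inter> qball (space M) d t2 r \<noteq> {} \<Longrightarrow> qball (space M) d t2 r \<subseteq> qball (space M) d t1 (c1 * r)"
    and qball_sets: "t \<in> space M \<Longrightarrow> 0 < r \<Longrightarrow> qball (space M) d t r \<in> sets M"
    and qball_pos: "t \<in> space M \<Longrightarrow> 0 < r \<Longrightarrow> 0 < emeasure M (qball (space M) d t r)"
    and qball_finite: "t \<in> space M \<Longrightarrow> 0 < r \<Longrightarrow> emeasure M (qball (space M) d t r) < \<infinity>"
    and doubling: "t \<in> space M \<Longrightarrow> 0 < r \<Longrightarrow>
      emeasure M (qball (space M) d t (c1 * r)) \<le> ennreal c2 * emeasure M (qball (space M) d t r)"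

lemma homogeneous_spaceE:
  assumes "homogeneous_space M d"
  obtains c1 c2 where "homogeneous M d c1 c2"
proof -
  note h = assms[unfolded homogeneous_space_def quasimetric_on_def]
  have qm: "\<forall>x\<in>space M. \<forall>y\<in>space M. 0 \<le> d x y \<and> (d x y = 0 \<longleftrightarrow> x = y) \<and> d x y = d y x"
    using h by (elim conjE)
  have M: "sets M = sigma_sets (space M) {V. qopen (space M) d V}" using h by (elim conjE)
  have "sigma_finite_measure M" using h by (elim conjE)
  from h obtain c1 where c1: "1 \<le> c1" and
    e: "\<forall>t1\<in>space M. \<forall>t2\<in>space M. \<forall>r>0.
           qball (space M) d t1 r \<inter> qball (space M) d t2 r \<noteq> {} \<longrightarrow> qball (space M) d t2 r \<subseteq> qball (space M) d t1 (c1 * r)"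
    and b: "\<forall>t\<in>space M. \<forall>r>0. qball (space M) d t r \<in> sets M \<and>
           0 < emeasure M (qball (space M) d t r) \<and> emeasure M (qball (space M) d t r) < \<infinity>"
    and "\<exists>c2::real. \<forall>t\<in>space M. \<forall>r>0. emeasure M (qball (space M) d t (c1 * r)) \<le> ennreal c2 * emeasure M (qball (space M) d t r)"
    by (elim conjE exE) metis
  from this(4) obtain c2 :: real where
    db: "\<forall>t\<in>space M. \<forall>r>0. emeasure M (qball (space M) d t (c1 * r)) \<le> ennreal c2 * emeasure M (qball (space M) d t r)"
    by (elim exE)
  interpret sigma_finite_measure M by fact
  have "homogeneous M d c1 c2"
  proof
    show "d x x = 0" if "x \<in> space M" for x using qm that by blast
    show "d x y = d y x" if "x \<in> space M" "y \<in> space M" for x y using qm that by blast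
  qed (use M c1 e b db in \<open>auto\<close>)
  then show ?thesis by (rule that)
qed

context homogeneous
begin

section \<open>Engulfing, separability and a countable net of balls\<close>

abbreviation B :: "'a \<Rightarrow> real \<Rightarrow> 'a set" where "B \<equiv> qball (space M) d"

lemma B_subset_space: "B t r \<subseteq> space M"
  by (auto simp: qball_def)

lemma B_self: "t \<in> space M \<Longrightarrow> 0 < r \<Longrightarrow> t \<in> B t r"
  by (simp add: qball_def d_refl)

lemma B_sym: "x \<in> space M \<Longrightarrow> y \<in> B x r \<Longrightarrow> x \<in> B y r"
  by (auto simp: qball_def d_sym)

text \<open>Engulfing takes the part of the triangle inequality: moving the centre of a ball to
  another of its points costs a factor \<open>c1\<close> in the radius.\<close>

lemma B_engulf:
  assumes "x \<in> space M" "0 < r" "y \<in> B x r"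
  shows "B y r \<subseteq> B x (c1 * r)" "B x r \<subseteq> B y (c1 * r)"
proof -
  have "y \<in> space M" using assms(3) B_subset_space by auto
  moreover have "B x r \<inter> B y r \<noteq> {}" using B_self[OF \<open>y \<in> space M\<close> assms(2)] assms(3) by auto
  ultimately show "B y r \<subseteq> B x (c1 * r)" "B x r \<subseteq> B y (c1 * r)"
    using qball_engulf[of x y r] qball_engulf[of y x r] assms by (auto simp: Int_commute)
qed

lemma c1_pos: "0 < c1" using c1_ge_1 by simp

lemma B_c1: "0 < r \<Longrightarrow> B t r \<subseteq> B t (c1 * r)"
  using c1_ge_1 by (intro qball_mono) simp

lemma sets_qopen: "qopen (space M) d V \<Longrightarrow> V \<in> sets M"
  by (auto simp: sets_eq_qopen)

lemma qopen_space: "qopen (space M) d (space M)"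
  by (auto simp: qopen_def B_subset_space intro: exI[of _ 1])

text \<open>Zorn's lemma gives a maximal set of centres with disjoint \<open>r\<close>-balls. It is
  countable because these balls have positive mass for the finite measure \<open>density M h\<close>
  and the masses of disjoint sets are summable. Maximality is the last claim.\<close>

lemma ex_maximal_separated:
  assumes r: "0 < r"
  obtains Z where "countable Z" "Z \<subseteq> space M" "\<And>x. x \<in> space M \<Longrightarrow> \<exists>t\<in>Z. B t r \<inter> B x r \<noteq> {}"
proof -
  define F where "F = {Z. Z \<subseteq> space M \<and> disjoint_family_on (\<lambda>t. B t r) Z}"
  have "\<exists>Z\<in>F. \<forall>X\<in>F. Z \<subseteq> X \<longrightarrow> X = Z"
  proof (rule subset_Zorn)
    fix C assume C: "subset.chain F C"
    have "\<Union>C \<in> F"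
      unfolding F_def disjoint_family_on_def
    proof (intro CollectI conjI ballI impI)
      show "\<Union>C \<subseteq> space M" using C by (auto simp: subset_chain_def F_def)
      fix x y assume xy: "x \<in> \<Union>C" "y \<in> \<Union>C" "x \<noteq> y"
      then obtain X Y where "X \<in> C" "Y \<in> C" "x \<in> X" "y \<in> Y" by auto
      then obtain Z where "Z \<in> C" "x \<in> Z" "y \<in> Z" using C unfolding subset_chain_def by blast
      moreover from this have "disjoint_family_on (\<lambda>t. B t r) Z" using C by (auto simp: subset_chain_def F_def)
      ultimately show "B x r \<inter> B y r = {}" using xy unfolding disjoint_family_on_def by blast
    qed
    then show "\<exists>U\<in>F. \<forall>X\<in>C. X \<subseteq> U" by blast
  qed
  then obtain Z where Z: "Z \<in> F" and max: "\<And>X. X \<in> F \<Longrightarrow> Z \<subseteq> X \<Longrightarrow> X = Z" by blast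
  have Zs: "Z \<subseteq> space M" and dis: "disjoint_family_on (\<lambda>t. B t r) Z" using Z by (auto simp: F_def)
  obtain h where h[measurable]: "h \<in> borel_measurable M" and hfin: "integral\<^sup>N M h \<noteq> \<infinity>"
    and hpos: "\<And>x. x \<in> space M \<Longrightarrow> 0 < h x \<and> h x < \<infinity>"
    using Ex_finite_integrable_function by blast
  interpret h: finite_measure "density M h"
    using hfin by (intro finite_measureI) (simp add: emeasure_density cong: nn_integral_cong)
  let ?f = "\<lambda>t. measure (density M h) (B t r)"
  have "?f summable_on Z"
  proof (rule nonneg_bdd_above_summable_on)
    show "bdd_above (sum ?f ` {F. F \<subseteq> Z \<and> finite F})"
    proof (rule bdd_aboveI2)
      fix G assume G: "G \<in> {F. F \<subseteq> Z \<and> finite F}"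
      have "sum ?f G = measure (density M h) (\<Union>t\<in>G. B t r)"
        using G Zs disjoint_family_on_mono[OF _ dis, of G] r
        by (intro h.finite_measure_finite_Union[symmetric]) (auto intro!: qball_sets)
      also have "\<dots> \<le> measure (density M h) (space M)"
        using h.bounded_measure by simp
      finally show "sum ?f G \<le> measure (density M h) (space M)" .
    qed
  qed simp
  then have "countable {t \<in> Z. ?f t \<noteq> 0}" by (rule summable_countable_real)
  moreover have "?f t \<noteq> 0" if "t \<in> Z" for t
  proof
    assume "?f t = 0"
    then have "emeasure (density M h) (B t r) = 0" by (simp add: h.emeasure_eq_measure)
    then have "B t r \<in> null_sets (density M h)"
      using that Zs r by (auto intro!: null_setsI qball_sets)
    then have "AE x in M. x \<in> B t r \<longrightarrow> h x = 0" by (subst (asm) null_sets_density_iff) auto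
    with AE_space have "AE x in M. x \<notin> B t r"
      by eventually_elim (use hpos in fastforce)
    then have "emeasure M (B t r) = 0"
      using that Zs r by (subst (asm) AE_iff_measurable[OF qball_sets]) (auto simp: qball_def)
    then show False using qball_pos[of t r] that Zs r by auto
  qed
  ultimately have "countable Z" by (auto cong: conj_cong)
  moreover have "\<exists>t\<in>Z. B t r \<inter> B x r \<noteq> {}" if x: "x \<in> space M" for x
  proof (rule ccontr)
    assume *: "\<not> (\<exists>t\<in>Z. B t r \<inter> B x r \<noteq> {})"
    then have "insert x Z \<in> F" using Zs dis x
      by (auto simp: F_def disjoint_family_on_def Int_commute)
    from max[OF this] have "x \<in> Z" by auto
    then show False using * B_self[OF x r] by blast
  qed
  ultimately show ?thesis using Zs that by blast
qed

lemma ex_countable_dense: "\<exists>D. countable D \<and> D \<subseteq> space M \<and> (\<forall>x\<in>space M. \<forall>r>0. \<exists>t\<in>D. t \<in> B x r)"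
proof -
  have "\<exists>Z. countable Z \<and> Z \<subseteq> space M \<and> (\<forall>x\<in>space M. \<exists>t\<in>Z. B t (1 / Suc n) \<inter> B x (1 / Suc n) \<noteq> {})" for n :: nat
    using ex_maximal_separated[of "1 / Suc n"] by (metis of_nat_0_less_iff zero_less_Suc zero_less_divide_1_iff)
  then obtain Z where Z: "\<And>n. countable (Z n)" "\<And>n. Z n \<subseteq> space M"
    "\<And>n x. x \<in> space M \<Longrightarrow> \<exists>t\<in>Z n. B t (1 / Suc n) \<inter> B x (1 / Suc n) \<noteq> {}"
    by metis
  show ?thesis
  proof (intro exI[of _ "\<Union>n. Z n"] conjI ballI allI impI)
    fix x r assume x: "x \<in> space M" and r: "0 < (r :: real)"
    obtain n :: nat where n: "1 / Suc n < r / c1"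
      using reals_Archimedean[of "r / c1"] r c1_pos by (auto simp: inverse_eq_divide)
    from Z(3)[OF x, of n] obtain t where t: "t \<in> Z n" "B t (1 / Suc n) \<inter> B x (1 / Suc n) \<noteq> {}" by blast
    then have "B t (1 / Suc n) \<subseteq> B x (c1 * (1 / Suc n))"
      using x Z(2) by (intro qball_engulf) auto
    also have "\<dots> \<subseteq> B x r"
      using n c1_pos by (intro qball_mono) (simp add: field_simps)
    finally have "t \<in> B x r" using B_self[of t "1 / Suc n"] t Z(2) by auto
    then show "\<exists>t\<in>\<Union>n. Z n. t \<in> B x r" using t by blast
  qed (use Z in auto)
qed

definition dense_set :: "'a set" where
  "dense_set = (SOME D. countable D \<and> D \<subseteq> space M \<and> (\<forall>x\<in>space M. \<forall>r>0. \<exists>t\<in>D. t \<in> B x r))"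

text \<open>Stands in for a countable base of the topology, although its balls need not be
  open.\<close>

definition net :: "('a \<times> real) set" where
  "net = dense_set \<times> {q \<in> \<rat>. 0 < q}"

lemma dense_set: "countable dense_set" "dense_set \<subseteq> space M" "x \<in> space M \<Longrightarrow> 0 < r \<Longrightarrow> \<exists>t\<in>dense_set. t \<in> B x r"
  using someI_ex[OF ex_countable_dense] unfolding dense_set_def[symmetric] by blast+

lemma countable_net: "countable net"
  unfolding net_def by (intro countable_SIGMA dense_set) (auto intro: countable_subset[OF _ countable_rat])

lemma netD: "(t, q) \<in> net \<Longrightarrow> t \<in> space M" "(t, q) \<in> net \<Longrightarrow> 0 < q"
  using dense_set(2) by (auto simp: net_def)

lemma sets_net: "(t, q) \<in> net \<Longrightarrow> B t q \<in> sets M"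
  using netD by (intro qball_sets) auto

text \<open>The inclusions say that the net ball enlarged by \<open>c1\<close> lies between two
  balls around \<open>x\<close>. They allow statements about all small balls around \<open>x\<close>
  to be checked on the net.\<close>

lemma ex_net:
  assumes x: "x \<in> space M" and r: "0 < r"
  obtains t q where "(t, q) \<in> net" "x \<in> B t q" "B t (c1 * q) \<subseteq> B x r" "B x q \<subseteq> B t (c1 * q)" "q < r"
proof -
  \<comment> \<open>One factor \<open>c1\<close> comes from enlarging the net ball, the other from
    recentring it at \<open>x\<close>.\<close>
  obtain q where q: "q \<in> \<rat>" "0 < q" "q < r / (c1 * c1)"
    using Rats_dense_in_real[of 0 "r / (c1 * c1)"] r c1_pos by auto
  obtain t where t: "t \<in> dense_set" "t \<in> B x q" using dense_set(3)[OF x q(2)] by blast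
  have tq: "(t, q) \<in> net" using t q by (simp add: net_def)
  have "t \<in> B x (c1 * q)" using t B_c1[OF q(2)] by auto
  then have "B t (c1 * q) \<subseteq> B x (c1 * (c1 * q))" using x q c1_pos by (intro B_engulf) auto
  also have "\<dots> \<subseteq> B x r" using q c1_pos by (intro qball_mono) (simp add: field_simps)
  finally have 1: "B t (c1 * q) \<subseteq> B x r" .
  have "q \<le> c1 * (c1 * q)" using q c1_ge_1 mult_mono[of 1 c1 1 c1] by (simp add: mult.assoc[symmetric])
  also have "\<dots> < r" using q c1_pos by (simp add: field_simps)
  finally have "q < r" .
  then show ?thesis using that[OF tq B_sym[OF x t(2)] 1 B_engulf(2)[OF x q(2) t(2)]] by blast
qed

text \<open>By \<open>ex_net\<close> an open set is the union of the net balls that it contains, a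
  countable union; conversely balls are measurable by assumption.\<close>

lemma sets_eq_net: "sets M = sigma_sets (space M) ((\<lambda>(t, q). B t q) ` net)"
proof (rule antisym)
  have "{V. qopen (space M) d V} \<subseteq> sigma_sets (space M) ((\<lambda>(t, q). B t q) ` net)"
  proof safe
    fix V assume V: "qopen (space M) d V"
    have "V = (\<Union>i\<in>{i \<in> net. (\<lambda>(t, q). B t q) i \<subseteq> V}. (\<lambda>(t, q). B t q) i)"
    proof safe
      fix x assume x: "x \<in> V"
      then obtain r where r: "r > 0" "B x r \<subseteq> V" using V by (auto simp: qopen_def)
      have "x \<in> space M" using x V by (auto simp: qopen_def)
      then obtain t q where tq: "(t, q) \<in> net" "x \<in> B t q" "B t (c1 * q) \<subseteq> B x r"
        using ex_net r by metis
      then have "B t q \<subseteq> V" using B_c1[of q t] netD r by blast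
      then show "x \<in> (\<Union>i\<in>{i \<in> net. (\<lambda>(t, q). B t q) i \<subseteq> V}. (\<lambda>(t, q). B t q) i)" using tq by force
    qed auto
    also have "\<dots> \<in> sigma_sets (space M) ((\<lambda>(t, q). B t q) ` net)"
      using countable_net by (intro sigma_sets_UNION countable_image) (auto intro: countable_subset)
    finally show "V \<in> sigma_sets (space M) ((\<lambda>(t, q). B t q) ` net)" .
  qed
  then show "sets M \<subseteq> sigma_sets (space M) ((\<lambda>(t, q). B t q) ` net)"
    unfolding sets_eq_qopen by (rule sigma_sets_mono)
  show "sigma_sets (space M) ((\<lambda>(t, q). B t q) ` net) \<subseteq> sets M"
    by (intro sets.sigma_sets_subset) (auto intro: sets_net)
qed

text \<open>A quasimetric ball need not be open; summing geometrically shrinking steps produces an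
  open set between \<open>F\<close> and the union of the \<open>r\<close>-balls around \<open>F\<close>.\<close>

lemma ex_qopen_nbhd:
  assumes F: "F \<subseteq> space M" and r: "0 < r"
  obtains W where "qopen (space M) d W" "F \<subseteq> W" "W \<subseteq> (\<Union>x\<in>F. B x r)"
proof -
  define V where "V = rec_nat F (\<lambda>n V. \<Union>y\<in>V. B y (r / c1 ^ (n + 2)))"
  have V0: "V 0 = F" and VS: "V (Suc n) = (\<Union>y\<in>V n. B y (r / c1 ^ (n + 2)))" for n
    by (simp_all add: V_def)
  have pos: "0 < r / c1 ^ n" for n using r c1_pos by simp
  have Vs: "V n \<subseteq> space M" for n using F by (induction n) (auto simp: V0 VS dest: subsetD[OF B_subset_space])
  \<comment> \<open>The invariant that keeps the growing sets inside the \<open>r\<close>-balls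
    around \<open>F\<close>. Passing to \<open>Suc n\<close> recentres one ball, which costs a
    factor \<open>c1\<close>; this is why the radii are divided by \<open>c1\<close> at each
    step.\<close>
  have inv: "\<exists>x\<in>F. B y (r / c1 ^ (n + 1)) \<subseteq> B x r" if "y \<in> V n" for n y
    using that
  proof (induction n arbitrary: y)
    case 0
    have "r / c1 \<le> r" using c1_ge_1 r by (simp add: field_simps)
    then show ?case using 0 by (auto simp: V0 intro!: bexI[of _ y] qball_mono)
  next
    case (Suc n)
    then obtain z where z: "z \<in> V n" "y \<in> B z (r / c1 ^ (n + 2))" by (auto simp: VS)
    obtain x where x: "x \<in> F" "B z (r / c1 ^ (n + 1)) \<subseteq> B x r" using Suc.IH[OF z(1)] by blast
    have "B y (r / c1 ^ (n + 2)) \<subseteq> B z (c1 * (r / c1 ^ (n + 2)))"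
      using Vs by (intro B_engulf pos z) (use z in auto)
    also have "c1 * (r / c1 ^ (n + 2)) = r / c1 ^ (n + 1)" using c1_pos by simp
    finally show ?case using x by auto
  qed
  show ?thesis
  proof (rule that[of "\<Union>n. V n"])
    show "qopen (space M) d (\<Union>n. V n)"
      unfolding qopen_def
    proof (intro conjI ballI)
      fix t assume "t \<in> (\<Union>n. V n)"
      then obtain n where "t \<in> V n" by auto
      then have "B t (r / c1 ^ (n + 2)) \<subseteq> V (Suc n)" by (auto simp: VS)
      then show "\<exists>r>0. B t r \<subseteq> (\<Union>n. V n)" using pos[of "n + 2"] by blast
    qed (use Vs in auto)
    show "F \<subseteq> (\<Union>n. V n)" using V0 by auto
    show "(\<Union>n. V n) \<subseteq> (\<Union>x\<in>F. B x r)"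
    proof safe
      fix y n assume y: "y \<in> V n"
      then show "y \<in> (\<Union>x\<in>F. B x r)"
        using inv[OF y] B_self[of y, OF _ pos[of "n + 1"]] Vs by blast
    qed
  qed
qed

text \<open>Open neighbourhoods of the complement taken inside the \<open>1/(n+1)\<close>-balls
  around it shrink to the complement: a point of \<open>V\<close> has a ball inside
  \<open>V\<close>, so it is not within every such distance of the complement.\<close>

lemma closed_eq_INT_qopen:
  assumes V: "qopen (space M) d V"
  obtains W :: "nat \<Rightarrow> 'a set" where "\<And>n. qopen (space M) d (W n)" "space M - V = (\<Inter>n. W n)"
proof -
  have "\<exists>W. qopen (space M) d W \<and> space M - V \<subseteq> W \<and> W \<subseteq> (\<Union>x\<in>space M - V. B x (1 / Suc n))" for n :: nat
    using ex_qopen_nbhd[of "space M - V" "1 / Suc n"] by (metis Diff_subset of_nat_0_less_iff zero_less_Suc zero_less_divide_1_iff)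
  then obtain W where W: "\<And>n. qopen (space M) d (W n)" "\<And>n. space M - V \<subseteq> W n"
    "\<And>n. W n \<subseteq> (\<Union>x\<in>space M - V. B x (1 / Suc n))" by metis
  have "z \<in> space M - V" if z: "z \<in> (\<Inter>n. W n)" for z
  proof -
    have zs: "z \<in> space M" using z W(1)[of 0] by (auto simp: qopen_def)
    have False if zV: "z \<in> V"
    proof -
      obtain r where r: "r > 0" "B z r \<subseteq> V" using zV V by (auto simp: qopen_def)
      obtain n :: nat where n: "1 / Suc n < r" using reals_Archimedean[of r] r by (auto simp: inverse_eq_divide)
      obtain x where x: "x \<in> space M - V" "z \<in> B x (1 / Suc n)" using z W(3)[of n] by blast
      then have "x \<in> B z (1 / Suc n)" using B_sym by auto
      then show False using x r qball_mono[of "1 / Suc n" r "space M" d z] n by auto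
    qed
    then show ?thesis using zs by auto
  qed
  then show ?thesis using W that[of W] by blast
qed

text \<open>Approximating from outside by an open and from inside by a closed set at the same time
  makes the claim stable under complements; open sets themselves are handled by
  \<open>closed_eq_INT_qopen\<close> and continuity from above.\<close>

lemma regular:
  assumes \<nu>: "finite_measure \<nu>" "sets \<nu> = sets M" and A: "A \<in> sets M" and e: "0 < e"
  shows "\<exists>V C. qopen (space M) d V \<and> qopen (space M) d (space M - C) \<and> C \<subseteq> A \<and> A \<subseteq> V \<and> measure \<nu> (V - C) < e"
  using A[unfolded sets_eq_qopen] e
proof (induction arbitrary: e rule: sigma_sets.induct)
  interpret \<nu>: finite_measure \<nu> by (rule \<nu>)
  have sp: "space \<nu> = space M" using \<nu>(2) by (rule sets_eq_imp_space_eq)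
  {
    case (Basic V)
    then have V: "qopen (space M) d V" by simp
    obtain W :: "nat \<Rightarrow> 'a set" where W: "\<And>n. qopen (space M) d (W n)" "space M - V = (\<Inter>n. W n)"
      using closed_eq_INT_qopen[OF V] by blast
    define W' where "W' n = (\<Inter>i\<le>n. W i)" for n :: nat
    have W': "qopen (space M) d (W' n)" for n unfolding W'_def by (rule qopen_INT_atMost[OF W(1)])
    have [measurable]: "W' n \<in> sets \<nu>" "V \<in> sets \<nu>" for n using sets_qopen W' V \<nu> by auto
    have INT: "(\<Inter>n. W' n) = space M - V" unfolding W(2) W'_def by auto
    have "(\<lambda>n. measure \<nu> (W' n)) \<longlonglongrightarrow> measure \<nu> (\<Inter>n. W' n)"
    proof (rule \<nu>.finite_Lim_measure_decseq)
      show "range W' \<subseteq> sets \<nu>" using sets_qopen W' \<nu> by auto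
    qed (auto simp: decseq_def W'_def)
    then have "(\<lambda>n. measure \<nu> (W' n) - measure \<nu> (space M - V)) \<longlonglongrightarrow> 0"
      unfolding INT by (simp add: LIM_zero)
    then have "\<forall>\<^sub>F n in sequentially. measure \<nu> (W' n) - measure \<nu> (space M - V) < e"
      using Basic(2) by (rule order_tendstoD)
    then obtain n where n: "measure \<nu> (W' n) - measure \<nu> (space M - V) < e"
      by (auto simp: eventually_sequentially)
    have sub: "space M - V \<subseteq> W' n" unfolding W(2) W'_def by auto
    have Ws: "W' n \<subseteq> space M" using W' by (auto simp: qopen_def)
    have "V - (space M - W' n) = W' n - (space M - V)" using V sub Ws by (auto simp: qopen_def)
    then have "measure \<nu> (V - (space M - W' n)) = measure \<nu> (W' n) - measure \<nu> (space M - V)"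
      using sub by (simp add: \<nu>.finite_measure_Diff sp[symmetric])
    with n show ?case
      using V W' Ws sub by (intro exI[of _ V] exI[of _ "space M - W' n"]) (auto simp: double_diff)
  next
    case Empty
    then show ?case using qopen_space by (intro exI[of _ "{}"]) (auto simp: qopen_def)
  next
    case (Compl A)
    from Compl.IH[OF Compl.prems] obtain V C where VC: "qopen (space M) d V" "qopen (space M) d (space M - C)"
      "C \<subseteq> A" "A \<subseteq> V" "measure \<nu> (V - C) < e" by blast
    have Vs: "V \<subseteq> space M" using VC by (auto simp: qopen_def)
    then have "(space M - C) - (space M - V) = V - C" by auto
    then show ?case using VC Vs
      by (intro exI[of _ "space M - C"] exI[of _ "space M - V"]) (auto simp: double_diff)
  next
    case (Union A)
    \<comment> \<open>These errors add up to \<open>e / 2\<close>. The other half is spent on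
      keeping only finitely many of the closed sets, since an infinite union of closed sets need not
      be closed.\<close>
    have "\<exists>V C. qopen (space M) d V \<and> qopen (space M) d (space M - C) \<and> C \<subseteq> A i \<and> A i \<subseteq> V \<and> measure \<nu> (V - C) < e / 2 * (1/2) ^ Suc i" for i
      using Union.IH[of "e / 2 * (1/2) ^ Suc i" i] Union.prems by simp
    then obtain V C where VC: "\<And>i. qopen (space M) d (V i)" "\<And>i. qopen (space M) d (space M - C i)"
      "\<And>i. C i \<subseteq> A i" "\<And>i. A i \<subseteq> V i" "\<And>i. measure \<nu> (V i - C i) < e / 2 * (1/2) ^ Suc i" by metis
    have Vs: "V i \<subseteq> space M" for i using VC by (auto simp: qopen_def)
    then have Cs: "C i \<subseteq> space M" for i using VC(3)[of i] VC(4)[of i] by blast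
    have V_sets[measurable]: "V i \<in> sets \<nu>" for i using sets_qopen VC(1) \<nu> by auto
    have C_sets[measurable]: "C i \<in> sets \<nu>" for i
      using sets_qopen[OF VC(2)[of i]] sets.compl_sets[of "space M - C i" M] Cs[of i] \<nu> by (simp add: double_diff)
    define K where "K n = (\<Union>i\<le>n. C i)" for n :: nat
    have [measurable]: "K n \<in> sets \<nu>" for n unfolding K_def by measurable
    have UK: "(\<Union>n. K n) = (\<Union>i. C i)" unfolding K_def by auto
    have "(\<lambda>n. measure \<nu> (K n)) \<longlonglongrightarrow> measure \<nu> (\<Union>n. K n)"
      by (rule \<nu>.finite_Lim_measure_incseq) (auto simp: incseq_def K_def intro: order_trans)
    then have "(\<lambda>n. measure \<nu> (\<Union>i. C i) - measure \<nu> (K n)) \<longlonglongrightarrow> measure \<nu> (\<Union>i. C i) - measure \<nu> (\<Union>i. C i)"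
      unfolding UK by (intro tendsto_intros)
    then have "\<forall>\<^sub>F n in sequentially. measure \<nu> (\<Union>i. C i) - measure \<nu> (K n) < e / 2"
      using Union.prems by (intro order_tendstoD) auto
    then obtain n where n: "measure \<nu> (\<Union>i. C i) - measure \<nu> (K n) < e / 2"
      by (auto simp: eventually_sequentially)
    have sums: "(\<lambda>i. e / 2 * (1/2) ^ Suc i) sums (e / 2)"
      using sums_mult[OF power_half_series, of "e / 2"] by simp
    have summ: "summable (\<lambda>i. measure \<nu> (V i - C i))"
      by (rule summable_comparison_test'[OF sums_summable[OF sums], of 0]) (use VC(5) in \<open>auto intro: less_imp_le\<close>)
    have "measure \<nu> (\<Union>i. V i - C i) \<le> (\<Sum>i. measure \<nu> (V i - C i))"
      by (rule \<nu>.finite_measure_subadditive_countably[OF _ summ]) auto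
    also have "\<dots> \<le> (\<Sum>i. e / 2 * (1/2) ^ Suc i)"
      by (rule suminf_le[OF _ summ sums_summable[OF sums]]) (use VC(5) in \<open>auto intro: less_imp_le\<close>)
    also have "\<dots> = e / 2" using sums by (rule sums_unique[symmetric])
    finally have 1: "measure \<nu> (\<Union>i. V i - C i) \<le> e / 2" .
    have KC: "K n \<subseteq> (\<Union>i. C i)" unfolding K_def by auto
    have 2: "measure \<nu> ((\<Union>i. C i) - K n) = measure \<nu> (\<Union>i. C i) - measure \<nu> (K n)"
      using KC by (intro \<nu>.finite_measure_Diff) auto
    have "measure \<nu> ((\<Union>i. V i) - K n) \<le> measure \<nu> ((\<Union>i. V i - C i) \<union> ((\<Union>i. C i) - K n))"
      by (intro \<nu>.finite_measure_mono) auto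
    also have "\<dots> \<le> measure \<nu> (\<Union>i. V i - C i) + measure \<nu> ((\<Union>i. C i) - K n)"
      by (intro measure_Un_le) auto
    also have "\<dots> < e" using 1 2 n by simp
    finally have 3: "measure \<nu> ((\<Union>i. V i) - K n) < e" .
    have "qopen (space M) d (\<Inter>i\<le>n. space M - C i)" by (rule qopen_INT_atMost[OF VC(2)])
    also have "(\<Inter>i\<le>n. space M - C i) = space M - K n" unfolding K_def by auto
    finally have 4: "qopen (space M) d (space M - K n)" .
    have "K n \<subseteq> (\<Union>i. A i)" unfolding K_def using VC(3) by fast
    moreover have "(\<Union>i. A i) \<subseteq> (\<Union>i. V i)" using VC(4) by (intro UN_mono) auto
    moreover have "qopen (space M) d (\<Union>i. V i)" using VC(1) by (intro qopen_UN) auto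
    ultimately show ?case using 3 4 by (intro exI[of _ "\<Union>i. V i"] exI[of _ "K n"] conjI)
  }
qed

end

section \<open>Vitali covering and averages at zeros of a function\<close>

context homogeneous
begin

lemma disjoint_family_on_insertI:
  "(\<And>j. j \<in> J \<Longrightarrow> F i \<inter> F j = {}) \<Longrightarrow> disjoint_family_on F J \<Longrightarrow> disjoint_family_on F (insert i J)"
  by (auto simp: disjoint_family_on_def Int_commute)

text \<open>Greedy selection: a ball of largest radius is kept and the balls meeting it are dropped.
  Those have smaller or equal radius, so a single engulfing puts them into the kept ball enlarged by
  \<open>c1\<close>.\<close>

lemma finite_vitali:
  assumes "finite I" "\<And>t r. (t, r) \<in> I \<Longrightarrow> t \<in> space M \<and> 0 < r"
  shows "\<exists>J\<subseteq>I. disjoint_family_on (\<lambda>(t, r). B t r) J \<and> (\<Union>(t, r)\<in>I. B t r) \<subseteq> (\<Union>(t, r)\<in>J. B t (c1 * r))"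
  using assms
proof (induction I rule: finite_psubset_induct)
  case (psubset I)
  show ?case
  proof (cases "I = {}")
    case False
    have "Max (snd ` I) \<in> snd ` I" using False psubset.hyps by (intro Max_in) auto
    then obtain i where "i \<in> I" "snd i = Max (snd ` I)" by auto
    then have i: "i \<in> I" "\<And>j. j \<in> I \<Longrightarrow> snd j \<le> snd i" using psubset.hyps by auto
    obtain t0 r0 where tr: "i = (t0, r0)" by (cases i)
    define I' where "I' = {(t, r) \<in> I. B t r \<inter> B t0 r0 = {}}"
    have i0: "t0 \<in> space M" "0 < r0" using psubset.prems[of t0 r0] i tr by auto
    have "i \<notin> I'" using B_self[OF i0] tr by (auto simp: I'_def)
    then have "I' \<subset> I" using i unfolding I'_def by blast
    moreover have "\<And>t r. (t, r) \<in> I' \<Longrightarrow> t \<in> space M \<and> 0 < r" using psubset.prems by (auto simp: I'_def)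
    ultimately obtain J' where J': "J' \<subseteq> I'" "disjoint_family_on (\<lambda>(t, r). B t r) J'"
      "(\<Union>(t, r)\<in>I'. B t r) \<subseteq> (\<Union>(t, r)\<in>J'. B t (c1 * r))"
      using psubset.IH[of I'] by blast
    have "disjoint_family_on (\<lambda>(t, r). B t r) (insert i J')"
    proof (rule disjoint_family_on_insertI)
      fix j assume "j \<in> J'"
      then show "(\<lambda>(t, r). B t r) i \<inter> (\<lambda>(t, r). B t r) j = {}"
        using J'(1) by (auto simp: I'_def tr)
    qed (rule J'(2))
    moreover have "(\<Union>(t, r)\<in>I. B t r) \<subseteq> (\<Union>(t, r)\<in>insert i J'. B t (c1 * r))"
    proof safe
      fix x t r assume x: "x \<in> B t r" and tI: "(t, r) \<in> I"
      show "x \<in> (\<Union>(t, r)\<in>insert i J'. B t (c1 * r))"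
      proof (cases "(t, r) \<in> I'")
        case True
        then show ?thesis using J'(3) x by blast
      next
        case False
        have "r \<le> r0" using i(2)[OF tI] tr by simp
        then have "B t r \<subseteq> B t r0" by (rule qball_mono)
        moreover have "B t0 r0 \<inter> B t r0 \<noteq> {}" using False tI \<open>B t r \<subseteq> B t r0\<close> by (auto simp: I'_def)
        ultimately have "x \<in> B t0 (c1 * r0)"
          using qball_engulf[of t0 t r0] i0 psubset.prems[OF tI] x by blast
        then show ?thesis using tr by auto
      qed
    qed
    moreover have "insert i J' \<subseteq> I" using J'(1) i by (auto simp: I'_def)
    ultimately show ?thesis by blast
  qed (simp add: disjoint_family_on_def)
qed

text \<open>For a finite subfamily, the enlarged selected balls cover and doubling removes the
  enlargement at the cost of \<open>c2\<close>; the selected balls are disjoint, so their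
  \<open>\<nu>\<close>-masses add up to at most that of \<open>V\<close>. The bound is the same for
  all finite subfamilies and passes to the countable family by continuity from below.\<close>

lemma vitali_bound:
  assumes I: "countable I" "\<And>t r. (t, r) \<in> I \<Longrightarrow> t \<in> space M \<and> 0 < r"
    and \<nu>: "sets \<nu> = sets M" and V: "V \<in> sets M" "\<And>t r. (t, r) \<in> I \<Longrightarrow> B t r \<subseteq> V"
    and le: "\<And>t r. (t, r) \<in> I \<Longrightarrow> emeasure M (B t r) \<le> K * emeasure \<nu> (B t r)"
  shows "emeasure M (\<Union>(t, r)\<in>I. B t r) \<le> ennreal c2 * K * emeasure \<nu> V"
proof -
  have bs: "B t r \<in> sets M" if "(t, r) \<in> I" for t r using I(2)[OF that] by (auto intro: qball_sets)
  have fin: "emeasure M (\<Union>(t, r)\<in>F. B t r) \<le> ennreal c2 * K * emeasure \<nu> V" if F: "finite F" "F \<subseteq> I" for F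
  proof -
    have FI: "\<And>t r. (t, r) \<in> F \<Longrightarrow> t \<in> space M \<and> 0 < r" using F I by auto
    obtain J where J: "J \<subseteq> F" "disjoint_family_on (\<lambda>(t, r). B t r) J" "(\<Union>(t, r)\<in>F. B t r) \<subseteq> (\<Union>(t, r)\<in>J. B t (c1 * r))"
      using finite_vitali[OF F(1) FI] by blast
    have JI: "J \<subseteq> I" "finite J" using J F by (auto intro: finite_subset)
    have cs: "B t (c1 * r) \<in> sets M" if "(t, r) \<in> J" for t r
      using I(2)[of t r] that JI c1_pos by (intro qball_sets) auto
    have "emeasure M (\<Union>(t, r)\<in>F. B t r) \<le> emeasure M (\<Union>(t, r)\<in>J. B t (c1 * r))"
      using J(3) JI(2) cs by (intro emeasure_mono) auto
    also have "\<dots> \<le> (\<Sum>(t, r)\<in>J. emeasure M (B t (c1 * r)))"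
      using emeasure_subadditive_finite[OF JI(2), of "\<lambda>(t, r). B t (c1 * r)" M] cs
      by (simp add: split_beta image_subset_iff)
    also have "\<dots> \<le> (\<Sum>(t, r)\<in>J. ennreal c2 * (K * emeasure \<nu> (B t r)))"
    proof (intro sum_mono, clarify)
      fix t r assume "(t, r) \<in> J"
      then have tr: "(t, r) \<in> I" using JI by auto
      have "emeasure M (B t (c1 * r)) \<le> ennreal c2 * emeasure M (B t r)"
        using I(2)[OF tr] by (intro doubling) auto
      also have "\<dots> \<le> ennreal c2 * (K * emeasure \<nu> (B t r))"
        using le[OF tr] by (intro mult_left_mono) auto
      finally show "emeasure M (B t (c1 * r)) \<le> ennreal c2 * (K * emeasure \<nu> (B t r))" .
    qed
    also have "\<dots> = ennreal c2 * K * (\<Sum>(t, r)\<in>J. emeasure \<nu> (B t r))"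
      by (simp add: sum_distrib_left split_beta mult.assoc)
    also have "(\<Sum>(t, r)\<in>J. emeasure \<nu> (B t r)) = emeasure \<nu> (\<Union>(t, r)\<in>J. B t r)"
    proof -
      have "(\<lambda>(t, r). B t r) ` J \<subseteq> sets \<nu>" using JI bs \<nu> by auto
      from sum_emeasure[OF this J(2) JI(2)] show ?thesis by (simp add: split_beta)
    qed
    also have "\<dots> \<le> emeasure \<nu> V"
      using V JI \<nu> by (intro emeasure_mono) auto
    finally show ?thesis by (simp add: mult_left_mono)
  qed
  show ?thesis
  proof (cases "I = {}")
    case False
    define F where "F n = from_nat_into I ` {..n}" for n
    have FI: "F n \<subseteq> I" "finite (F n)" for n using from_nat_into[OF False] by (auto simp: F_def)
    have "I = from_nat_into I ` (\<Union>n. {..n})"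
      using range_from_nat_into[OF False I(1)] by (simp add: UN_atMost_UNIV)
    then have "I = (\<Union>n. F n)" unfolding F_def by (simp only: image_UN)
    then have "(\<Union>(t, r)\<in>I. B t r) = (\<Union>(t, r)\<in>(\<Union>n. F n). B t r)" by (rule arg_cong)
    also have "\<dots> = (\<Union>n. \<Union>(t, r)\<in>F n. B t r)" by (simp only: UN_UN_flatten)
    also have "emeasure M \<dots> = (SUP n. emeasure M (\<Union>(t, r)\<in>F n. B t r))"
    proof (rule SUP_emeasure_incseq[symmetric])
      show "range (\<lambda>n. \<Union>(t, r)\<in>F n. B t r) \<subseteq> sets M"
      proof clarify
        show "(\<Union>(t, r)\<in>F n. B t r) \<in> sets M" for n
          using FI[of n] bs by (intro sets.finite_UN) auto
      qed
      show "incseq (\<lambda>n. \<Union>(t, r)\<in>F n. B t r)"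
        unfolding F_def incseq_def by (intro allI impI UN_mono image_mono) auto
    qed
    also have "\<dots> \<le> ennreal c2 * K * emeasure \<nu> V"
      using FI by (intro SUP_least fin)
    finally show ?thesis .
  qed simp
qed

text \<open>Contains every point where \<open>m s\<close> vanishes although its averages over shrinking balls do not tend to \<open>0\<close>.
  Admitting only the balls of the countable net makes the set jointly measurable, so that it is null as soon as its slices are.\<close>

definition bad_set :: "'s measure \<Rightarrow> ('s \<times> 'a \<Rightarrow> ennreal) \<Rightarrow> nat \<Rightarrow> ('s \<times> 'a) set" where
  "bad_set P m K = {z \<in> space (P \<Otimes>\<^sub>M M). m z = 0} \<inter>
     (\<Inter>n::nat. \<Union>(t, r)\<in>{(t, r) \<in> net. r < 1 / Suc n}.
       {z \<in> space (P \<Otimes>\<^sub>M M). snd z \<in> B t r \<and>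
          emeasure M (B t (c1 * r)) \<le> of_nat K * (\<integral>\<^sup>+y\<in>B t (c1 * r). m (fst z, y) \<partial>M)})"

lemma net_scale: "(t, r) \<in> net \<Longrightarrow> 0 < c1 * r" "(t, r) \<in> net \<Longrightarrow> B t (c1 * r) \<in> sets M"
  using netD[of t r] c1_pos by (auto intro!: qball_sets)

lemma sets_bad_set:
  assumes [measurable]: "m \<in> borel_measurable (P \<Otimes>\<^sub>M M)"
  shows "bad_set P m K \<in> sets (P \<Otimes>\<^sub>M M)"
proof -
  have "{z \<in> space (P \<Otimes>\<^sub>M M). snd z \<in> B t r \<and>
          emeasure M (B t (c1 * r)) \<le> of_nat K * (\<integral>\<^sup>+y\<in>B t (c1 * r). m (fst z, y) \<partial>M)} \<in> sets (P \<Otimes>\<^sub>M M)"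
    if "(t, r) \<in> net" for t r
  proof -
    have [measurable]: "B t r \<in> sets M" "B t (c1 * r) \<in> sets M" using sets_net net_scale that by auto
    show ?thesis by measurable
  qed
  moreover have "countable {(t, r) \<in> net. r < 1 / Suc n}" for n
    by (rule countable_subset[OF _ countable_net]) auto
  ultimately show ?thesis
    unfolding bad_set_def by (intro sets.Int sets.countable_INT sets.countable_UN') auto
qed

text \<open>The measure \<open>\<nu>\<close> with density \<open>m (s, _)\<close> gives no mass to
  the zeros of \<open>m (s, _)\<close>, so by regularity these lie in an open \<open>V\<close> with
  \<open>\<nu>\<close>-mass below \<open>e\<close>. Each bad point lies in a ball inside
  \<open>V\<close> whose \<open>M\<close>-measure is at most \<open>K\<close> times its
  \<open>\<nu>\<close>-mass, and \<open>vitali_bound\<close> makes the slice small with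
  \<open>e\<close>.\<close>

lemma emeasure_bad_set_slice:
  assumes m[measurable]: "m \<in> borel_measurable (P \<Otimes>\<^sub>M M)" and s: "s \<in> space P"
    and fin: "(\<integral>\<^sup>+y. m (s, y) \<partial>M) < \<infinity>"
  shows "emeasure M (Pair s -` bad_set P m K) = 0"
proof -
  have [measurable]: "(\<lambda>y. m (s, y)) \<in> borel_measurable M" using s by measurable
  define \<nu> where "\<nu> = density M (\<lambda>y. m (s, y))"
  interpret \<nu>: finite_measure \<nu>
    unfolding \<nu>_def using fin by (intro finite_measureI) (simp add: emeasure_density less_top[symmetric] cong: nn_integral_cong)
  have \<nu>_sets: "sets \<nu> = sets M" by (simp add: \<nu>_def)
  let ?N = "{y \<in> space M. m (s, y) = 0}"
  have N0: "emeasure \<nu> ?N = 0"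
  proof -
    have "emeasure \<nu> ?N = (\<integral>\<^sup>+y. m (s, y) * indicator ?N y \<partial>M)" unfolding \<nu>_def by (subst emeasure_density) auto
    also have "\<dots> = (\<integral>\<^sup>+y. 0 \<partial>M)" by (intro nn_integral_cong) (auto simp: indicator_def)
    finally show ?thesis by simp
  qed
  have bound: "emeasure M (Pair s -` bad_set P m K) \<le> ennreal (c2 * real K * e)" if e: "0 < e" for e
  proof -
    obtain V C where V: "qopen (space M) d V" "?N \<subseteq> V" "C \<subseteq> ?N" and VC: "measure \<nu> (V - C) < e"
      and C: "qopen (space M) d (space M - C)"
      using regular[OF \<nu>.finite_measure_axioms \<nu>_sets _ e, of ?N] by auto
    have [measurable]: "V \<in> sets M" using V by (auto intro: sets_qopen)
    have Csets[measurable]: "C \<in> sets M"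
      using sets.compl_sets[OF sets_qopen[OF C]] V(3) by (subst (asm) double_diff) auto
    have "emeasure \<nu> C = 0" using emeasure_mono[of C ?N \<nu>] V(3) N0 \<nu>_sets by auto
    then have "emeasure \<nu> V = emeasure \<nu> (V - C)"
      using \<nu>_sets by (intro emeasure_Diff_null_set[symmetric]) auto
    then have Ve: "emeasure \<nu> V \<le> ennreal e"
      using VC by (simp add: \<nu>.emeasure_eq_measure ennreal_leI)
    define I where "I = {(t, r). (t, r) \<in> net \<and> B t (c1 * r) \<subseteq> V \<and> emeasure M (B t (c1 * r)) \<le> of_nat K * emeasure \<nu> (B t (c1 * r))}"
    have "Pair s -` bad_set P m K \<subseteq> (\<Union>(t, r)\<in>(\<lambda>(t, r). (t, c1 * r)) ` I. B t r)"
    proof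
      fix y assume "y \<in> Pair s -` bad_set P m K"
      then have y: "(s, y) \<in> bad_set P m K" by simp
      then have "y \<in> ?N" by (auto simp: bad_set_def space_pair_measure)
      then have "y \<in> V" "y \<in> space M" using V by auto
      then obtain \<rho> where \<rho>: "0 < \<rho>" "B y \<rho> \<subseteq> V" using V(1) by (auto simp: qopen_def)
      \<comment> \<open>One factor \<open>c1\<close> is the enlargement in the definition of
        \<open>bad_set\<close>, the other comes from recentring the enlarged ball at
        \<open>y\<close>.\<close>
      obtain n :: nat where n: "1 / Suc n < \<rho> / (c1 * c1)"
        using reals_Archimedean[of "\<rho> / (c1 * c1)"] \<rho> c1_pos by (auto simp: inverse_eq_divide)
      from y obtain t r where tr: "(t, r) \<in> net" "r < 1 / Suc n" "y \<in> B t r"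
        "emeasure M (B t (c1 * r)) \<le> of_nat K * (\<integral>\<^sup>+y\<in>B t (c1 * r). m (s, y) \<partial>M)"
        unfolding bad_set_def by fastforce
      have r: "0 < r" "t \<in> space M" using netD tr by auto
      have yc: "y \<in> B t (c1 * r)" using tr(3) B_c1[OF r(1)] by auto
      have "B t (c1 * r) \<subseteq> B y (c1 * (c1 * r))" using r yc net_scale tr by (intro B_engulf) auto
      also have "\<dots> \<subseteq> B y \<rho>"
      proof (rule qball_mono)
        have "r < \<rho> / (c1 * c1)" using tr(2) n by simp
        then show "c1 * (c1 * r) \<le> \<rho>" using c1_pos by (simp add: field_simps)
      qed
      finally have "B t (c1 * r) \<subseteq> V" using \<rho> by auto
      moreover have "emeasure \<nu> (B t (c1 * r)) = (\<integral>\<^sup>+y\<in>B t (c1 * r). m (s, y) \<partial>M)"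
        unfolding \<nu>_def using net_scale(2)[OF tr(1)] by (simp add: emeasure_density)
      ultimately have "(t, r) \<in> I" using tr by (auto simp: I_def)
      then show "y \<in> (\<Union>(t, r)\<in>(\<lambda>(t, r). (t, c1 * r)) ` I. B t r)" using yc by force
    qed
    moreover have Inet: "I \<subseteq> net" by (auto simp: I_def)
    moreover have cI: "countable I" using Inet countable_net by (rule countable_subset)
    moreover have "(\<Union>(t, r)\<in>(\<lambda>(t, r). (t, c1 * r)) ` I. B t r) \<in> sets M"
      using cI Inet net_scale(2) by (intro sets.countable_UN') auto
    ultimately have "emeasure M (Pair s -` bad_set P m K) \<le> emeasure M (\<Union>(t, r)\<in>(\<lambda>(t, r). (t, c1 * r)) ` I. B t r)"
      by (intro emeasure_mono)
    also have "\<dots> \<le> ennreal c2 * of_nat K * emeasure \<nu> V"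
    proof (rule vitali_bound)
      show "t \<in> space M \<and> 0 < r" if "(t, r) \<in> (\<lambda>(t, r). (t, c1 * r)) ` I" for t r
        using that Inet netD net_scale(1) by auto
    qed (use cI \<nu>_sets in \<open>auto simp: I_def\<close>)
    also have "\<dots> \<le> ennreal c2 * of_nat K * ennreal e" using Ve by (intro mult_left_mono) auto
    also have "\<dots> \<le> ennreal (c2 * real K * e)"
      using e by (cases "0 \<le> c2") (simp_all add: ennreal_mult ennreal_of_nat_eq_real_of_nat ennreal_neg)
    finally show ?thesis .
  qed
  have "emeasure M (Pair s -` bad_set P m K) \<le> 0 + ennreal e" if e: "0 < e" for e
  proof -
    \<comment> \<open>The sign of \<open>c2\<close> is not known; the absolute value and the summand
      1 make the divisor positive in every case.\<close>
    have "emeasure M (Pair s -` bad_set P m K) \<le> ennreal (c2 * real K * (e / (\<bar>c2\<bar> * real K + 1)))"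
      using e by (intro bound divide_pos_pos) (auto intro: add_nonneg_pos)
    also have "\<dots> \<le> ennreal e"
    proof (rule ennreal_leI)
      have "c2 * real K \<le> \<bar>c2\<bar> * real K + 1"
        using mult_right_mono[OF abs_ge_self[of c2], of "real K"] by simp
      moreover have "0 < \<bar>c2\<bar> * real K + 1" by (intro add_nonneg_pos) auto
      ultimately show "c2 * real K * (e / (\<bar>c2\<bar> * real K + 1)) \<le> e"
        using e by (simp add: divide_simps) 
    qed
    finally show ?thesis by simp
  qed
  then have "emeasure M (Pair s -` bad_set P m K) \<le> 0" by (rule ennreal_le_epsilon)
  then show ?thesis by simp
qed

lemma null_sets_bad_set:
  assumes m: "m \<in> borel_measurable (P \<Otimes>\<^sub>M M)" and fin: "\<And>s. s \<in> space P \<Longrightarrow> (\<integral>\<^sup>+y. m (s, y) \<partial>M) < \<infinity>"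
  shows "bad_set P m K \<in> null_sets (P \<Otimes>\<^sub>M M)"
proof (rule null_setsI)
  show "emeasure (P \<Otimes>\<^sub>M M) (bad_set P m K) = 0"
    unfolding emeasure_pair_measure_alt[OF sets_bad_set[OF m]]
    using emeasure_bad_set_slice[OF m _ fin] by (simp cong: nn_integral_cong)
qed (rule sets_bad_set[OF m])

text \<open>Balls are defined by a strict inequality and hence continuous from below in the radius,
  which carries estimates from rational to arbitrary radii. The 2 in the denominator keeps all the
  smaller radii positive.\<close>

lemma B_UN_incseq:
  assumes r: "0 < r"
  shows "B y r = (\<Union>n::nat. B y (r - r / (n + 2)))"
proof safe
  fix x assume x: "x \<in> B y r"
  then have dr: "d y x < r" by (simp add: qball_def)
  obtain n :: nat where n: "r / (r - d y x) < n" using reals_Archimedean2 by blast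
  then have "r < n * (r - d y x)" using dr by (simp add: field_simps)
  also have "\<dots> \<le> (real n + 2) * (r - d y x)" using dr by (intro mult_right_mono) auto
  finally have "r / (real n + 2) < r - d y x" by (simp add: field_simps)
  then have "d y x < r - r / (real n + 2)" by simp
  then show "x \<in> (\<Union>n::nat. B y (r - r / (n + 2)))" using x by (auto simp: qball_def intro!: exI[of _ n])
next
  fix x n assume "x \<in> B y (r - r / (real n + 2))"
  moreover have "0 < r / (real n + 2)" using r by simp
  ultimately show "x \<in> B y r" by (auto simp: qball_def)
qed

text \<open>Avoiding \<open>bad_set\<close> controls only the enlarged net balls containing
  \<open>y\<close>. A ball around \<open>y\<close> of rational radius lies in such a net ball, and
  two applications of doubling bound the measure of the latter by \<open>c2 * c2\<close> times that
  of the former.\<close>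

lemma eventually_not_bad:
  assumes m[measurable]: "m \<in> borel_measurable (P \<Otimes>\<^sub>M M)" and s: "s \<in> space P" and y: "y \<in> space M"
    and m0: "m (s, y) = 0" and nb: "\<And>K. (s, y) \<notin> bad_set P m K"
  shows "\<forall>\<^sub>F r in at_right 0. of_nat K * (\<integral>\<^sup>+x\<in>B y r. m (s, x) \<partial>M) \<le> emeasure M (B y r)"
proof -
  have [measurable]: "(\<lambda>y. m (s, y)) \<in> borel_measurable M" using s by measurable
  define \<nu> where "\<nu> = density M (\<lambda>y. m (s, y))"
  have \<nu>_sets[measurable_cong]: "sets \<nu> = sets M" by (simp add: \<nu>_def)
  have \<nu>: "emeasure \<nu> A = (\<integral>\<^sup>+x\<in>A. m (s, x) \<partial>M)" if "A \<in> sets M" for A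
    unfolding \<nu>_def using that by (simp add: emeasure_density)
  \<comment> \<open>Applying the hypothesis with \<open>K * k\<close> in place of \<open>K\<close>
    absorbs the loss from doubling; \<open>1 \<le> k\<close> allows \<open>k\<close> to be
    cancelled.\<close>
  obtain k :: nat where k: "c2 * c2 \<le> real k" "1 \<le> k"
  proof -
    obtain k :: nat where "c2 * c2 \<le> real k" using real_arch_simple by blast
    then show ?thesis by (intro that[of "Suc k"]) auto
  qed
  have c2k: "ennreal c2 * ennreal c2 \<le> of_nat k"
    using k(1) by (cases "0 \<le> c2") (auto simp: ennreal_mult[symmetric] ennreal_of_nat_eq_real_of_nat ennreal_neg intro: ennreal_leI)
  from nb[of "K * k"] obtain n :: nat where n: "\<And>t r. (t, r) \<in> net \<Longrightarrow> r < 1 / Suc n \<Longrightarrow> y \<in> B t r \<Longrightarrow>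
      \<not> emeasure M (B t (c1 * r)) \<le> of_nat (K * k) * (\<integral>\<^sup>+x\<in>B t (c1 * r). m (s, x) \<partial>M)"
    using s y m0 unfolding bad_set_def by (auto simp: space_pair_measure)
  have rat: "of_nat K * emeasure \<nu> (B y q) \<le> emeasure M (B y q)" if q: "q \<in> \<rat>" "0 < q" "q < 1 / Suc n" for q
  proof -
    obtain t where t: "t \<in> dense_set" "t \<in> B y q" using dense_set(3)[OF y q(2)] by blast
    have tM: "t \<in> space M" using t dense_set by auto
    have tq: "(t, q) \<in> net" using t q by (simp add: net_def)
    have "of_nat k * (of_nat K * emeasure \<nu> (B y q)) = of_nat (K * k) * emeasure \<nu> (B y q)"
      by (simp add: ac_simps)
    also have "\<dots> \<le> of_nat (K * k) * emeasure \<nu> (B t (c1 * q))"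
      using B_engulf(2)[OF y q(2) t(2)] net_scale(2)[OF tq] by (intro mult_left_mono emeasure_mono) auto
    also have "\<dots> \<le> emeasure M (B t (c1 * q))"
      using n[OF tq q(3) B_sym[OF y t(2)]] \<nu>[OF net_scale(2)[OF tq]] by simp
    also have "\<dots> \<le> ennreal c2 * emeasure M (B t q)" using tM q by (intro doubling)
    also have "\<dots> \<le> ennreal c2 * emeasure M (B y (c1 * q))"
      using B_engulf(1)[OF y q(2) t(2)] y q c1_pos by (intro mult_left_mono emeasure_mono qball_sets) auto
    also have "\<dots> \<le> ennreal c2 * (ennreal c2 * emeasure M (B y q))"
      using y q by (intro mult_left_mono doubling) auto
    also have "\<dots> \<le> of_nat k * emeasure M (B y q)"
      unfolding mult.assoc[symmetric] using c2k by (rule mult_right_mono) simp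
    finally show ?thesis
      using k(2) by (subst (asm) ennreal_mult_le_mult_iff) (auto simp: of_nat_less_top less_top[symmetric])
  qed
  have "of_nat K * (\<integral>\<^sup>+x\<in>B y r. m (s, x) \<partial>M) \<le> emeasure M (B y r)" if r: "0 < r" "r < 1 / Suc n" for r
  proof -
    have Bs: "B y (r - r / (real i + 2)) \<in> sets M" for i :: nat
    proof (rule qball_sets[OF y])
      show "0 < r - r / (real i + 2)" using r by (simp add: field_simps add_pos_nonneg)
    qed
    \<comment> \<open>Between each of the approximating radii and \<open>r\<close> there is a
      rational radius, to which \<open>rat\<close> applies.\<close>
    have "emeasure \<nu> (\<Union>i::nat. B y (r - r / (real i + 2))) = (SUP i::nat. emeasure \<nu> (B y (r - r / (real i + 2))))"
    proof (rule SUP_emeasure_incseq[symmetric])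
      show "incseq (\<lambda>i::nat. B y (r - r / (real i + 2)))"
        using r by (intro incseq_SucI qball_mono) (simp add: divide_left_mono)
      show "range (\<lambda>i::nat. B y (r - r / (real i + 2))) \<subseteq> sets \<nu>" using Bs \<nu>_sets by auto
    qed
    then have "of_nat K * emeasure \<nu> (B y r) = (SUP i::nat. of_nat K * emeasure \<nu> (B y (r - r / (real i + 2))))"
      unfolding B_UN_incseq[OF r(1), of y, symmetric] by (simp add: SUP_mult_left_ennreal)
    also have "\<dots> \<le> emeasure M (B y r)"
    proof (rule SUP_least)
      fix i :: nat
      have "0 < r / (real i + 2)" using r by simp
      then obtain q where q: "q \<in> \<rat>" "r - r / (real i + 2) < q" "q < r"
        using Rats_dense_in_real[of "r - r / (real i + 2)" r] by auto
      have "0 < r - r / (real i + 2)" using r by (simp add: field_simps add_pos_nonneg)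
      then have q0: "0 < q" using q by simp
      have "of_nat K * emeasure \<nu> (B y (r - r / (real i + 2))) \<le> of_nat K * emeasure \<nu> (B y q)"
        using q q0 y \<nu>_sets by (intro mult_left_mono emeasure_mono qball_mono) (auto intro: qball_sets)
      also have "\<dots> \<le> emeasure M (B y q)" using q q0 r by (intro rat) auto
      also have "\<dots> \<le> emeasure M (B y r)"
        using q r y by (intro emeasure_mono qball_mono) (auto intro: qball_sets)
      finally show "of_nat K * emeasure \<nu> (B y (r - r / (real i + 2))) \<le> emeasure M (B y r)" .
    qed
    finally show ?thesis using \<nu>[OF qball_sets[OF y r(1)]] by simp
  qed
  then show ?thesis
    unfolding eventually_at_right_field by (intro exI[of _ "1 / Suc n"]) auto
qed

end

lemma ennreal_dense_real:
  assumes "a < (b :: ennreal)"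
  obtains c where "0 \<le> c" "a < ennreal c" "ennreal c < b"
proof -
  obtain z where "a < z" "z < b" using dense[OF assms] by blast
  then show ?thesis using that[of "enn2real z"] by (cases z) auto
qed

section \<open>Lebesgue differentiation with a parameter\<close>

context homogeneous
begin

text \<open>If \<open>c\<close> is at least \<open>k (s, y)\<close>, the positive part of
  \<open>k - c\<close> vanishes at \<open>y\<close>, so off its bad sets its averages tend to 0 and
  the averages of \<open>k\<close> are eventually below any bound larger than \<open>c\<close>; the
  positive part of \<open>c - k\<close> gives the bounds from below. Rational \<open>c\<close> and
  net balls suffice, so \<open>Z\<close> is a countable union of sets that are null in the
  product.\<close>

lemma fibrewise_differentiation:
  assumes k[measurable]: "k \<in> borel_measurable (P \<Otimes>\<^sub>M M)"
  obtains Z where "Z \<in> null_sets (P \<Otimes>\<^sub>M M)"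
    "\<And>s y r. s \<in> space P \<Longrightarrow> y \<in> space M \<Longrightarrow> (s, y) \<notin> Z \<Longrightarrow> 0 < r \<Longrightarrow>
      (\<integral>\<^sup>+x\<in>B y r. k (s, x) \<partial>M) < \<infinity> \<Longrightarrow>
      ((\<lambda>r. (\<integral>\<^sup>+x\<in>B y r. k (s, x) \<partial>M) / emeasure M (B y r)) \<longlongrightarrow> k (s, y)) (at_right 0)"
proof -
  define L where "L s A = (\<integral>\<^sup>+x\<in>A. k (s, x) \<partial>M)" for s A
  \<comment> \<open>Restricted to one net ball and to those \<open>s\<close> for which
    \<open>k\<close> is integrable over it: \<open>null_sets_bad_set\<close> asks for a finite
    integral at every \<open>s\<close>.\<close>
  define mp where "mp c t q = (\<lambda>(s, x). (k (s, x) - ennreal c) * indicator (B t (c1 * q)) x *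
      indicator {s \<in> space P. L s (B t (c1 * q)) < \<infinity>} s)" for c t q
  \<comment> \<open>Here the bound by \<open>c\<close> on a ball of finite measure already gives
    integrability for every \<open>s\<close>.\<close>
  define mm where "mm c t q = (\<lambda>(s, x). (ennreal c - k (s, x)) * indicator (B t (c1 * q)) x)" for c t q
  have mp_meas: "mp c t q \<in> borel_measurable (P \<Otimes>\<^sub>M M)"
    and mm_meas: "mm c t q \<in> borel_measurable (P \<Otimes>\<^sub>M M)" if "(t, q) \<in> net" for c t q
  proof -
    have [measurable]: "B t (c1 * q) \<in> sets M" using net_scale that by auto
    have [measurable]: "{s \<in> space P. L s (B t (c1 * q)) < \<infinity>} \<in> sets P" unfolding L_def by measurable
    show "mp c t q \<in> borel_measurable (P \<Otimes>\<^sub>M M)" "mm c t q \<in> borel_measurable (P \<Otimes>\<^sub>M M)"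
      unfolding mp_def mm_def by measurable
  qed
  define Z where "Z = (\<Union>c\<in>\<rat>. \<Union>(t, q)\<in>net. \<Union>K. bad_set P (mp c t q) K \<union> bad_set P (mm c t q) K)"
  show ?thesis
  proof
    have "bad_set P (mp c t q) K \<in> null_sets (P \<Otimes>\<^sub>M M)" "bad_set P (mm c t q) K \<in> null_sets (P \<Otimes>\<^sub>M M)"
      if tq: "(t, q) \<in> net" for c t q K
    proof -
      have G[measurable]: "B t (c1 * q) \<in> sets M" using net_scale tq by auto
      show "bad_set P (mp c t q) K \<in> null_sets (P \<Otimes>\<^sub>M M)"
      proof (rule null_sets_bad_set[OF mp_meas[OF tq]])
        fix s assume "s \<in> space P"
        show "(\<integral>\<^sup>+y. mp c t q (s, y) \<partial>M) < \<infinity>"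
        proof (cases "s \<in> {s \<in> space P. L s (B t (c1 * q)) < \<infinity>}")
          case True
          have "(\<integral>\<^sup>+y. mp c t q (s, y) \<partial>M) \<le> L s (B t (c1 * q))"
            unfolding L_def mp_def
            by (intro nn_integral_mono) (auto simp: indicator_def diff_le_self_ennreal)
          then show ?thesis using True by (auto intro: le_less_trans)
        qed (simp add: mp_def)
      qed
      show "bad_set P (mm c t q) K \<in> null_sets (P \<Otimes>\<^sub>M M)"
      proof (rule null_sets_bad_set[OF mm_meas[OF tq]])
        fix s assume "s \<in> space P"
        have "(\<integral>\<^sup>+y. mm c t q (s, y) \<partial>M) \<le> (\<integral>\<^sup>+y\<in>B t (c1 * q). ennreal c \<partial>M)"
          unfolding mm_def by (intro nn_integral_mono) (auto simp: indicator_def diff_le_self_ennreal)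
        also have "\<dots> = ennreal c * emeasure M (B t (c1 * q))" by (rule nn_integral_cmult_indicator) (rule G)
        also have "\<dots> < \<infinity>" using qball_finite[OF netD(1)[OF tq] net_scale(1)[OF tq]] by (simp add: ennreal_mult_less_top)
        finally show "(\<integral>\<^sup>+y. mm c t q (s, y) \<partial>M) < \<infinity>" .
      qed
    qed
    then show "Z \<in> null_sets (P \<Otimes>\<^sub>M M)"
      unfolding Z_def
      by (intro null_sets_UN' countable_rat countable_net) (auto intro!: null_sets_UN' null_sets.Un)
  next
    fix s y r0 assume s: "s \<in> space P" and y: "y \<in> space M" and nZ: "(s, y) \<notin> Z" and r0: "0 < r0"
      and fin: "(\<integral>\<^sup>+x\<in>B y r0. k (s, x) \<partial>M) < \<infinity>"
    have [measurable]: "(\<lambda>x. k (s, x)) \<in> borel_measurable M" using s by measurable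
    \<comment> \<open>The enlarged net ball \<open>G\<close> inherits integrability of
      \<open>k\<close> from \<open>B y r0\<close> and contains all small balls around
      \<open>y\<close>, so the cutoffs in \<open>mp\<close> and \<open>mm\<close> do not affect the
      limit.\<close>
    obtain t q where tq: "(t, q) \<in> net" "y \<in> B t q" "B t (c1 * q) \<subseteq> B y r0" "B y q \<subseteq> B t (c1 * q)"
      using ex_net[OF y r0] by metis
    define G where "G = B t (c1 * q)"
    have [measurable]: "G \<in> sets M" using net_scale tq by (auto simp: G_def)
    have q: "0 < q" using netD tq by auto
    have "L s G \<le> (\<integral>\<^sup>+x\<in>B y r0. k (s, x) \<partial>M)"
      unfolding L_def G_def using tq(3) by (intro nn_integral_mono mult_left_mono) (auto simp: indicator_def)
    then have LG: "L s G < \<infinity>" using fin by (rule le_less_trans)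
    have small: "\<forall>\<^sub>F r in at_right (0::real). 0 < r \<and> B y r \<subseteq> G"
      unfolding eventually_at_right_field using q tq(4) qball_mono[of _ q "space M" d y]
      by (intro exI[of _ q]) (auto simp: G_def dest: less_imp_le)
    have pos: "\<exists>\<mu>>0. emeasure M (B y r) = ennreal \<mu>" if "0 < r" for r
      using qball_pos[OF y that] qball_finite[OF y that] by (cases "emeasure M (B y r)") auto
    have "((\<lambda>r. L s (B y r) / emeasure M (B y r)) \<longlongrightarrow> k (s, y)) (at_right 0)"
    proof (rule order_tendstoI)
      fix a assume a: "a < k (s, y)"
      obtain b where b: "0 \<le> b" "a < ennreal b" "ennreal b < k (s, y)" using ennreal_dense_real[OF a] .
      obtain b' where b': "0 \<le> b'" "ennreal b < ennreal b'" "ennreal b' < k (s, y)" using ennreal_dense_real[OF b(3)] .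
      then have "b < b'" using b by (simp add: ennreal_less_iff)
      then obtain c where c: "c \<in> \<rat>" "b < c" "c < b'" using Rats_dense_in_real by blast
      have ck: "ennreal c \<le> k (s, y)"
        using b'(3) c(3) b by (meson ennreal_leI less_imp_le order_trans)
      \<comment> \<open>The average of the error term is at most \<open>1 / Suc K\<close>, which
        fits into the gap between \<open>b\<close> and \<open>c\<close>.\<close>
      obtain K :: nat where K: "1 / Suc K < c - b" using reals_Archimedean[of "c - b"] c by (auto simp: inverse_eq_divide)
      have ev: "\<forall>\<^sub>F r in at_right 0. of_nat (Suc K) * (\<integral>\<^sup>+x\<in>B y r. mm c t q (s, x) \<partial>M) \<le> emeasure M (B y r)"
      proof (rule eventually_not_bad[OF mm_meas[OF tq(1)] s y])
        show "mm c t q (s, y) = 0" using ck by (simp add: mm_def diff_eq_0_iff_ennreal)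
        show "(s, y) \<notin> bad_set P (mm c t q) K" for K using nZ c tq(1) unfolding Z_def by blast
      qed
      show "\<forall>\<^sub>F r in at_right 0. a < L s (B y r) / emeasure M (B y r)"
        using ev small
      proof eventually_elim
        case (elim r)
        have [measurable]: "B y r \<in> sets M" using y elim by (intro qball_sets) auto
        obtain \<mu> where \<mu>: "0 < \<mu>" "emeasure M (B y r) = ennreal \<mu>" using pos elim by blast
        let ?P = "\<integral>\<^sup>+x\<in>B y r. mm c t q (s, x) \<partial>M"
        have [measurable]: "(\<lambda>x. mm c t q (s, x)) \<in> borel_measurable M" using mm_meas[OF tq(1)] s by measurable
        have "ennreal c * emeasure M (B y r) = (\<integral>\<^sup>+x\<in>B y r. ennreal c \<partial>M)"
          by (rule nn_integral_cmult_indicator[symmetric]) measurable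
        also have "\<dots> \<le> (\<integral>\<^sup>+x. k (s, x) * indicator (B y r) x + mm c t q (s, x) * indicator (B y r) x \<partial>M)"
        proof (rule nn_integral_mono)
          fix x
          have "ennreal c \<le> k (s, x) + (ennreal c - k (s, x))"
            by (metis add.commute add_diff_inverse_ennreal diff_add_self_ennreal le_add2 linear)
          then show "ennreal c * indicator (B y r) x \<le> k (s, x) * indicator (B y r) x + mm c t q (s, x) * indicator (B y r) x"
            using elim by (auto simp: mm_def indicator_def G_def)
        qed
        also have "\<dots> = L s (B y r) + ?P" unfolding L_def by (rule nn_integral_add) measurable
        finally have 1: "ennreal c * ennreal \<mu> \<le> L s (B y r) + ?P" unfolding \<mu> .
        have 2: "of_nat (Suc K) * ?P \<le> ennreal \<mu>" using elim \<mu> by simp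
        then have "?P \<noteq> top" by (auto simp: top_unique ennreal_mult_top)
        then obtain \<pi> where \<pi>: "?P = ennreal \<pi>" "0 \<le> \<pi>" by (cases ?P) auto
        have K\<pi>: "Suc K * \<pi> \<le> \<mu>"
          using 2 \<pi> \<mu> by (simp add: ennreal_of_nat_eq_real_of_nat ennreal_mult[symmetric] del: of_nat_Suc)
        have "ennreal b \<le> L s (B y r) / ennreal \<mu>"
        proof (cases "L s (B y r)")
          case (real l)
          have "c * \<mu> \<le> l + \<pi>"
            using 1 real \<pi> \<mu> b c by (simp add: ennreal_mult[symmetric] ennreal_plus[symmetric] del: ennreal_plus)
          moreover have "\<pi> \<le> (c - b) * \<mu>"
          proof -
            have "\<pi> \<le> \<mu> * (1 / Suc K)" using K\<pi> by (simp add: field_simps)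
            also have "\<dots> \<le> \<mu> * (c - b)" using K \<mu> by (intro mult_left_mono) auto
            finally show ?thesis by (simp add: mult.commute)
          qed
          ultimately have "b * \<mu> \<le> l" by (simp add: algebra_simps)
          then have "b \<le> l / \<mu>" using \<mu> by (simp add: field_simps)
          then show ?thesis using real \<mu> by (simp add: divide_ennreal ennreal_leI)
        qed (use \<mu> in \<open>simp add: ennreal_top_divide\<close>)
        with b(2) show ?case unfolding \<mu> by (rule less_le_trans)
      qed
    next
      fix a assume a: "k (s, y) < a"
      obtain b where b: "0 \<le> b" "k (s, y) < ennreal b" "ennreal b < a" using ennreal_dense_real[OF a] .
      obtain b' where b': "0 \<le> b'" "k (s, y) < ennreal b'" "ennreal b' < ennreal b" using ennreal_dense_real[OF b(2)] .
      then have "b' < b" using b by (simp add: ennreal_less_iff)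
      then obtain c where c: "c \<in> \<rat>" "b' < c" "c < b" using Rats_dense_in_real by blast
      have ck: "k (s, y) \<le> ennreal c"
        using b'(2) c(2) by (meson ennreal_leI less_imp_le order_trans)
      obtain K :: nat where K: "1 / Suc K < b - c" using reals_Archimedean[of "b - c"] c by (auto simp: inverse_eq_divide)
      have ev: "\<forall>\<^sub>F r in at_right 0. of_nat (Suc K) * (\<integral>\<^sup>+x\<in>B y r. mp c t q (s, x) \<partial>M) \<le> emeasure M (B y r)"
      proof (rule eventually_not_bad[OF mp_meas[OF tq(1)] s y])
        show "mp c t q (s, y) = 0" using ck le_less_trans[OF ck ennreal_less_top] by (simp add: mp_def diff_eq_0_iff_ennreal)
        show "(s, y) \<notin> bad_set P (mp c t q) K" for K using nZ c tq(1) unfolding Z_def by blast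
      qed
      show "\<forall>\<^sub>F r in at_right 0. L s (B y r) / emeasure M (B y r) < a"
        using ev small
      proof eventually_elim
        case (elim r)
        have [measurable]: "B y r \<in> sets M" using y elim by (intro qball_sets) auto
        obtain \<mu> where \<mu>: "0 < \<mu>" "emeasure M (B y r) = ennreal \<mu>" using pos elim by blast
        let ?P = "\<integral>\<^sup>+x\<in>B y r. mp c t q (s, x) \<partial>M"
        have [measurable]: "(\<lambda>x. mp c t q (s, x)) \<in> borel_measurable M" using mp_meas[OF tq(1)] s by measurable
        have "L s (B y r) \<le> (\<integral>\<^sup>+x. ennreal c * indicator (B y r) x + mp c t q (s, x) * indicator (B y r) x \<partial>M)"
          unfolding L_def
        proof (rule nn_integral_mono)
          fix x
          have "k (s, x) \<le> ennreal c + (k (s, x) - ennreal c)"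
            by (metis add.commute add_diff_inverse_ennreal diff_add_self_ennreal le_add2 linear)
          then show "k (s, x) * indicator (B y r) x \<le> ennreal c * indicator (B y r) x + mp c t q (s, x) * indicator (B y r) x"
            using elim s LG by (auto simp: mp_def indicator_def G_def)
        qed
        also have "\<dots> = (\<integral>\<^sup>+x\<in>B y r. ennreal c \<partial>M) + ?P" by (rule nn_integral_add) measurable
        also have "(\<integral>\<^sup>+x\<in>B y r. ennreal c \<partial>M) = ennreal c * emeasure M (B y r)"
          by (rule nn_integral_cmult_indicator) measurable
        finally have 1: "L s (B y r) \<le> ennreal c * ennreal \<mu> + ?P" unfolding \<mu> .
        have 2: "of_nat (Suc K) * ?P \<le> ennreal \<mu>" using elim \<mu> by simp
        then have "?P \<noteq> top" by (auto simp: top_unique ennreal_mult_top)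
        then obtain \<pi> where \<pi>: "?P = ennreal \<pi>" "0 \<le> \<pi>" by (cases ?P) auto
        have K\<pi>: "Suc K * \<pi> \<le> \<mu>"
          using 2 \<pi> \<mu> by (simp add: ennreal_of_nat_eq_real_of_nat ennreal_mult[symmetric] del: of_nat_Suc)
        have "\<pi> \<le> \<mu> * (1 / Suc K)" using K\<pi> by (simp add: field_simps)
        also have "\<dots> \<le> \<mu> * (b - c)" using K \<mu> by (intro mult_left_mono) auto
        finally have \<pi>b: "c * \<mu> + \<pi> \<le> b * \<mu>" by (simp add: algebra_simps)
        have "L s (B y r) \<le> ennreal (c * \<mu> + \<pi>)"
          using 1 \<pi> \<mu> b' c by (simp add: ennreal_mult[symmetric] ennreal_plus[symmetric] del: ennreal_plus)
        also have "\<dots> \<le> ennreal (b * \<mu>)" using \<pi>b by (rule ennreal_leI)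
        finally have "L s (B y r) / ennreal \<mu> \<le> ennreal (b * \<mu>) / ennreal \<mu>" by (rule divide_right_mono_ennreal)
        also have "\<dots> = ennreal b" using \<mu> b by (simp add: divide_ennreal)
        also have "\<dots> < a" by fact
        finally show ?case unfolding \<mu> .
      qed
    qed
    then show "((\<lambda>r. (\<integral>\<^sup>+x\<in>B y r. k (s, x) \<partial>M) / emeasure M (B y r)) \<longlongrightarrow> k (s, y)) (at_right 0)"
      unfolding L_def .
  qed
qed

end

section \<open>Densities of the fibre measures\<close>

abbreviation slice_space :: "'b measure \<Rightarrow> ('a \<times> 'b) set \<Rightarrow> 'a \<Rightarrow> 'b measure" where
  "slice_space X U s \<equiv> restrict_space (completion X) (slice U s)"

lemma emeasure_distr_restrict_space:
  assumes \<Omega>: "\<Omega> \<in> sets N" and f: "f \<in> restrict_space N \<Omega> \<rightarrow>\<^sub>M M" and V: "V \<in> sets M"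
  shows "emeasure (distr (restrict_space N \<Omega>) M f) V = emeasure N {x \<in> \<Omega>. f x \<in> V}"
proof -
  have \<Omega>': "\<Omega> \<inter> space N \<in> sets N" using \<Omega> by auto
  have sp: "space (restrict_space N \<Omega>) = \<Omega>" using sets.sets_into_space[OF \<Omega>] by (auto simp: space_restrict_space)
  have "emeasure (distr (restrict_space N \<Omega>) M f) V = emeasure (restrict_space N \<Omega>) (f -` V \<inter> \<Omega>)"
    using emeasure_distr[OF f V] by (simp add: sp)
  also have "\<dots> = emeasure N (f -` V \<inter> \<Omega>)" by (rule emeasure_restrict_space[OF \<Omega>']) auto
  also have "f -` V \<inter> \<Omega> = {x \<in> \<Omega>. f x \<in> V}" by auto
  finally show ?thesis .
qed

lemma nn_integral_distr_restrict_space: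
  assumes \<Omega>: "\<Omega> \<in> sets N" and f: "f \<in> restrict_space N \<Omega> \<rightarrow>\<^sub>M M" and g: "g \<in> borel_measurable M"
  shows "(\<integral>\<^sup>+y. g y \<partial>distr (restrict_space N \<Omega>) M f) = (\<integral>\<^sup>+x. g (f x) * indicator \<Omega> x \<partial>N)"
proof -
  have "(\<integral>\<^sup>+y. g y \<partial>distr (restrict_space N \<Omega>) M f) = (\<integral>\<^sup>+x. g (f x) \<partial>restrict_space N \<Omega>)"
    using f g by (intro nn_integral_distr) simp_all
  also have "\<dots> = (\<integral>\<^sup>+x. g (f x) * indicator \<Omega> x \<partial>N)"
    using \<Omega> by (intro nn_integral_restrict_space) auto
  finally show ?thesis .
qed

lemma sets_restrict_space_vimage:
  assumes \<Omega>: "\<Omega> \<in> sets N" and f: "f \<in> restrict_space N \<Omega> \<rightarrow>\<^sub>M M" and V: "V \<in> sets M"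
  shows "{x \<in> \<Omega>. f x \<in> V} \<in> sets N"
proof -
  have \<Omega>': "\<Omega> \<inter> space N \<in> sets N" using \<Omega> by auto
  have sp: "space (restrict_space N \<Omega>) = \<Omega>" using sets.sets_into_space[OF \<Omega>] by (auto simp: space_restrict_space)
  have "f -` V \<inter> space (restrict_space N \<Omega>) = {x \<in> \<Omega>. f x \<in> V}" using sp by auto
  then show ?thesis using measurable_sets[OF f V] sets_restrict_space_iff[OF \<Omega>', of "{x \<in> \<Omega>. f x \<in> V}"] by auto
qed

section \<open>Tonelli's theorem for the completed product measure\<close>

context pair_sigma_finite
begin

lemma AE_fst: "(AE s in M1. P s) \<Longrightarrow> AE z in M1 \<Otimes>\<^sub>M M2. P (fst z)"
proof -
  assume "AE s in M1. P s"
  then obtain N where N: "{s \<in> space M1. \<not> P s} \<subseteq> N" "N \<in> null_sets M1"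
    by (auto elim!: AE_E simp: null_sets_def)
  have "AE z in M1 \<Otimes>\<^sub>M M2. z \<notin> N \<times> space M2"
    by (rule AE_not_in[OF M2.times_in_null_sets1[OF N(2) sets.top]])
  then show ?thesis
    using AE_space by eventually_elim (use N(1) in \<open>auto simp: space_pair_measure\<close>)
qed

text \<open>\<open>C\<close> is the union of its main part, which belongs to the product
  sigma-algebra, and a subset of a null set of the product. Almost every slice of that null set is
  null, so almost every slice of \<open>C\<close> is measurable for the completed fibre measure and
  has the measure of the slice of the main part.\<close>

lemma completion_pair_sets_version:
  assumes C: "C \<in> sets (completion (M1 \<Otimes>\<^sub>M M2))"
  obtains A where "A \<in> sets (M1 \<Otimes>\<^sub>M M2)" "emeasure (completion (M1 \<Otimes>\<^sub>M M2)) C = emeasure (M1 \<Otimes>\<^sub>M M2) A"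
    "AE s in M1. slice C s \<in> sets (completion M2) \<and> emeasure (completion M2) (slice C s) = emeasure M2 (Pair s -` A)"
proof -
  let ?A = "main_part (M1 \<Otimes>\<^sub>M M2) C"
  have A: "?A \<in> sets (M1 \<Otimes>\<^sub>M M2)" using C by (rule main_part_sets)
  obtain N where N: "N \<in> null_sets (M1 \<Otimes>\<^sub>M M2)" "null_part (M1 \<Otimes>\<^sub>M M2) C \<subseteq> N" using null_part[OF C] by auto
  have "AE z in M1 \<Otimes>\<^sub>M M2. z \<notin> N" using N(1) by (rule AE_not_in)
  then have "AE s in M1. AE x in M2. (s, x) \<notin> N" by (rule AE_pair)
  then have "AE s in M1. slice C s \<in> sets (completion M2) \<and> emeasure (completion M2) (slice C s) = emeasure M2 (Pair s -` ?A)"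
    using AE_space
  proof eventually_elim
    case (elim s)
    have As: "Pair s -` ?A \<in> sets M2" using A by (rule sets_Pair1)
    have Cs: "slice C s = Pair s -` ?A \<union> Pair s -` null_part (M1 \<Otimes>\<^sub>M M2) C"
      using main_part_null_part_Un[OF C] by (auto simp: slice_def)
    have Ns: "Pair s -` N \<in> sets M2" using N by (intro sets_Pair1) auto
    have "emeasure M2 (Pair s -` N) = 0"
      using elim Ns sets.sets_into_space[OF Ns] by (subst (asm) AE_iff_measurable[OF Ns]) auto
    then have N0: "Pair s -` N \<in> null_sets M2" using Ns by auto
    have sub: "Pair s -` null_part (M1 \<Otimes>\<^sub>M M2) C \<subseteq> Pair s -` N" using N by auto
    then have null: "Pair s -` null_part (M1 \<Otimes>\<^sub>M M2) C \<in> null_sets (completion M2)"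
      using N0 null_sets_completion_subset null_sets_completionI by blast
    show ?case
      unfolding Cs using As null by (auto simp: emeasure_Un_null_set)
  qed
  then show ?thesis using that[OF A] C by simp
qed

lemma AE_slice_sets:
  "C \<in> sets (completion (M1 \<Otimes>\<^sub>M M2)) \<Longrightarrow> AE s in M1. slice C s \<in> sets (completion M2)"
  using completion_pair_sets_version[of C] by (auto elim!: eventually_mono)

lemma emeasure_completion_pair:
  assumes C: "C \<in> sets (completion (M1 \<Otimes>\<^sub>M M2))"
  shows "emeasure (completion (M1 \<Otimes>\<^sub>M M2)) C = (\<integral>\<^sup>+s. emeasure (completion M2) (slice C s) \<partial>M1)"
proof -
  obtain A where A: "A \<in> sets (M1 \<Otimes>\<^sub>M M2)" "emeasure (completion (M1 \<Otimes>\<^sub>M M2)) C = emeasure (M1 \<Otimes>\<^sub>M M2) A"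
    "AE s in M1. slice C s \<in> sets (completion M2) \<and> emeasure (completion M2) (slice C s) = emeasure M2 (Pair s -` A)"
    using completion_pair_sets_version[OF C] by blast
  have "emeasure (M1 \<Otimes>\<^sub>M M2) A = (\<integral>\<^sup>+s. emeasure M2 (Pair s -` A) \<partial>M1)"
    using A(1) by (rule M2.emeasure_pair_measure_alt)
  also have "\<dots> = (\<integral>\<^sup>+s. emeasure (completion M2) (slice C s) \<partial>M1)"
  proof (rule nn_integral_cong_AE)
    show "AE s in M1. emeasure M2 (Pair s -` A) = emeasure (completion M2) (slice C s)"
      using A(3) by eventually_elim (simp del: emeasure_completion)
  qed
  finally show ?thesis using A(2) by simp
qed

lemma completion_measurable_emeasure_slice:
  assumes C: "C \<in> sets (completion (M1 \<Otimes>\<^sub>M M2))"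
  obtains l where "l \<in> borel_measurable M1" "AE s in M1. emeasure (completion M2) (slice C s) = l s"
proof -
  obtain A where A: "A \<in> sets (M1 \<Otimes>\<^sub>M M2)"
    "AE s in M1. slice C s \<in> sets (completion M2) \<and> emeasure (completion M2) (slice C s) = emeasure M2 (Pair s -` A)"
    using completion_pair_sets_version[OF C] by blast
  show ?thesis
    by (rule that[of "\<lambda>s. emeasure M2 (Pair s -` A)"])
      (use A in \<open>auto intro: M2.measurable_emeasure_Pair elim!: eventually_mono simp del: emeasure_completion\<close>)
qed

lemma null_sets_completion_pair_iff:
  assumes C: "C \<in> sets (completion (M1 \<Otimes>\<^sub>M M2))"
  shows "C \<in> null_sets (completion (M1 \<Otimes>\<^sub>M M2)) \<longleftrightarrow> (AE s in M1. slice C s \<in> null_sets (completion M2))"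
proof -
  obtain A where A: "A \<in> sets (M1 \<Otimes>\<^sub>M M2)" "emeasure (completion (M1 \<Otimes>\<^sub>M M2)) C = emeasure (M1 \<Otimes>\<^sub>M M2) A"
    "AE s in M1. slice C s \<in> sets (completion M2) \<and> emeasure (completion M2) (slice C s) = emeasure M2 (Pair s -` A)"
    using completion_pair_sets_version[OF C] by blast
  have "C \<in> null_sets (completion (M1 \<Otimes>\<^sub>M M2)) \<longleftrightarrow> emeasure (M1 \<Otimes>\<^sub>M M2) A = 0"
    using C A(2) by (auto simp del: emeasure_completion)
  also have "\<dots> \<longleftrightarrow> (AE s in M1. emeasure M2 (Pair s -` A) = 0)"
    unfolding M2.emeasure_pair_measure_alt[OF A(1)]
    by (rule nn_integral_0_iff_AE) (rule M2.measurable_emeasure_Pair[OF A(1)])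
  also have "\<dots> \<longleftrightarrow> (AE s in M1. slice C s \<in> null_sets (completion M2))"
  proof
    assume "AE s in M1. emeasure M2 (Pair s -` A) = 0"
    with A(3) show "AE s in M1. slice C s \<in> null_sets (completion M2)"
      by eventually_elim (auto simp: null_sets_def simp del: emeasure_completion)
  next
    assume "AE s in M1. slice C s \<in> null_sets (completion M2)"
    with A(3) show "AE s in M1. emeasure M2 (Pair s -` A) = 0"
      by eventually_elim (auto simp: null_sets_def simp del: emeasure_completion)
  qed
  finally show ?thesis .
qed

end

section \<open>Jointly measurable densities of images of fibre measures\<close>

context homogeneous
begin

text \<open>A countable generator closed under intersection: countable, so that statements holding
  for almost every \<open>s\<close> for each member hold for almost every \<open>s\<close> for all
  members at once; intersection-stable, so that finite measures are determined by it. The empty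
  family contributes the whole space.\<close>

definition basis :: "'a set set" where
  "basis = (\<lambda>F. space M \<inter> \<Inter>F) ` {F. finite F \<and> F \<subseteq> (\<lambda>(t, q). B t q) ` net}"

lemma countable_basis: "countable basis"
  unfolding basis_def by (intro countable_image countable_Collect_finite_subset countable_net)

lemma space_in_basis: "space M \<in> basis"
  unfolding basis_def by (rule image_eqI[of _ _ "{}"]) auto

lemma Int_stable_basis: "Int_stable basis"
proof (rule Int_stableI)
  fix a b assume "a \<in> basis" "b \<in> basis"
  then obtain F G where FG: "finite F" "F \<subseteq> (\<lambda>(t, q). B t q) ` net" "a = space M \<inter> \<Inter>F"
    "finite G" "G \<subseteq> (\<lambda>(t, q). B t q) ` net" "b = space M \<inter> \<Inter>G"
    by (auto simp: basis_def)
  then show "a \<inter> b \<in> basis"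
    unfolding basis_def by (intro image_eqI[of _ _ "F \<union> G"]) auto
qed

lemma sets_basis: "V \<in> basis \<Longrightarrow> V \<in> sets M"
proof -
  assume "V \<in> basis"
  then obtain F where F: "finite F" "F \<subseteq> (\<lambda>(t, q). B t q) ` net" "V = space M \<inter> \<Inter>F" by (auto simp: basis_def)
  then have "F \<subseteq> sets M" using sets_net by auto
  then show "V \<in> sets M" using F by (cases "F = {}") (auto intro!: sets.Int sets.finite_INT[of F "\<lambda>x. x", simplified])
qed

lemma sets_eq_basis: "sets M = sigma_sets (space M) basis"
proof (rule antisym)
  have "(\<lambda>(t, q). B t q) ` net \<subseteq> basis"
  proof
    fix V assume "V \<in> (\<lambda>(t, q). B t q) ` net"
    then show "V \<in> basis" unfolding basis_def using B_subset_space by (intro image_eqI[of _ _ "{V}"]) auto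
  qed
  then show "sets M \<subseteq> sigma_sets (space M) basis" unfolding sets_eq_net by (rule sigma_sets_mono')
  show "sigma_sets (space M) basis \<subseteq> sets M" by (intro sets.sigma_sets_subset) (auto intro: sets_basis)
qed

lemma AE_measurable_slice_map:
  assumes S: "sigma_finite_measure S" and X: "sigma_finite_measure X"
    and U: "U \<in> sets (completion (S \<Otimes>\<^sub>M X))"
    and \<zeta>: "\<zeta> \<in> restrict_space (completion (S \<Otimes>\<^sub>M X)) U \<rightarrow>\<^sub>M M"
  shows "AE s in S. slice U s \<in> sets (completion X) \<and> (\<lambda>x. \<zeta> (s, x)) \<in> slice_space X U s \<rightarrow>\<^sub>M M"
proof -
  interpret SX: pair_sigma_finite S X using S X by (rule pair_sigma_finite.intro)
  have Usp: "U \<subseteq> space (S \<Otimes>\<^sub>M X)" using sets.sets_into_space[OF U] by simp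
  have pre: "{z \<in> U. \<zeta> z \<in> A} \<in> sets (completion (S \<Otimes>\<^sub>M X))" if "A \<in> sets M" for A
    by (rule sets_restrict_space_vimage[OF U \<zeta> that])
  have "AE s in S. \<forall>V\<in>basis. slice {z \<in> U. \<zeta> z \<in> V} s \<in> sets (completion X)"
    using countable_basis by (intro AE_ball_countable') (auto intro!: SX.AE_slice_sets pre sets_basis)
  with SX.AE_slice_sets[OF U] show ?thesis
  proof eventually_elim
    case (elim s)
    have spU: "space (slice_space X U s) = slice U s"
      using sets.sets_into_space[OF elim(1)] by (auto simp: space_restrict_space)
    have "(\<lambda>x. \<zeta> (s, x)) \<in> slice_space X U s \<rightarrow>\<^sub>M sigma (space M) basis"
    proof (rule measurable_measure_of)
      show "basis \<subseteq> Pow (space M)" using sets_basis sets.sets_into_space by auto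
      show "(\<lambda>x. \<zeta> (s, x)) \<in> space (slice_space X U s) \<rightarrow> space M"
        unfolding spU using measurable_space[OF \<zeta>] Usp by (auto simp: slice_def space_restrict_space)
      fix V assume V: "V \<in> basis"
      have "(\<lambda>x. \<zeta> (s, x)) -` V \<inter> slice U s = slice {z \<in> U. \<zeta> z \<in> V} s" by (auto simp: slice_def)
      then have "(\<lambda>x. \<zeta> (s, x)) -` V \<inter> slice U s \<in> sets (completion X)" using elim V by simp
      then show "(\<lambda>x. \<zeta> (s, x)) -` V \<inter> space (slice_space X U s) \<in> sets (slice_space X U s)"
        unfolding spU using elim(1) by (subst sets_restrict_space_iff) auto
    qed
    moreover have "sets (sigma (space M) basis) = sets M"
      using sets_eq_basis sets_basis sets.sets_into_space by (subst sets_measure_of) auto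
    ultimately show ?case using elim(1) measurable_cong_sets[OF refl \<open>sets (sigma (space M) basis) = sets M\<close>] by auto
  qed
qed

text \<open>The image of the product measure on \<open>U\<close> under
  \<open>(s, x) \<mapsto> (s, \<zeta> (s, x))\<close> is absolutely continuous by Tonelli's theorem,
  and its Radon-Nikodym derivative is jointly measurable from the start. It remains to recognise its
  sections as fibre densities, first on \<open>basis\<close> and then, as the fibre images are
  finite, on all measurable sets.\<close>

lemma ex_kernel_density_finite:
  assumes S: "sigma_finite_measure S" and X: "sigma_finite_measure X"
    and U: "U \<in> sets (completion (S \<Otimes>\<^sub>M X))"
    and \<zeta>: "\<zeta> \<in> restrict_space (completion (S \<Otimes>\<^sub>M X)) U \<rightarrow>\<^sub>M M"
    and null: "AE s in S. \<forall>Z\<in>null_sets M. {x \<in> slice U s. \<zeta> (s, x) \<in> Z} \<in> null_sets (completion X)"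
    and fin: "AE s in S. emeasure (completion X) (slice U s) < \<infinity>"
  shows "\<exists>k\<in>borel_measurable (S \<Otimes>\<^sub>M M). AE s in S.
    distr (slice_space X U s) M (\<lambda>x. \<zeta> (s, x)) = density M (\<lambda>y. k (s, y))"
proof -
  interpret SX: pair_sigma_finite S X using S X by (rule pair_sigma_finite.intro)
  interpret SM: pair_sigma_finite S M using S sigma_finite_measure_axioms by (rule pair_sigma_finite.intro)
  let ?R = "restrict_space (completion (S \<Otimes>\<^sub>M X)) U"
  let ?L = "\<lambda>s. distr (slice_space X U s) M (\<lambda>x. \<zeta> (s, x))"
  define \<Phi> where "\<Phi> z = (fst z, \<zeta> z)" for z
  have [measurable]: "\<zeta> \<in> ?R \<rightarrow>\<^sub>M M" by (rule \<zeta>)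
  have [measurable]: "fst \<in> ?R \<rightarrow>\<^sub>M S" by (intro measurable_restrict_space1 measurable_completion) auto
  have \<Phi>[measurable]: "\<Phi> \<in> ?R \<rightarrow>\<^sub>M S \<Otimes>\<^sub>M M" unfolding \<Phi>_def by measurable
  have Usp: "U \<subseteq> space (S \<Otimes>\<^sub>M X)" using sets.sets_into_space[OF U] by simp
  define \<Lambda> where "\<Lambda> = distr ?R (S \<Otimes>\<^sub>M M) \<Phi>"
  have pre: "{z \<in> U. \<Phi> z \<in> C} \<in> sets (completion (S \<Otimes>\<^sub>M X))" if C: "C \<in> sets (S \<Otimes>\<^sub>M M)" for C
    by (rule sets_restrict_space_vimage[OF U \<Phi> C])
  have \<Lambda>: "emeasure \<Lambda> C = (\<integral>\<^sup>+s. emeasure (completion X) {x \<in> slice U s. (s, \<zeta> (s, x)) \<in> C} \<partial>S)"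
    if C: "C \<in> sets (S \<Otimes>\<^sub>M M)" for C
  proof -
    have "emeasure \<Lambda> C = emeasure (completion (S \<Otimes>\<^sub>M X)) {z \<in> U. \<Phi> z \<in> C}"
      unfolding \<Lambda>_def by (rule emeasure_distr_restrict_space[OF U \<Phi> C])
    also have "\<dots> = (\<integral>\<^sup>+s. emeasure (completion X) (slice {z \<in> U. \<Phi> z \<in> C} s) \<partial>S)"
      by (rule SX.emeasure_completion_pair[OF pre[OF C]])
    also have "(\<lambda>s. slice {z \<in> U. \<Phi> z \<in> C} s) = (\<lambda>s. {x \<in> slice U s. (s, \<zeta> (s, x)) \<in> C})"
      by (auto simp: slice_def \<Phi>_def)
    finally show ?thesis .
  qed
  have "absolutely_continuous (S \<Otimes>\<^sub>M M) \<Lambda>"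
    unfolding absolutely_continuous_def
  proof
    fix C assume C: "C \<in> null_sets (S \<Otimes>\<^sub>M M)"
    then have Cs: "C \<in> sets (S \<Otimes>\<^sub>M M)" by auto
    have "AE z in S \<Otimes>\<^sub>M M. z \<notin> C" using C by (rule AE_not_in)
    then have "AE s in S. AE y in M. (s, y) \<notin> C" by (rule SM.AE_pair)
    with null AE_space have "AE s in S. emeasure (completion X) {x \<in> slice U s. (s, \<zeta> (s, x)) \<in> C} = 0"
    proof eventually_elim
      case (elim s)
      have Css: "Pair s -` C \<in> sets M" using Cs by (rule sets_Pair1)
      then have "emeasure M (Pair s -` C) = 0"
        using elim sets.sets_into_space[OF Css] by (subst (asm) AE_iff_measurable[OF Css]) auto
      then have "Pair s -` C \<in> null_sets M" using Css by auto
      then have "{x \<in> slice U s. \<zeta> (s, x) \<in> Pair s -` C} \<in> null_sets (completion X)" using elim by blast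
      then have "emeasure (completion X) {x \<in> slice U s. \<zeta> (s, x) \<in> Pair s -` C} = 0" by (rule null_setsD1)
      then show ?case by (simp del: emeasure_completion)
    qed
    then have "emeasure \<Lambda> C = 0"
      unfolding \<Lambda>[OF Cs] by (subst nn_integral_cong_AE[where v="\<lambda>_. 0"]) auto
    then show "C \<in> null_sets \<Lambda>" using Cs by (auto simp: \<Lambda>_def)
  qed
  then obtain k where k[measurable]: "k \<in> borel_measurable (S \<Otimes>\<^sub>M M)" and dk: "density (S \<Otimes>\<^sub>M M) k = \<Lambda>"
    using sigma_finite_measure.Radon_Nikodym[OF sigma_finite_pair_measure[OF S sigma_finite_measure_axioms], of \<Lambda>] by (auto simp: \<Lambda>_def)
  have good: "AE s in S. slice U s \<in> sets (completion X) \<and> (\<lambda>x. \<zeta> (s, x)) \<in> slice_space X U s \<rightarrow>\<^sub>M M"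
    by (rule AE_measurable_slice_map[OF S X U \<zeta>])
  have "AE s in S. emeasure (completion X) {x \<in> slice U s. \<zeta> (s, x) \<in> V} = (\<integral>\<^sup>+y\<in>V. k (s, y) \<partial>M)"
    if V[measurable]: "V \<in> sets M" for V
  proof -
    have SV: "space S \<times> V \<in> sets (S \<Otimes>\<^sub>M M)" by simp
    obtain l where l[measurable]: "l \<in> borel_measurable S"
      and lV: "AE s in S. emeasure (completion X) (slice {z \<in> U. \<Phi> z \<in> space S \<times> V} s) = l s"
      using SX.completion_measurable_emeasure_slice[OF pre[OF SV]] by blast
    have sl: "slice {z \<in> U. \<Phi> z \<in> space S \<times> V} s = {x \<in> slice U s. \<zeta> (s, x) \<in> V}" for s
      using Usp by (auto simp: slice_def \<Phi>_def space_pair_measure)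
    \<comment> \<open>For fixed \<open>V\<close> both sides are measures in the base variable; they
      agree on \<open>A\<close> because both compute the image measure of the rectangle
      \<open>A \<times> V\<close>. Uniqueness of densities then gives equality for almost every
      \<open>s\<close>.\<close>
    have "density S l = density S (\<lambda>s. \<integral>\<^sup>+y\<in>V. k (s, y) \<partial>M)"
    proof (rule measure_eqI)
      fix A assume "A \<in> sets (density S l)"
      then have A[measurable]: "A \<in> sets S" by simp
      have "emeasure (density S l) A = (\<integral>\<^sup>+s\<in>A. l s \<partial>S)" by (simp add: emeasure_density)
      also have "\<dots> = (\<integral>\<^sup>+s. emeasure (completion X) {x \<in> slice U s. (s, \<zeta> (s, x)) \<in> A \<times> V} \<partial>S)"
        using lV unfolding sl
        by (intro nn_integral_cong_AE) (auto elim!: eventually_mono simp: indicator_def simp del: emeasure_completion)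
      also have "\<dots> = emeasure \<Lambda> (A \<times> V)" by (rule \<Lambda>[symmetric]) simp
      also have "\<dots> = (\<integral>\<^sup>+z\<in>A \<times> V. k z \<partial>(S \<Otimes>\<^sub>M M))"
        unfolding dk[symmetric] by (simp add: emeasure_density)
      also have "\<dots> = (\<integral>\<^sup>+s. \<integral>\<^sup>+y. k (s, y) * indicator (A \<times> V) (s, y) \<partial>M \<partial>S)"
        by (rule nn_integral_fst[symmetric]) measurable
      also have "\<dots> = (\<integral>\<^sup>+s. (\<integral>\<^sup>+y\<in>V. k (s, y) \<partial>M) * indicator A s \<partial>S)"
        by (intro nn_integral_cong) (auto simp: indicator_def intro!: nn_integral_cong)
      also have "\<dots> = emeasure (density S (\<lambda>s. \<integral>\<^sup>+y\<in>V. k (s, y) \<partial>M)) A"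
        by (subst emeasure_density) auto
      finally show "emeasure (density S l) A = emeasure (density S (\<lambda>s. \<integral>\<^sup>+y\<in>V. k (s, y) \<partial>M)) A" .
    qed simp
    then have "AE s in S. l s = (\<integral>\<^sup>+y\<in>V. k (s, y) \<partial>M)"
      by (subst (asm) sigma_finite_measure.density_unique_iff[OF S]) auto
    with lV show ?thesis unfolding sl by eventually_elim simp
  qed
  then have "AE s in S. \<forall>V\<in>basis. emeasure (completion X) {x \<in> slice U s. \<zeta> (s, x) \<in> V} = (\<integral>\<^sup>+y\<in>V. k (s, y) \<partial>M)"
    using countable_basis by (intro AE_ball_countable') (auto intro: sets_basis simp del: emeasure_completion)
  with good fin AE_space have "AE s in S. ?L s = density M (\<lambda>y. k (s, y))"
  proof eventually_elim
    case (elim s)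
    have [measurable]: "(\<lambda>y. k (s, y)) \<in> borel_measurable M" using elim by measurable
    have \<lambda>: "emeasure (?L s) V = emeasure (completion X) {x \<in> slice U s. \<zeta> (s, x) \<in> V}" if V: "V \<in> sets M" for V
      using elim(1) V by (intro emeasure_distr_restrict_space) auto
    show ?case
    proof (rule measure_eqI_generator_eq[OF Int_stable_basis, where \<Omega>="space M" and A="\<lambda>_. space M"])
      show "emeasure (?L s) V = emeasure (density M (\<lambda>y. k (s, y))) V" if "V \<in> basis" for V
        using elim that by (simp add: \<lambda> sets_basis emeasure_density del: emeasure_completion)
      have "emeasure (?L s) (space M) \<le> emeasure (completion X) (slice U s)"
        unfolding \<lambda>[OF sets.top] using elim(1) by (intro emeasure_mono) auto
      then show "emeasure (?L s) (space M) \<noteq> \<infinity>" using elim(2) by (auto simp: top_unique simp del: emeasure_completion)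
    qed (use sets_eq_basis sets_basis sets.sets_into_space space_in_basis in auto)
  qed
  then show ?thesis using k by blast
qed

end

context homogeneous
begin

text \<open>X is split into disjoint pieces of finite measure and the densities belonging to the
  pieces are added. The sum may be infinite on sets of positive measure.\<close>

lemma ex_kernel_density:
  assumes S: "sigma_finite_measure S" and X: "sigma_finite_measure X"
    and U: "U \<in> sets (completion (S \<Otimes>\<^sub>M X))"
    and \<zeta>: "\<zeta> \<in> restrict_space (completion (S \<Otimes>\<^sub>M X)) U \<rightarrow>\<^sub>M M"
    and null: "AE s in S. \<forall>Z\<in>null_sets M. {x \<in> slice U s. \<zeta> (s, x) \<in> Z} \<in> null_sets (completion X)"
  obtains k where "k \<in> borel_measurable (S \<Otimes>\<^sub>M M)"
    "AE s in S. distr (slice_space X U s) M (\<lambda>x. \<zeta> (s, x)) = density M (\<lambda>y. k (s, y))"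
proof -
  interpret X: sigma_finite_measure X by (rule X)
  obtain A :: "nat \<Rightarrow> _" where A: "range A \<subseteq> sets X" "(\<Union>i. A i) = space X" "\<And>i. emeasure X (A i) \<noteq> \<infinity>" "disjoint_family A"
    using X.sigma_finite_disjoint by blast
  have As[measurable]: "A i \<in> sets X" for i using A(1) by auto
  define V where "V i = U \<inter> (space S \<times> A i)" for i
  have Usp: "U \<subseteq> space (S \<Otimes>\<^sub>M X)" using sets.sets_into_space[OF U] by simp
  have V: "V i \<in> sets (completion (S \<Otimes>\<^sub>M X))" for i
    unfolding V_def by (rule sets.Int[OF U sets_completionI_sets]) auto
  have VU: "V i \<subseteq> U" for i by (auto simp: V_def)
  have slV: "slice (V i) s = slice U s \<inter> A i" for i s using Usp by (auto simp: V_def slice_def space_pair_measure)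
  have \<zeta>V: "\<zeta> \<in> restrict_space (completion (S \<Otimes>\<^sub>M X)) (V i) \<rightarrow>\<^sub>M M" for i
    using \<zeta> VU by (rule measurable_restrict_mono)
  have "\<exists>k\<in>borel_measurable (S \<Otimes>\<^sub>M M). AE s in S.
    distr (slice_space X (V i) s) M (\<lambda>x. \<zeta> (s, x)) = density M (\<lambda>y. k (s, y))" for i
  proof (rule ex_kernel_density_finite[OF S X V \<zeta>V])
    show "AE s in S. \<forall>Z\<in>null_sets M. {x \<in> slice (V i) s. \<zeta> (s, x) \<in> Z} \<in> null_sets (completion X)"
      using null
    proof eventually_elim
      case (elim s)
      show ?case
      proof
        fix Z assume "Z \<in> null_sets M"
        then have "{x \<in> slice U s. \<zeta> (s, x) \<in> Z} \<in> null_sets (completion X)" using elim by blast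
        then show "{x \<in> slice (V i) s. \<zeta> (s, x) \<in> Z} \<in> null_sets (completion X)"
          by (rule completion.complete2[rotated]) (auto simp: slV)
      qed
    qed
    have "emeasure (completion X) (slice (V i) s) < \<infinity>" for s
    proof -
      have "emeasure (completion X) (slice (V i) s) \<le> emeasure (completion X) (A i)"
        unfolding slV by (rule emeasure_mono) auto
      also have "\<dots> < \<infinity>" using A(3)[of i] by (simp add: less_top[symmetric])
      finally show ?thesis .
    qed
    then show "AE s in S. emeasure (completion X) (slice (V i) s) < \<infinity>" by (rule AE_I2)
  qed
  then have "\<exists>k. \<forall>i. k i \<in> borel_measurable (S \<Otimes>\<^sub>M M) \<and> (AE s in S.
    distr (slice_space X (V i) s) M (\<lambda>x. \<zeta> (s, x)) = density M (\<lambda>y. k i (s, y)))"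
    by (intro choice allI) (simp only: Bex_def)
  then obtain k where k[measurable]: "\<And>i. k i \<in> borel_measurable (S \<Otimes>\<^sub>M M)"
    and dk: "\<And>i. AE s in S. distr (slice_space X (V i) s) M (\<lambda>x. \<zeta> (s, x)) = density M (\<lambda>y. k i (s, y))"
    by blast
  show ?thesis
  proof
    show "(\<lambda>z. \<Sum>i. k i z) \<in> borel_measurable (S \<Otimes>\<^sub>M M)" by measurable
    have "AE s in S. \<forall>i. distr (slice_space X (V i) s) M (\<lambda>x. \<zeta> (s, x)) = density M (\<lambda>y. k i (s, y))"
      unfolding AE_all_countable by (intro allI dk)
    with AE_measurable_slice_map[OF S X U \<zeta>] AE_space
    show "AE s in S. distr (slice_space X U s) M (\<lambda>x. \<zeta> (s, x)) = density M (\<lambda>y. \<Sum>i. k i (s, y))"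
    proof eventually_elim
      case (elim s)
      have [measurable]: "(\<lambda>y. k i (s, y)) \<in> borel_measurable M" for i using elim by measurable
      have Us: "slice U s \<in> sets (completion X)" and \<zeta>s: "(\<lambda>x. \<zeta> (s, x)) \<in> slice_space X U s \<rightarrow>\<^sub>M M"
        using elim by auto
      have Vs: "slice (V i) s \<in> sets (completion X)" for i unfolding slV using Us by auto
      have \<zeta>Vs: "(\<lambda>x. \<zeta> (s, x)) \<in> slice_space X (V i) s \<rightarrow>\<^sub>M M" for i
        using \<zeta>s by (rule measurable_restrict_mono) (auto simp: slV)
      show ?case
      proof (rule measure_eqI)
        fix C assume "C \<in> sets (distr (slice_space X U s) M (\<lambda>x. \<zeta> (s, x)))"
        then have C[measurable]: "C \<in> sets M" by simp
        have "emeasure (distr (slice_space X U s) M (\<lambda>x. \<zeta> (s, x))) C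
            = emeasure (completion X) {x \<in> slice U s. \<zeta> (s, x) \<in> C}"
          by (rule emeasure_distr_restrict_space[OF Us \<zeta>s C])
        also have "{x \<in> slice U s. \<zeta> (s, x) \<in> C} = (\<Union>i. {x \<in> slice (V i) s. \<zeta> (s, x) \<in> C})"
          using A(2) sets.sets_into_space[OF Us] unfolding slV by auto
        also have "emeasure (completion X) \<dots> = (\<Sum>i. emeasure (completion X) {x \<in> slice (V i) s. \<zeta> (s, x) \<in> C})"
          using A(4) sets_restrict_space_vimage[OF Vs \<zeta>Vs C]
          by (intro suminf_emeasure[symmetric]) (auto simp: slV disjoint_family_on_def)
        also have "\<dots> = (\<Sum>i. emeasure (density M (\<lambda>y. k i (s, y))) C)"
          using elim emeasure_distr_restrict_space[OF Vs \<zeta>Vs C] by simp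
        also have "\<dots> = (\<Sum>i. \<integral>\<^sup>+y\<in>C. k i (s, y) \<partial>M)"
          by (simp add: emeasure_density)
        also have "\<dots> = (\<integral>\<^sup>+y. (\<Sum>i. k i (s, y) * indicator C y) \<partial>M)"
          by (rule nn_integral_suminf[symmetric]) measurable
        also have "\<dots> = (\<integral>\<^sup>+y\<in>C. (\<Sum>i. k i (s, y)) \<partial>M)"
          by (simp only: ennreal_suminf_multc)
        also have "\<dots> = emeasure (density M (\<lambda>y. \<Sum>i. k i (s, y))) C"
          by (rule emeasure_density[symmetric]) measurable
        finally show "emeasure (distr (slice_space X U s) M (\<lambda>x. \<zeta> (s, x))) C
          = emeasure (density M (\<lambda>y. \<Sum>i. k i (s, y))) C" .
      qed simp
    qed
  qed
qed

text \<open>The condition quantifies over uncountably many balls; engulfing shows that it holds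
  exactly when some enlarged net ball around the point has a finite integral.\<close>

lemma sets_locally_finite:
  assumes k[measurable]: "k \<in> borel_measurable (P \<Otimes>\<^sub>M M)"
  shows "{z \<in> space (P \<Otimes>\<^sub>M M). \<exists>r>0. (\<integral>\<^sup>+x\<in>B (snd z) r. k (fst z, x) \<partial>M) < \<infinity>} \<in> sets (P \<Otimes>\<^sub>M M)"
    (is "?O \<in> _")
proof -
  have "?O = (\<Union>(t, q)\<in>net. {z \<in> space (P \<Otimes>\<^sub>M M). snd z \<in> B t q \<and> (\<integral>\<^sup>+x\<in>B t (c1 * q). k (fst z, x) \<partial>M) < \<infinity>})"
  proof safe
    fix s y r assume sy: "(s, y) \<in> space (P \<Otimes>\<^sub>M M)" and r: "0 < r"
      and fin: "(\<integral>\<^sup>+x\<in>B (snd (s, y)) r. k (fst (s, y), x) \<partial>M) < \<infinity>"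
    have y: "y \<in> space M" using sy by (simp add: space_pair_measure)
    obtain t q where tq: "(t, q) \<in> net" "y \<in> B t q" "B t (c1 * q) \<subseteq> B y r" using ex_net[OF y r] by metis
    have "(\<integral>\<^sup>+x\<in>B t (c1 * q). k (s, x) \<partial>M) \<le> (\<integral>\<^sup>+x\<in>B y r. k (s, x) \<partial>M)"
      using tq(3) by (intro nn_integral_mono mult_left_mono) (auto simp: indicator_def)
    also have "\<dots> < \<infinity>" using fin by simp
    finally show "(s, y) \<in> (\<Union>(t, q)\<in>net. {z \<in> space (P \<Otimes>\<^sub>M M). snd z \<in> B t q \<and> (\<integral>\<^sup>+x\<in>B t (c1 * q). k (fst z, x) \<partial>M) < \<infinity>})"
      using tq sy by (auto intro!: bexI[of _ "(t, q)"])
  next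
    fix s y t q assume sy: "(s, y) \<in> space (P \<Otimes>\<^sub>M M)" and tq: "(t, q) \<in> net" and y: "snd (s, y) \<in> B t q"
      and fin: "(\<integral>\<^sup>+x\<in>B t (c1 * q). k (fst (s, y), x) \<partial>M) < \<infinity>"
    have "B y q \<subseteq> B t (c1 * q)" using y netD[OF tq] by (intro B_engulf) auto
    then have "(\<integral>\<^sup>+x\<in>B y q. k (s, x) \<partial>M) \<le> (\<integral>\<^sup>+x\<in>B t (c1 * q). k (s, x) \<partial>M)"
      by (intro nn_integral_mono mult_left_mono) (auto simp: indicator_def)
    also have "\<dots> < \<infinity>" using fin by simp
    finally show "\<exists>r>0. (\<integral>\<^sup>+x\<in>B (snd (s, y)) r. k (fst (s, y), x) \<partial>M) < \<infinity>"
      using netD(2)[OF tq] by auto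
  qed
  also have "\<dots> \<in> sets (P \<Otimes>\<^sub>M M)"
  proof (intro sets.countable_UN' countable_net, clarify)
    fix t q assume tq: "(t, q) \<in> net"
    have [measurable]: "B t q \<in> sets M" "B t (c1 * q) \<in> sets M" using sets_net net_scale tq by auto
    show "{z \<in> space (P \<Otimes>\<^sub>M M). snd z \<in> B t q \<and> (\<integral>\<^sup>+x\<in>B t (c1 * q). k (fst z, x) \<partial>M) < \<infinity>} \<in> sets (P \<Otimes>\<^sub>M M)"
      by measurable
  qed
  finally show ?thesis .
qed

text \<open>The quotients agree for all positive radii and hence have the same limits. As
  \<open>Lim\<close> depends on nothing else, equality holds even where no limit exists and the
  value is unspecified.\<close>

lemma volume_deriv_inv_eq:
  assumes y: "y \<in> space M" and A: "A \<in> sets (completion N)" and f: "f \<in> restrict_space (completion N) A \<rightarrow>\<^sub>M M"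
    and dens: "distr (restrict_space (completion N) A) M f = density M k" and k: "k \<in> borel_measurable M"
  shows "volume_deriv_inv N A f M d y
    = Lim (at_right 0) (\<lambda>r. (\<integral>\<^sup>+x\<in>B y r. k x \<partial>M) / emeasure M (B y r))"
proof -
  have eq: "emeasure (completion N) {x \<in> A. f x \<in> B y r} = (\<integral>\<^sup>+x\<in>B y r. k x \<partial>M)" if "0 < r" for r
    using emeasure_distr_restrict_space[OF A f qball_sets[OF y that]] qball_sets[OF y that] k
    by (simp add: dens emeasure_density del: emeasure_completion)
  have "(((\<lambda>r. emeasure (completion N) {x \<in> A. f x \<in> B y r} / emeasure M (B y r)) \<longlongrightarrow> l) (at_right 0))
     \<longleftrightarrow> (((\<lambda>r. (\<integral>\<^sup>+x\<in>B y r. k x \<partial>M) / emeasure M (B y r)) \<longlongrightarrow> l) (at_right 0))" for l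
    by (intro filterlim_cong refl) (use eq in \<open>auto simp: eventually_at_right_field intro!: exI[of _ 1] simp del: emeasure_completion\<close>)
  then show ?thesis unfolding volume_deriv_inv_def Topological_Spaces.Lim_def by simp
qed

end

text \<open>Intended for a power of the volume derivative, whose measurability is not yet known when
  this is applied; the measurable set \<open>V\<close> is therefore given separately and the
  integral is bounded below by infinity times its measure.\<close>

lemma Lnorm_finite_imp_null:
  assumes V: "V \<in> sets (completion M)" and top: "AE y in M. y \<in> V \<longrightarrow> f y = top"
    and p: "p = \<infinity> \<or> (\<exists>a>0. p = ennreal a)" and fin: "Lnorm p M f < \<infinity>"
  shows "V \<in> null_sets (completion M)"
proof (cases "p = \<infinity>")
  case True
  then have "AE y in M. f y < top"
    using esssup_AE[of f "completion M"] fin unfolding AE_completion_iff True infinity_ennreal_def Lnorm_top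
    by (elim eventually_mono) (rule le_less_trans)
  with top have "AE y in M. y \<notin> V" by eventually_elim auto
  then show ?thesis using V sets.sets_into_space[OF V] by (simp add: completion.null_sets_iff_AE AE_completion)
next
  case False
  then obtain a where a: "a > 0" "p = ennreal a" using p by auto
  have "top * emeasure (completion M) V = (\<integral>\<^sup>+y\<in>V. top \<partial>completion M)"
    using V by (simp add: nn_integral_cmult_indicator del: emeasure_completion)
  also have "\<dots> \<le> (\<integral>\<^sup>+y. epowr (f y) a \<partial>completion M)"
    using AE_completion[OF top] by (intro nn_integral_mono_AE) (auto elim!: eventually_mono simp: indicator_def)
  also have "\<dots> < top" using fin a by (simp add: Lnorm_ennreal nn_integral_completion)
  finally have "emeasure (completion M) V = 0"
    by (cases "emeasure (completion M) V = 0") (auto simp: ennreal_top_mult simp del: emeasure_completion)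
  then show ?thesis using V by (rule null_setsI)
qed

section \<open>Transport along a map preserving the priority of the variables\<close>

lemma mixed_norm_eq:
  "mixed_norm p b M N U f = Lnorm p M (\<lambda>s. Lnorm b N (\<lambda>x. f (s, x) * indicator U (s, x)))"
  unfolding mixed_norm_def Lnorm_on_def slice_def by (simp add: indicator_def)

locale priority_map =
  SX: pair_sigma_finite S X + T: sigma_finite_measure T + Y: homogeneous Y dY c1 c2
  for S :: "'s measure" and X :: "'x measure" and T :: "'t measure" and Y :: "'y measure"
    and dY :: "'y \<Rightarrow> 'y \<Rightarrow> real" and c1 c2 :: real +
  fixes U :: "('s \<times> 'x) set" and U' :: "('t \<times> 'y) set"
    and \<phi> :: "'s \<times> 'x \<Rightarrow> 't \<times> 'y" and \<psi> :: "'s \<Rightarrow> 't" and \<xi> :: "'s \<Rightarrow> 'x \<Rightarrow> 'y"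
  assumes U: "U \<in> sets (completion (S \<Otimes>\<^sub>M X))" and U': "U' \<in> sets (completion (T \<Otimes>\<^sub>M Y))"
    and \<phi>_into: "\<phi> \<in> U \<rightarrow> U'"
    and \<phi>_meas: "\<phi> \<in> restrict_space (completion (S \<Otimes>\<^sub>M X)) U \<rightarrow>\<^sub>M (T \<Otimes>\<^sub>M Y)"
    and \<psi>_meas: "\<psi> \<in> completion S \<rightarrow>\<^sub>M T"
    and \<psi>_image: "\<And>A. A \<in> sets S \<Longrightarrow> \<psi> ` A \<in> sets (completion T)"
    and \<phi>_eq: "\<And>s x. (s, x) \<in> U \<Longrightarrow> \<phi> (s, x) = (\<psi> s, \<xi> s x)"
    and \<psi>_Ninv: "luzin_Ninv S (space S) \<psi> T"
    and \<xi>_Ninv: "AE s in S. luzin_Ninv X (slice U s) (\<xi> s) Y"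
    and \<psi>_inj: "inj_on \<psi> (space S)"
    and \<psi>_N: "luzin_N S (space S) \<psi> T"
begin

sublocale TY: pair_sigma_finite T Y by standard
sublocale SY: pair_sigma_finite S Y by standard

abbreviation "SXc \<equiv> completion (S \<Otimes>\<^sub>M X)"
abbreviation "TYc \<equiv> completion (T \<Otimes>\<^sub>M Y)"
abbreviation \<iota> :: "'t \<Rightarrow> 's" where "\<iota> \<equiv> inv_into (space S) \<psi>"
abbreviation \<psi>S :: "'t set" where "\<psi>S \<equiv> \<psi> ` space S"

lemma \<iota>: "s \<in> space S \<Longrightarrow> \<iota> (\<psi> s) = s" "t \<in> \<psi>S \<Longrightarrow> \<psi> (\<iota> t) = t" "t \<in> \<psi>S \<Longrightarrow> \<iota> t \<in> space S"
  using \<psi>_inj by (auto simp: inv_into_f_f f_inv_into_f inv_into_into)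

lemma AE_pullback: "(AE t in T. P t) \<Longrightarrow> AE s in S. P (\<psi> s)"
proof -
  assume "AE t in T. P t"
  then obtain N where N: "{t \<in> space T. \<not> P t} \<subseteq> N" "N \<in> null_sets T"
    by (auto elim!: AE_E simp: null_sets_def)
  have "{s \<in> space S. \<psi> s \<in> N} \<in> null_sets (completion S)"
    using \<psi>_Ninv N(2) by (auto simp: luzin_Ninv_def intro: null_sets_completionI)
  then have "AE s in completion S. s \<notin> {s \<in> space S. \<psi> s \<in> N}" by (rule AE_not_in)
  then have "AE s in S. s \<notin> {s \<in> space S. \<psi> s \<in> N}" by (simp add: AE_completion_iff)
  then show ?thesis
    using AE_space
  proof eventually_elim
    case (elim s)
    then have "\<psi> s \<in> space T" using measurable_space[OF \<psi>_meas, of s] by simp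
    then show ?case using elim N by auto
  qed
qed

text \<open>Here the Luzin N property enters: the image of an exceptional set is null.
  \<open>AE_pullback\<close> is the counterpart for the inverse property.\<close>

lemma AE_pushforward: "(AE s in S. P s) \<Longrightarrow> AE t in T. t \<in> \<psi>S \<longrightarrow> P (\<iota> t)"
proof -
  assume "AE s in S. P s"
  then obtain N where N: "{s \<in> space S. \<not> P s} \<subseteq> N" "N \<in> null_sets S"
    by (auto elim!: AE_E simp: null_sets_def)
  have "\<psi> ` N \<in> null_sets (completion T)"
    using \<psi>_N N(2) sets.sets_into_space[of N S] by (auto simp: luzin_N_def intro: null_sets_completionI)
  then have "AE t in completion T. t \<notin> \<psi> ` N" by (rule AE_not_in)
  then have "AE t in T. t \<notin> \<psi> ` N" by (simp add: AE_completion_iff)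
  then show ?thesis
  proof eventually_elim
    case (elim t)
    show ?case
    proof
      assume t: "t \<in> \<psi>S"
      then have "\<iota> t \<notin> N" using elim \<iota>(2)[OF t] by (metis imageI)
      then show "P (\<iota> t)" using N(1) \<iota>(3)[OF t] by auto
    qed
  qed
qed

lemma \<psi>S_sets: "\<psi>S \<in> sets (completion T)"
  by (rule \<psi>_image) simp

text \<open>A null set of the base times the whole fibre is null in the product, so
  \<open>fst\<close> remains measurable for completions. This is needed because
  \<open>\<psi>S\<close> is measurable only for the completion of \<open>T\<close>.\<close>

lemma fst_measurable_completion: "fst \<in> TYc \<rightarrow>\<^sub>M completion T"
proof (rule completion.measurable_completion2)
  show fst: "fst \<in> TYc \<rightarrow>\<^sub>M T" by (intro measurable_completion) simp
  show "null_sets T \<subseteq> null_sets (distr TYc T fst)"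
  proof
    fix N assume N: "N \<in> null_sets T"
    then have "fst -` N \<inter> space (T \<Otimes>\<^sub>M Y) = N \<times> space Y"
      using sets.sets_into_space[of N T] by (auto simp: space_pair_measure)
    moreover have "N \<times> space Y \<in> null_sets (T \<Otimes>\<^sub>M Y)"
      by (rule Y.times_in_null_sets1[OF N sets.top])
    ultimately have "emeasure (distr TYc T fst) N = 0"
      using emeasure_distr[OF fst null_setsD2[OF N]] by (simp add: null_setsD1 null_sets_completionI del: emeasure_completion)
    then show "N \<in> null_sets (distr TYc T fst)" using N by (intro null_setsI) auto
  qed
qed

lemma \<psi>S_times_sets: "\<psi>S \<times> space Y \<in> sets TYc"
proof -
  have "fst -` \<psi>S \<inter> space TYc \<in> sets TYc"
    by (rule measurable_sets[OF fst_measurable_completion \<psi>S_sets])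
  moreover have "fst -` \<psi>S \<inter> space TYc = \<psi>S \<times> space Y"
    using sets.sets_into_space[OF \<psi>S_sets] by (auto simp: space_pair_measure)
  ultimately show ?thesis by simp
qed

text \<open>By injectivity a preimage under \<open>\<iota>\<close> is an image under
  \<open>\<psi>\<close>, and images are measurable by \<open>\<psi>_image\<close>.\<close>

lemma \<iota>_measurable: "\<iota> \<in> restrict_space (completion T) \<psi>S \<rightarrow>\<^sub>M S"
proof (rule measurableI)
  have sp: "space (restrict_space (completion T) \<psi>S) = \<psi>S"
    using sets.sets_into_space[OF \<psi>S_sets] by (auto simp: space_restrict_space)
  show "\<iota> t \<in> space S" if "t \<in> space (restrict_space (completion T) \<psi>S)" for t
    using that \<iota>(3) unfolding sp by blast
  fix A assume A: "A \<in> sets S"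
  have "\<iota> -` A \<inter> \<psi>S = \<psi> ` A"
    using sets.sets_into_space[OF A] \<iota> by (auto simp: image_iff)
  then show "\<iota> -` A \<inter> space (restrict_space (completion T) \<psi>S) \<in> sets (restrict_space (completion T) \<psi>S)"
    unfolding sp using \<psi>_image[OF A] sets.sets_into_space[OF A] \<psi>S_sets by (subst sets_restrict_space_iff) auto
qed

definition transfer :: "'t \<times> 'y \<Rightarrow> 's \<times> 'y" where
  "transfer z = (\<iota> (fst z), snd z)"

lemma transfer_measurable:
  "transfer \<in> restrict_space TYc (\<psi>S \<times> space Y) \<rightarrow>\<^sub>M S \<Otimes>\<^sub>M Y"
proof -
  have [measurable]: "fst \<in> restrict_space TYc (\<psi>S \<times> space Y) \<rightarrow>\<^sub>M restrict_space (completion T) \<psi>S"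
    by (rule measurable_restrict_space3[OF fst_measurable_completion]) auto
  have [measurable]: "snd \<in> restrict_space TYc (\<psi>S \<times> space Y) \<rightarrow>\<^sub>M Y"
    by (intro measurable_restrict_space1 measurable_completion) simp
  note \<iota>_measurable[measurable]
  show ?thesis unfolding transfer_def by measurable
qed

lemma transfer_sets:
  assumes C: "C \<in> sets (S \<Otimes>\<^sub>M Y)"
  shows "{z \<in> \<psi>S \<times> space Y. transfer z \<in> C} \<in> sets TYc"
  by (rule sets_restrict_space_vimage[OF \<psi>S_times_sets transfer_measurable C])

text \<open>Almost all slices of \<open>C\<close> are null, and by the Luzin N property this
  persists over almost every \<open>t\<close> in \<open>\<psi>S\<close>. Measurability of the
  preimage is what allows the return from null slices to a null set of the product.\<close>

lemma transfer_null:
  assumes C: "C \<in> null_sets (S \<Otimes>\<^sub>M Y)"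
  shows "{z \<in> \<psi>S \<times> space Y. transfer z \<in> C} \<in> null_sets TYc"
proof -
  have Cs: "C \<in> sets (S \<Otimes>\<^sub>M Y)" using C by auto
  have "AE s in S. slice C s \<in> null_sets (completion Y)"
    using C SY.null_sets_completion_pair_iff[of C] by (auto intro: null_sets_completionI)
  then have "AE t in T. t \<in> \<psi>S \<longrightarrow> slice C (\<iota> t) \<in> null_sets (completion Y)" by (rule AE_pushforward)
  then have "AE t in T. slice {z \<in> \<psi>S \<times> space Y. transfer z \<in> C} t \<in> null_sets (completion Y)"
  proof eventually_elim
    case (elim t)
    show ?case
    proof (cases "t \<in> \<psi>S")
      case True
      have "slice {z \<in> \<psi>S \<times> space Y. transfer z \<in> C} t \<subseteq> slice C (\<iota> t)"
        by (auto simp: slice_def transfer_def)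
      then show ?thesis using elim True by (blast intro: completion.complete2)
    qed (simp add: slice_def)
  qed
  then show ?thesis using TY.null_sets_completion_pair_iff[OF transfer_sets[OF Cs]] by simp
qed

lemma \<phi>_preimage_null:
  assumes N: "N \<in> null_sets (T \<Otimes>\<^sub>M Y)"
  shows "{z \<in> U. \<phi> z \<in> N} \<in> null_sets SXc"
proof -
  have Ns: "N \<in> sets (T \<Otimes>\<^sub>M Y)" using N by auto
  have pre: "{z \<in> U. \<phi> z \<in> N} \<in> sets SXc"
    by (rule sets_restrict_space_vimage[OF U \<phi>_meas Ns])
  have "AE t in T. slice N t \<in> null_sets (completion Y)"
    using N TY.null_sets_completion_pair_iff[of N] by (auto intro: null_sets_completionI)
  then have "AE s in S. slice N (\<psi> s) \<in> null_sets (completion Y)" by (rule AE_pullback)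
  with \<xi>_Ninv have "AE s in S. slice {z \<in> U. \<phi> z \<in> N} s \<in> null_sets (completion X)"
  proof eventually_elim
    case (elim s)
    have "slice {z \<in> U. \<phi> z \<in> N} s = {x \<in> slice U s. \<xi> s x \<in> slice N (\<psi> s)}"
      using \<phi>_eq by (auto simp: slice_def)
    then show ?case using elim by (simp add: luzin_Ninv_def)
  qed
  then show ?thesis using SX.null_sets_completion_pair_iff[OF pre] by simp
qed

text \<open>Elements of the mixed space are measurable only for the completion, so measurability of
  \<open>\<phi>\<close> into the product is not enough for \<open>f \<circ> \<phi>\<close>. By
  \<open>\<phi>_preimage_null\<close> the null part of a set has a null preimage.\<close>

lemma \<phi>_measurable_completion:
  "\<phi> \<in> restrict_space SXc U \<rightarrow>\<^sub>M restrict_space TYc U'"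
proof (rule measurable_restrict_space2)
  have spU: "space (restrict_space SXc U) = U"
    using sets.sets_into_space[OF U] by (auto simp: space_restrict_space)
  show "\<phi> \<in> space (restrict_space SXc U) \<rightarrow> U'" unfolding spU by (rule \<phi>_into)
  show "\<phi> \<in> restrict_space SXc U \<rightarrow>\<^sub>M TYc"
  proof (rule measurableI)
    show "\<phi> z \<in> space TYc" if "z \<in> space (restrict_space SXc U)" for z
      using measurable_space[OF \<phi>_meas that] by simp
    fix A assume A: "A \<in> sets TYc"
    obtain N where N: "N \<in> null_sets (T \<Otimes>\<^sub>M Y)" "null_part (T \<Otimes>\<^sub>M Y) A \<subseteq> N" using null_part[OF A] by auto
    have 1: "{z \<in> U. \<phi> z \<in> main_part (T \<Otimes>\<^sub>M Y) A} \<in> sets SXc"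
      by (rule sets_restrict_space_vimage[OF U \<phi>_meas main_part_sets[OF A]])
    have 2: "{z \<in> U. \<phi> z \<in> null_part (T \<Otimes>\<^sub>M Y) A} \<in> null_sets SXc"
      using N(2) by (intro completion.complete2[OF _ \<phi>_preimage_null[OF N(1)]]) auto
    have "\<phi> -` A \<inter> U = {z \<in> U. \<phi> z \<in> main_part (T \<Otimes>\<^sub>M Y) A} \<union> {z \<in> U. \<phi> z \<in> null_part (T \<Otimes>\<^sub>M Y) A}"
      using main_part_null_part_Un[OF A] by auto
    then have "\<phi> -` A \<inter> U \<in> sets SXc" using 1 2 by auto
    then show "\<phi> -` A \<inter> space (restrict_space SXc U) \<in> sets (restrict_space SXc U)"
      unfolding spU using U by (subst sets_restrict_space_iff) auto
  qed
qed

lemma absolutely_continuous_\<psi>: "absolutely_continuous T (distr (completion S) T \<psi>)"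
  unfolding absolutely_continuous_def
proof
  fix N assume N: "N \<in> null_sets T"
  then have "{s \<in> space S. \<psi> s \<in> N} \<in> null_sets (completion S)"
    using \<psi>_Ninv by (auto simp: luzin_Ninv_def intro: null_sets_completionI)
  moreover have "\<psi> -` N \<inter> space (completion S) = {s \<in> space S. \<psi> s \<in> N}" by auto
  ultimately show "N \<in> null_sets (distr (completion S) T \<psi>)"
    using N emeasure_distr[OF \<psi>_meas null_setsD2[OF N]] by (intro null_setsI) (simp_all add: null_setsD1 null_setsD2 del: emeasure_completion)
qed

abbreviation RN :: "'t \<Rightarrow> ennreal" where "RN \<equiv> RN_deriv T (distr (completion S) T \<psi>)"

lemma density_RN: "density T RN = distr (completion S) T \<psi>"
  by (rule T.density_RN_deriv[OF absolutely_continuous_\<psi>]) simp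

lemma nn_integral_\<psi>:
  assumes G: "G \<in> borel_measurable (completion T)"
  shows "(\<integral>\<^sup>+s. G (\<psi> s) \<partial>S) = (\<integral>\<^sup>+t. RN t * G t \<partial>T)"
proof -
  obtain G' where G'[measurable]: "G' \<in> borel_measurable T" and GG': "AE t in T. G t = G' t"
    using completion_ex_borel_measurable[OF G] by blast
  have "(\<integral>\<^sup>+s. G (\<psi> s) \<partial>S) = (\<integral>\<^sup>+s. G' (\<psi> s) \<partial>S)"
    using AE_pullback[OF GG'] by (rule nn_integral_cong_AE)
  also have "\<dots> = (\<integral>\<^sup>+s. G' (\<psi> s) \<partial>completion S)" by (simp add: nn_integral_completion)
  also have "\<dots> = (\<integral>\<^sup>+t. G' t \<partial>distr (completion S) T \<psi>)"
    by (subst nn_integral_distr[OF \<psi>_meas]) simp_all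
  also have "\<dots> = (\<integral>\<^sup>+t. G' t \<partial>density T RN)" by (rule arg_cong[OF density_RN[symmetric]])
  also have "\<dots> = (\<integral>\<^sup>+t. RN t * G' t \<partial>T)" by (rule nn_integral_density) measurable
  also have "\<dots> = (\<integral>\<^sup>+t. RN t * G t \<partial>T)"
    using GG' by (intro nn_integral_cong_AE) (auto elim!: eventually_mono)
  finally show ?thesis .
qed

lemma AE_RN_finite: "AE t in T. t \<in> \<psi>S \<longrightarrow> RN t < \<infinity>"
proof -
  obtain A :: "nat \<Rightarrow> _" where A: "range A \<subseteq> sets S" "(\<Union>i. A i) = space S" "\<And>i. emeasure S (A i) \<noteq> \<infinity>"
    using SX.M1.sigma_finite by blast
  have As: "A i \<in> sets S" for i using A by auto
  have "AE t in T. t \<in> \<psi> ` A i \<longrightarrow> RN t < \<infinity>" for i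
  proof -
    have "(\<integral>\<^sup>+t. RN t * indicator (\<psi> ` A i) t \<partial>completion T) = (\<integral>\<^sup>+s. indicator (\<psi> ` A i) (\<psi> s) \<partial>S)"
      using \<psi>_image[OF As] by (subst nn_integral_\<psi>) (auto simp: nn_integral_completion)
    also have "\<dots> = (\<integral>\<^sup>+s. indicator (A i) s \<partial>S)"
      using \<psi>_inj sets.sets_into_space[OF As[of i]]
      by (intro nn_integral_cong) (auto simp: indicator_def inj_on_def image_iff subset_iff)
    also have "\<dots> \<noteq> \<infinity>" using A(3)[of i] As by simp
    finally have "AE t in completion T. RN t * indicator (\<psi> ` A i) t \<noteq> \<infinity>"
    proof (rule nn_integral_PInf_AE[rotated])
      have [measurable]: "RN \<in> borel_measurable (completion T)" by (rule measurable_completion) simp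
      have [measurable]: "\<psi> ` A i \<in> sets (completion T)" by (rule \<psi>_image[OF As])
      show "(\<lambda>t. RN t * indicator (\<psi> ` A i) t) \<in> borel_measurable (completion T)" by measurable
    qed
    then show ?thesis
      unfolding AE_completion_iff by eventually_elim (auto simp: less_top)
  qed
  then have "AE t in T. \<forall>i. t \<in> \<psi> ` A i \<longrightarrow> RN t < \<infinity>" unfolding AE_all_countable by blast
  then show ?thesis
    by eventually_elim (use A(2) in blast)
qed

end

section \<open>Volume derivatives of the fibre maps\<close>

context priority_map
begin

lemma ex_fibre_density:
  obtains k where "k \<in> borel_measurable (S \<Otimes>\<^sub>M Y)"
    "AE s in S. slice U s \<in> sets (completion X) \<and> \<xi> s \<in> slice_space X U s \<rightarrow>\<^sub>M Y \<and>
      distr (slice_space X U s) Y (\<xi> s) = density Y (\<lambda>y. k (s, y))"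
proof -
  \<comment> \<open>Only \<open>\<phi>\<close> is assumed jointly measurable on \<open>U\<close>;
    its second component agrees with \<open>\<xi>\<close> on every slice of
    \<open>U\<close>.\<close>
  define \<zeta> where "\<zeta> = (\<lambda>z. snd (\<phi> z))"
  have \<zeta>: "\<zeta> \<in> restrict_space SXc U \<rightarrow>\<^sub>M Y"
    unfolding \<zeta>_def by (rule measurable_compose[OF \<phi>_meas measurable_snd])
  have \<zeta>\<xi>: "\<zeta> (s, x) = \<xi> s x" if "x \<in> slice U s" for s x
    using \<phi>_eq that by (simp add: \<zeta>_def slice_def)
  have null: "AE s in S. \<forall>Z\<in>null_sets Y. {x \<in> slice U s. \<zeta> (s, x) \<in> Z} \<in> null_sets (completion X)"
    using \<xi>_Ninv
  proof eventually_elim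
    case (elim s)
    have "{x \<in> slice U s. \<zeta> (s, x) \<in> Z} = {x \<in> slice U s. \<xi> s x \<in> Z}" for Z using \<zeta>\<xi> by auto
    then show ?case using elim by (auto simp: luzin_Ninv_def intro: null_sets_completionI)
  qed
  obtain k where k: "k \<in> borel_measurable (S \<Otimes>\<^sub>M Y)"
    and dk: "AE s in S. distr (slice_space X U s) Y (\<lambda>x. \<zeta> (s, x)) = density Y (\<lambda>y. k (s, y))"
    using Y.ex_kernel_density[OF SX.M1.sigma_finite_measure_axioms SX.M2.sigma_finite_measure_axioms U \<zeta> null] by blast
  show ?thesis
  proof (rule that[OF k])
    show "AE s in S. slice U s \<in> sets (completion X) \<and> \<xi> s \<in> slice_space X U s \<rightarrow>\<^sub>M Y \<and>
      distr (slice_space X U s) Y (\<xi> s) = density Y (\<lambda>y. k (s, y))"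
      using Y.AE_measurable_slice_map[OF SX.M1.sigma_finite_measure_axioms SX.M2.sigma_finite_measure_axioms U \<zeta>] dk
    proof eventually_elim
      case (elim s)
      have sp: "space (slice_space X U s) = slice U s"
        using elim sets.sets_into_space[of "slice U s" "completion X"] by (auto simp: space_restrict_space)
      have "(\<lambda>x. \<zeta> (s, x)) \<in> slice_space X U s \<rightarrow>\<^sub>M Y \<longleftrightarrow> \<xi> s \<in> slice_space X U s \<rightarrow>\<^sub>M Y"
        by (rule measurable_cong) (simp add: sp \<zeta>\<xi>)
      moreover have "distr (slice_space X U s) Y (\<lambda>x. \<zeta> (s, x)) = distr (slice_space X U s) Y (\<xi> s)"
        by (rule distr_cong) (simp_all add: sp \<zeta>\<xi>)
      ultimately show ?case using elim by auto
    qed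
  qed
qed

definition fibre_density :: "'s \<times> 'y \<Rightarrow> ennreal" where
  "fibre_density = (SOME k. k \<in> borel_measurable (S \<Otimes>\<^sub>M Y) \<and>
    (AE s in S. slice U s \<in> sets (completion X) \<and> \<xi> s \<in> slice_space X U s \<rightarrow>\<^sub>M Y \<and>
      distr (slice_space X U s) Y (\<xi> s) = density Y (\<lambda>y. k (s, y))))"

definition good :: "'s \<Rightarrow> bool" where
  "good s \<longleftrightarrow> slice U s \<in> sets (completion X) \<and> \<xi> s \<in> slice_space X U s \<rightarrow>\<^sub>M Y \<and>
      distr (slice_space X U s) Y (\<xi> s) = density Y (\<lambda>y. fibre_density (s, y))"

lemma fibre_density_measurable[measurable]: "fibre_density \<in> borel_measurable (S \<Otimes>\<^sub>M Y)"
  and AE_good: "AE s in S. good s"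
proof -
  have "\<exists>k. k \<in> borel_measurable (S \<Otimes>\<^sub>M Y) \<and>
    (AE s in S. slice U s \<in> sets (completion X) \<and> \<xi> s \<in> slice_space X U s \<rightarrow>\<^sub>M Y \<and>
      distr (slice_space X U s) Y (\<xi> s) = density Y (\<lambda>y. k (s, y)))"
    by (rule ex_fibre_density) blast
  from someI_ex[OF this] show "fibre_density \<in> borel_measurable (S \<Otimes>\<^sub>M Y)" "AE s in S. good s"
    unfolding good_def fibre_density_def[symmetric] by blast+
qed

abbreviation J\<xi> :: "'s \<Rightarrow> 'y \<Rightarrow> ennreal" where
  "J\<xi> s \<equiv> volume_deriv_inv X (slice U s) (\<xi> s) Y dY"

text \<open>Off the open set where the fibre measure is locally finite, the volume derivative is infinite.\<close>

lemma J\<xi>_dichotomy: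
  obtains Z G where "Z \<in> null_sets (S \<Otimes>\<^sub>M Y)" "G \<in> sets (S \<Otimes>\<^sub>M Y)"
    "\<And>s y. s \<in> space S \<Longrightarrow> y \<in> space Y \<Longrightarrow> good s \<Longrightarrow> (s, y) \<notin> Z \<Longrightarrow>
      J\<xi> s y = (if (s, y) \<in> G then fibre_density (s, y) else top)"
proof -
  define L where "L s y r = (\<integral>\<^sup>+x. fibre_density (s, x) * indicator (Y.B y r) x \<partial>Y)" for s y r
  obtain Z where Z: "Z \<in> null_sets (S \<Otimes>\<^sub>M Y)"
    "\<And>s y r. s \<in> space S \<Longrightarrow> y \<in> space Y \<Longrightarrow> (s, y) \<notin> Z \<Longrightarrow> 0 < r \<Longrightarrow> L s y r < \<infinity> \<Longrightarrow>
      ((\<lambda>r. L s y r / emeasure Y (Y.B y r)) \<longlongrightarrow> fibre_density (s, y)) (at_right 0)"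
    unfolding L_def using Y.fibrewise_differentiation[OF fibre_density_measurable] by blast
  define G where "G = {z \<in> space (S \<Otimes>\<^sub>M Y). \<exists>r>0. L (fst z) (snd z) r < \<infinity>}"
  have G: "G \<in> sets (S \<Otimes>\<^sub>M Y)"
    unfolding G_def L_def by (rule Y.sets_locally_finite) measurable
  show ?thesis
  proof (rule that[OF Z(1) G])
    fix s y assume s: "s \<in> space S" and y: "y \<in> space Y" and g: "good s" and nZ: "(s, y) \<notin> Z"
    have "(\<lambda>y. fibre_density (s, y)) \<in> borel_measurable Y" using s by measurable
    then have J: "J\<xi> s y = Lim (at_right 0) (\<lambda>r. L s y r / emeasure Y (Y.B y r))"
      unfolding L_def using g y by (intro Y.volume_deriv_inv_eq) (auto simp: good_def)
    have nb: "\<not> trivial_limit (at_right (0::real))" by simp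
    show "J\<xi> s y = (if (s, y) \<in> G then fibre_density (s, y) else top)"
    proof (cases "(s, y) \<in> G")
      case True
      then obtain r where "0 < r" "L s y r < \<infinity>" by (auto simp: G_def)
      from tendsto_Lim[OF nb Z(2)[OF s y nZ this]] show ?thesis using J True by simp
    next
      case False
      have inf: "L s y r = top" if "0 < r" for r
      proof -
        have "\<not> L s y r < top" using False that s y by (auto simp: G_def space_pair_measure)
        then show ?thesis by (simp add: less_top[symmetric])
      qed
      have "\<forall>\<^sub>F r in at_right 0. L s y r / emeasure Y (Y.B y r) = top"
        unfolding eventually_at_right_field
      proof (intro exI[of _ 1] conjI allI impI)
        fix r :: real assume r: "0 < r"
        show "L s y r / emeasure Y (Y.B y r) = top"
          using inf[OF r] Y.qball_finite[OF y r] by (simp add: ennreal_top_divide)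
      qed simp
      then have "((\<lambda>r. L s y r / emeasure Y (Y.B y r)) \<longlongrightarrow> top) (at_right 0)"
        by (rule tendsto_eventually)
      from tendsto_Lim[OF nb this] show ?thesis using J False by simp
    qed
  qed
qed

text \<open>Where the fibre measure is not locally finite the volume derivative is infinite, and a
  finite norm in (A2) makes this part of almost every slice of \<open>U'\<close> null. All
  exceptional sets are measurable in the product, so null slices give a null set of the
  product.\<close>

lemma AE_J\<xi>_eq:
  assumes \<gamma>: "\<gamma> = \<infinity> \<or> (\<exists>a>0. \<gamma> = ennreal a)"
    and A2: "\<forall>t\<in>\<psi>S. Lnorm_on \<gamma> Y (slice U' t) (\<lambda>y. epowr (J\<xi> (\<iota> t) y) e) < \<infinity>"
  shows "AE z in T \<Otimes>\<^sub>M Y. z \<in> U' \<and> fst z \<in> \<psi>S \<longrightarrow> J\<xi> (\<iota> (fst z)) (snd z) = fibre_density (\<iota> (fst z), snd z)"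
proof -
  obtain Z G where Z: "Z \<in> null_sets (S \<Otimes>\<^sub>M Y)" and G: "G \<in> sets (S \<Otimes>\<^sub>M Y)"
    and J: "\<And>s y. s \<in> space S \<Longrightarrow> y \<in> space Y \<Longrightarrow> good s \<Longrightarrow> (s, y) \<notin> Z \<Longrightarrow>
      J\<xi> s y = (if (s, y) \<in> G then fibre_density (s, y) else top)"
    by (rule J\<xi>_dichotomy) (rule that)
  have spY: "slice U' t \<subseteq> space Y" for t
    using sets.sets_into_space[OF U'] by (auto simp: slice_def space_pair_measure)
  define V where "V = U' \<inter> {z \<in> \<psi>S \<times> space Y. transfer z \<in> space (S \<Otimes>\<^sub>M Y) - G}"
  have V: "V \<in> sets TYc"
    unfolding V_def by (intro sets.Int U' transfer_sets) (use G in auto)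
  have AZ: "AE t in T. t \<in> \<psi>S \<longrightarrow> (AE y in Y. (\<iota> t, y) \<notin> Z)"
    by (rule AE_pushforward[OF SY.AE_pair[OF AE_not_in[OF Z]]])
  have Ag: "AE t in T. t \<in> \<psi>S \<longrightarrow> good (\<iota> t)" by (rule AE_pushforward[OF AE_good])
  have "AE t in T. slice V t \<in> null_sets (completion Y)"
    using TY.AE_slice_sets[OF V] AZ Ag
  proof eventually_elim
    case (elim t)
    show ?case
    proof (cases "t \<in> \<psi>S")
      case True
      show ?thesis
      proof (rule Lnorm_finite_imp_null[OF elim(1) _ \<gamma>])
        show "Lnorm \<gamma> Y (\<lambda>y. epowr (J\<xi> (\<iota> t) y) e * indicator (slice U' t) y) < \<infinity>"
          using A2[rule_format, OF True] unfolding Lnorm_on_def .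
        have "AE y in Y. (\<iota> t, y) \<notin> Z" using elim True by blast
        then show "AE y in Y. y \<in> slice V t \<longrightarrow> epowr (J\<xi> (\<iota> t) y) e * indicator (slice U' t) y = top"
          using AE_space
        proof eventually_elim
          case (elim y)
          show ?case
          proof
            assume y: "y \<in> slice V t"
            then have "(\<iota> t, y) \<notin> G" "y \<in> slice U' t" by (auto simp: V_def slice_def transfer_def)
            moreover have "good (\<iota> t)" using \<open>t \<in> \<psi>S \<longrightarrow> good (\<iota> t)\<close> True by blast
            ultimately show "epowr (J\<xi> (\<iota> t) y) e * indicator (slice U' t) y = top"
              using J[OF \<iota>(3)[OF True] elim(2) _ elim(1)] by simp
          qed
        qed
      qed
    qed (simp add: V_def slice_def)
  qed
  then have "V \<in> null_sets TYc" using TY.null_sets_completion_pair_iff[OF V] by simp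
  then have "AE z in TYc. z \<notin> V" by (rule AE_not_in)
  moreover have "AE z in TYc. z \<notin> {z \<in> \<psi>S \<times> space Y. transfer z \<in> Z}"
    by (rule AE_not_in[OF transfer_null[OF Z]])
  moreover have "AE z in TYc. fst z \<in> \<psi>S \<longrightarrow> good (\<iota> (fst z))"
    by (rule AE_completion[OF TY.AE_fst[OF Ag]])
  ultimately have "AE z in TYc. z \<in> U' \<and> fst z \<in> \<psi>S \<longrightarrow> J\<xi> (\<iota> (fst z)) (snd z) = fibre_density (\<iota> (fst z), snd z)"
    using AE_space
  proof eventually_elim
    case (elim z)
    show ?case
    proof
      assume z: "z \<in> U' \<and> fst z \<in> \<psi>S"
      have y: "snd z \<in> space Y" and s: "\<iota> (fst z) \<in> space S"
        using elim(4) \<iota>(3)[of "fst z"] z by (auto simp: space_pair_measure)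
      have zin: "z \<in> \<psi>S \<times> space Y" using z y by (simp add: mem_Times_iff)
      have "(\<iota> (fst z), snd z) \<in> G"
        using elim(1) z zin y s by (auto simp: V_def transfer_def space_pair_measure)
      moreover have "(\<iota> (fst z), snd z) \<notin> Z" using elim(2) zin by (auto simp: transfer_def)
      ultimately show "J\<xi> (\<iota> (fst z)) (snd z) = fibre_density (\<iota> (fst z), snd z)"
        using J[OF s y] elim(3) z by simp
    qed
  qed
  then show ?thesis by (simp add: AE_completion_iff)
qed

end

section \<open>Change of variables and the criterion\<close>

context priority_map
begin

text \<open>A measurable stand-in for the power of the volume derivative of the fibre map, extended
  by 0 off \<open>\<psi>S\<close> in agreement with the convention for the product in the
  theorem.\<close>

definition weight :: "real \<Rightarrow> 't \<times> 'y \<Rightarrow> ennreal" where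
  "weight \<alpha> z = (if z \<in> \<psi>S \<times> space Y then epowr (fibre_density (transfer z)) (1 / \<alpha>) else 0)"

lemma weight_measurable: "weight \<alpha> \<in> borel_measurable TYc"
proof -
  have sub: "(\<psi>S \<times> space Y) \<inter> space TYc \<in> sets TYc"
    by (rule sets.Int[OF \<psi>S_times_sets sets.top])
  have "(\<lambda>z. epowr (fibre_density (transfer z)) (1 / \<alpha>)) \<in> borel_measurable (restrict_space TYc (\<psi>S \<times> space Y))"
    by (intro borel_measurable_epowr' measurable_compose[OF transfer_measurable fibre_density_measurable])
  then have "(\<lambda>z. epowr (fibre_density (transfer z)) (1 / \<alpha>) * indicator (\<psi>S \<times> space Y) z) \<in> borel_measurable TYc"
    by (rule iffD1[OF borel_measurable_restrict_space_iff_ennreal[OF sub]])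
  also have "(\<lambda>z. epowr (fibre_density (transfer z)) (1 / \<alpha>) * indicator (\<psi>S \<times> space Y) z) = weight \<alpha>"
    by (auto simp: weight_def indicator_def fun_eq_iff)
  finally show ?thesis .
qed

lemma mixed_norm_comp:
  fixes f :: "'t \<times> 'y \<Rightarrow> real"
  assumes f: "f \<in> borel_measurable (restrict_space TYc U')" and \<alpha>: "0 < \<alpha>" and q: "0 < q"
  shows "mixed_norm (ennreal q) (ennreal \<alpha>) S X U (\<lambda>z. ennreal \<bar>(f \<circ> \<phi>) z\<bar>) =
    Lnorm (ennreal q) T (\<lambda>t. Lnorm (ennreal \<alpha>) Y
      (\<lambda>y. (ennreal \<bar>f (t, y)\<bar> * indicator U' (t, y)) * (epowr (RN t) (1 / q) * weight \<alpha> (t, y))))"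
proof -
  define F where "F z = ennreal \<bar>f z\<bar> * indicator U' z" for z
  have U'': "U' \<inter> space TYc \<in> sets TYc" using U' by (rule sets.Int) (rule sets.top)
  have F: "F \<in> borel_measurable TYc"
  proof -
    have "(\<lambda>z. ennreal \<bar>f z\<bar>) \<in> borel_measurable (restrict_space TYc U')" using f by measurable
    then show ?thesis unfolding F_def by (rule iffD1[OF borel_measurable_restrict_space_iff_ennreal[OF U'']])
  qed
  have FW: "(\<lambda>z. F z * weight \<alpha> z) \<in> borel_measurable TYc"
    using F weight_measurable by (rule borel_measurable_times_ennreal)
  have a': "ennreal \<alpha> = \<infinity> \<or> (\<exists>a>0. ennreal \<alpha> = ennreal a)" using \<alpha> by (auto intro: exI[of _ \<alpha>])
  define G where "G t = Lnorm (ennreal \<alpha>) Y (\<lambda>y. F (t, y) * weight \<alpha> (t, y))" for t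
  have G: "G \<in> borel_measurable (completion T)"
    unfolding G_def by (rule TY.completion_measurable_Lnorm_slice[OF FW a'])
  obtain F' where F'[measurable]: "F' \<in> borel_measurable (T \<Otimes>\<^sub>M Y)" and FF': "AE t in T. AE y in Y. F (t, y) = F' (t, y)"
    using TY.completion_pair_AE_version[OF F] by blast
  have inner: "AE s in S. Lnorm (ennreal \<alpha>) X (\<lambda>x. ennreal \<bar>(f \<circ> \<phi>) (s, x)\<bar> * indicator U (s, x)) = G (\<psi> s)"
    using AE_good AE_pullback[OF FF'] \<xi>_Ninv AE_space
  proof eventually_elim
    case (elim s)
    have Us: "slice U s \<in> sets (completion X)" and \<xi>s: "\<xi> s \<in> slice_space X U s \<rightarrow>\<^sub>M Y"
      and ds: "distr (slice_space X U s) Y (\<xi> s) = density Y (\<lambda>y. fibre_density (s, y))"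
      using elim(1) by (auto simp: good_def)
    have \<psi>s: "\<psi> s \<in> space T" using measurable_space[OF \<psi>_meas, of s] elim(4) by simp
    have [measurable]: "(\<lambda>y. fibre_density (s, y)) \<in> borel_measurable Y" "(\<lambda>y. F' (\<psi> s, y)) \<in> borel_measurable Y"
      using elim(4) \<psi>s by measurable
    \<comment> \<open>The image-measure formula needs the version \<open>F'\<close>, measurable for
      the product itself; the fibre map takes values in the exceptional set \<open>N\<close> only on
      a null set, by its Luzin property.\<close>
    obtain N where N: "{y \<in> space Y. F (\<psi> s, y) \<noteq> F' (\<psi> s, y)} \<subseteq> N" "N \<in> null_sets Y"
      using elim(2) by (auto elim!: AE_E simp: null_sets_def)
    have "{x \<in> slice U s. \<xi> s x \<in> N} \<in> null_sets (completion X)"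
      using elim(3) N(2) by (auto simp: luzin_Ninv_def intro: null_sets_completionI)
    then have AEN: "AE x in completion X. x \<notin> {x \<in> slice U s. \<xi> s x \<in> N}" by (rule AE_not_in)
    have \<xi>Y: "\<xi> s x \<in> space Y" if "x \<in> slice U s" for x
      using measurable_space[OF \<xi>s, of x] that sets.sets_into_space[OF Us] by (auto simp: space_restrict_space)
    have "(\<integral>\<^sup>+x. epowr (ennreal \<bar>(f \<circ> \<phi>) (s, x)\<bar> * indicator U (s, x)) \<alpha> \<partial>completion X)
      = (\<integral>\<^sup>+x. epowr (F' (\<psi> s, \<xi> s x)) \<alpha> * indicator (slice U s) x \<partial>completion X)"
      using AEN
    proof (intro nn_integral_cong_AE, eventually_elim)
      case (elim x)
      show ?case
      proof (cases "x \<in> slice U s")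
        case True
        then have x: "(s, x) \<in> U" by (simp add: slice_def)
        have "\<phi> (s, x) \<in> U'" using \<phi>_into x by auto
        then have "ennreal \<bar>(f \<circ> \<phi>) (s, x)\<bar> = F (\<psi> s, \<xi> s x)" using \<phi>_eq[OF x] by (simp add: F_def)
        also have "\<dots> = F' (\<psi> s, \<xi> s x)" using elim True \<xi>Y[OF True] N(1) by auto
        finally show ?thesis using True x by simp
      qed (simp add: slice_def)
    qed
    also have "\<dots> = (\<integral>\<^sup>+y. epowr (F' (\<psi> s, y)) \<alpha> \<partial>distr (slice_space X U s) Y (\<xi> s))"
      by (rule nn_integral_distr_restrict_space[symmetric, OF Us \<xi>s]) measurable
    also have "\<dots> = (\<integral>\<^sup>+y. fibre_density (s, y) * epowr (F' (\<psi> s, y)) \<alpha> \<partial>Y)"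
      unfolding ds by (rule nn_integral_density) measurable
    also have "\<dots> = (\<integral>\<^sup>+y. epowr (F (\<psi> s, y) * weight \<alpha> (\<psi> s, y)) \<alpha> \<partial>Y)"
    proof (rule nn_integral_cong_AE)
      show "AE y in Y. fibre_density (s, y) * epowr (F' (\<psi> s, y)) \<alpha> = epowr (F (\<psi> s, y) * weight \<alpha> (\<psi> s, y)) \<alpha>"
        using elim(2) AE_space
      proof eventually_elim
        case (elim y)
        have "weight \<alpha> (\<psi> s, y) = epowr (fibre_density (s, y)) (1 / \<alpha>)"
          using \<open>s \<in> space S\<close> elim by (simp add: weight_def transfer_def \<iota>(1))
        then show ?case using elim \<alpha> by (simp add: epowr_mult epowr_inverse_cancel mult.commute)
      qed
    qed
    finally show ?case using \<alpha> by (simp add: Lnorm_ennreal G_def nn_integral_completion)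
  qed
  have "mixed_norm (ennreal q) (ennreal \<alpha>) S X U (\<lambda>z. ennreal \<bar>(f \<circ> \<phi>) z\<bar>) = Lnorm (ennreal q) S (\<lambda>s. G (\<psi> s))"
    unfolding mixed_norm_eq using inner by (rule Lnorm_cong_AE)
  also have "\<dots> = epowr (\<integral>\<^sup>+s. epowr (G (\<psi> s)) q \<partial>S) (1 / q)" using q by (simp add: Lnorm_ennreal)
  also have "(\<integral>\<^sup>+s. epowr (G (\<psi> s)) q \<partial>S) = (\<integral>\<^sup>+t. RN t * epowr (G t) q \<partial>T)"
    using G by (intro nn_integral_\<psi>) measurable
  also have "\<dots> = (\<integral>\<^sup>+t. epowr (epowr (RN t) (1 / q) * G t) q \<partial>T)"
    using q by (simp add: epowr_mult epowr_inverse_cancel)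
  also have "epowr \<dots> (1 / q) = Lnorm (ennreal q) T (\<lambda>t. epowr (RN t) (1 / q) * G t)"
    using q by (simp add: Lnorm_ennreal)
  also have "\<dots> = Lnorm (ennreal q) T (\<lambda>t. Lnorm (ennreal \<alpha>) Y (\<lambda>y. F (t, y) * (epowr (RN t) (1 / q) * weight \<alpha> (t, y))))"
  proof (rule Lnorm_cong_AE)
    show "AE t in T. epowr (RN t) (1 / q) * G t = Lnorm (ennreal \<alpha>) Y (\<lambda>y. F (t, y) * (epowr (RN t) (1 / q) * weight \<alpha> (t, y)))"
      using TY.AE_measurable_slice[OF FW]
    proof eventually_elim
      case (elim t)
      have "Lnorm (ennreal \<alpha>) Y (\<lambda>y. F (t, y) * (epowr (RN t) (1 / q) * weight \<alpha> (t, y)))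
          = Lnorm (ennreal \<alpha>) Y (\<lambda>y. epowr (RN t) (1 / q) * (F (t, y) * weight \<alpha> (t, y)))"
        by (simp only: mult.left_commute)
      also have "\<dots> = epowr (RN t) (1 / q) * G t"
        unfolding G_def by (rule Lnorm_cmult_finite[OF elim \<alpha>])
      finally show ?case by simp
    qed
  qed
  finally show ?thesis unfolding F_def .
qed

theorem composition_operator_iff:
  fixes p q \<alpha> \<beta> :: real and \<kappa> \<gamma> :: ennreal and J\<psi> :: "'t \<Rightarrow> ennreal"
  assumes q: "1 \<le> q" "q \<le> p" and \<alpha>: "1 \<le> \<alpha>" "\<alpha> \<le> \<beta>"
    and \<gamma>: "\<gamma> = (if \<alpha> < \<beta> then ennreal (\<beta> * \<alpha> / (\<beta> - \<alpha>)) else \<infinity>)"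
    and \<kappa>: "\<kappa> = (if q < p then ennreal (p * q / (p - q)) else \<infinity>)"
    and J\<psi>: "AE t in T. J\<psi> t = RN t"
    and A2: "\<forall>t\<in>\<psi>S. Lnorm_on \<gamma> Y (slice U' t) (\<lambda>y. epowr (J\<xi> (\<iota> t) y) (1 / \<alpha>)) < \<infinity>"
  shows "induces_bounded_composition_operator \<phi> (ennreal p) (ennreal \<beta>) T Y U' (ennreal q) (ennreal \<alpha>) S X U \<longleftrightarrow>
    in_mixed_space \<kappa> \<gamma> T Y U'
      (\<lambda>(t, y). if t \<in> \<psi>S then epowr (J\<psi> t) (1 / q) * epowr (J\<xi> (\<iota> t) y) (1 / \<alpha>) else 0)"
    (is "?L \<longleftrightarrow> in_mixed_space _ _ _ _ _ ?W0")
proof -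
  have q0: "0 < q" and \<alpha>0: "0 < \<alpha>" and p0: "0 < p" and \<beta>0: "0 < \<beta>" using q \<alpha> by auto
  have \<gamma>': "\<gamma> = \<infinity> \<or> (\<exists>a>0. \<gamma> = ennreal a)" using \<gamma> \<alpha> by (auto intro!: exI[of _ "\<beta> * \<alpha> / (\<beta> - \<alpha>)"])
  have \<beta>': "ennreal \<beta> = \<infinity> \<or> (\<exists>a>0. ennreal \<beta> = ennreal a)" using \<beta>0 by (auto intro: exI[of _ \<beta>])
  have U'': "U' \<inter> space TYc \<in> sets TYc" using U' by (rule sets.Int) (rule sets.top)
  have indU'[measurable]: "indicator U' \<in> borel_measurable TYc" using U' by measurable
  define W where "W z = epowr (RN (fst z)) (1 / q) * weight \<alpha> z" for z
  \<comment> \<open>With the restriction to \<open>U'\<close> built into the weight, both Hoelder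
    arguments can work on all of \<open>T \<times> Y\<close>.\<close>
  define W1 where "W1 z = W z * indicator U' z" for z
  have W1: "W1 \<in> borel_measurable TYc"
  proof -
    have [measurable]: "(\<lambda>z. epowr (RN (fst z)) (1 / q)) \<in> borel_measurable TYc"
      by (intro measurable_completion) measurable
    note weight_measurable[measurable]
    show ?thesis unfolding W1_def W_def by measurable
  qed
  have J\<psi>': "AE z in T \<Otimes>\<^sub>M Y. J\<psi> (fst z) = RN (fst z)"
    by (rule TY.AE_fst[OF J\<psi>])
  have W0W1: "AE z in T \<Otimes>\<^sub>M Y. W1 z = ?W0 z * indicator U' z"
    using J\<psi>' AE_J\<xi>_eq[OF \<gamma>' A2] AE_space
  proof eventually_elim
    case (elim z)
    then show ?case
      by (cases "z \<in> U'") (auto simp: W1_def W_def weight_def transfer_def space_pair_measure split_beta)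
  qed
  have norm_W: "mixed_norm \<kappa> \<gamma> T Y U' ?W0 = Lnorm \<kappa> T (\<lambda>t. Lnorm \<gamma> Y (\<lambda>y. W1 (t, y)))"
    unfolding mixed_norm_eq
    by (rule TY.Lnorm_Lnorm_cong_AE[OF TY.AE_pair, symmetric]) (rule W0W1)
  have meas_W: "?W0 \<in> borel_measurable (restrict_space TYc U')"
    unfolding borel_measurable_restrict_space_iff_ennreal[OF U'']
    by (rule measurable_completion_cong_AE[OF W0W1 W1])
  have comp: "mixed_norm (ennreal q) (ennreal \<alpha>) S X U (\<lambda>z. ennreal \<bar>(f \<circ> \<phi>) z\<bar>) =
      Lnorm (ennreal q) T (\<lambda>t. Lnorm (ennreal \<alpha>) Y (\<lambda>y. (ennreal \<bar>f (t, y)\<bar> * indicator U' (t, y)) * W1 (t, y)))"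
    if "f \<in> borel_measurable (restrict_space TYc U')" for f :: "'t \<times> 'y \<Rightarrow> real"
  proof -
    have "(ennreal \<bar>f z\<bar> * indicator U' z) * W1 z = (ennreal \<bar>f z\<bar> * indicator U' z) * W z" for z
      by (simp add: W1_def indicator_def)
    then show ?thesis unfolding mixed_norm_comp[OF that \<alpha>0 q0] by (simp add: W_def)
  qed
  \<comment> \<open>The finiteness that the converse of Hoelder's inequality requires: (A2) bounds
    the fibre norm over \<open>\<psi>S\<close>, \<open>AE_RN_finite\<close> the base factor, and
    elsewhere the weight is 0.\<close>
  have W1_fin: "AE t in T. Lnorm \<gamma> Y (\<lambda>y. W1 (t, y)) < \<infinity>"
  proof -
    have HW: "(\<lambda>z. weight \<alpha> z * indicator U' z) \<in> borel_measurable TYc"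
      using weight_measurable indU' by (rule borel_measurable_times_ennreal)
    have "AE t in T. AE y in Y. (t, y) \<in> U' \<and> t \<in> \<psi>S \<longrightarrow> J\<xi> (\<iota> t) y = fibre_density (\<iota> t, y)"
      using TY.AE_pair[OF AE_J\<xi>_eq[OF \<gamma>' A2]] by simp
    with TY.AE_measurable_slice[OF HW] AE_RN_finite show ?thesis
    proof eventually_elim
      case (elim t)
      have W1t: "W1 (t, y) = epowr (RN t) (1 / q) * (weight \<alpha> (t, y) * indicator U' (t, y))" for y
        by (simp add: W1_def W_def mult.assoc)
      have le: "Lnorm \<gamma> Y (\<lambda>y. W1 (t, y)) \<le> epowr (RN t) (1 / q) * Lnorm \<gamma> Y (\<lambda>y. weight \<alpha> (t, y) * indicator U' (t, y))"
        unfolding W1t by (rule Lnorm_cmult_le[OF elim(1) \<gamma>'])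
      show ?case
      proof (cases "t \<in> \<psi>S")
        case True
        have "Lnorm \<gamma> Y (\<lambda>y. weight \<alpha> (t, y) * indicator U' (t, y)) = Lnorm_on \<gamma> Y (slice U' t) (\<lambda>y. epowr (J\<xi> (\<iota> t) y) (1 / \<alpha>))"
          unfolding Lnorm_on_def
        proof (rule Lnorm_cong_AE)
          show "AE y in Y. weight \<alpha> (t, y) * indicator U' (t, y) = epowr (J\<xi> (\<iota> t) y) (1 / \<alpha>) * indicator (slice U' t) y"
            using elim(3) AE_space
            by eventually_elim (use True in \<open>auto simp: weight_def transfer_def slice_def indicator_def\<close>)
        qed
        also have "\<dots> < \<infinity>" using A2 True by blast
        finally show ?thesis
          using le elim(2) True by (intro le_less_trans[OF le]) (auto simp: ennreal_mult_less_top)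
      next
        case False
        then have "Lnorm \<gamma> Y (\<lambda>y. weight \<alpha> (t, y) * indicator U' (t, y)) = 0"
          unfolding Lnorm_eq_0_iff[OF elim(1) \<gamma>'] by (simp add: weight_def)
        then show ?thesis using le by simp
      qed
    qed
  qed
  show ?thesis
  proof
    assume ?L
    then obtain C :: real where C: "\<And>f. f \<in> mixed_space (ennreal p) (ennreal \<beta>) T Y U' \<Longrightarrow>
        mixed_norm (ennreal q) (ennreal \<alpha>) S X U (\<lambda>z. ennreal \<bar>(f \<circ> \<phi>) z\<bar>)
          \<le> ennreal C * mixed_norm (ennreal p) (ennreal \<beta>) T Y U' (\<lambda>z. ennreal \<bar>f z\<bar>)"
      unfolding induces_bounded_composition_operator_def by blast
    have "Lnorm \<kappa> T (\<lambda>t. Lnorm \<gamma> Y (\<lambda>y. W1 (t, y))) < \<infinity>"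
    \<comment> \<open>Test functions live on all of \<open>T \<times> Y\<close>. Cutting them off
      outside \<open>U'\<close> leaves the left side unchanged, because \<open>W1\<close> vanishes
      there, and does not increase the right side.\<close>
    proof (rule TY.Lnorm_Lnorm_converse_holder[OF W1 q0 q(2) \<alpha>0 \<alpha>(2) \<kappa> \<gamma> W1_fin, of "ennreal C"])
      fix f :: "'t \<times> 'y \<Rightarrow> real"
      assume f[measurable]: "f \<in> borel_measurable (T \<Otimes>\<^sub>M Y)" and f0: "\<And>z. 0 \<le> f z"
        and fin: "Lnorm (ennreal p) T (\<lambda>t. Lnorm (ennreal \<beta>) Y (\<lambda>y. ennreal (f (t, y)))) < \<infinity>"
      have fU: "f \<in> borel_measurable (restrict_space TYc U')"
        by (intro measurable_restrict_space1 measurable_completion) measurable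
      have fC: "(\<lambda>z. ennreal (f z)) \<in> borel_measurable TYc"
        by (intro measurable_completion) measurable
      have fI: "(\<lambda>z. ennreal (f z) * indicator U' z) \<in> borel_measurable TYc"
        using fC indU' by (rule borel_measurable_times_ennreal)
      have le: "mixed_norm (ennreal p) (ennreal \<beta>) T Y U' (\<lambda>z. ennreal \<bar>f z\<bar>)
          \<le> Lnorm (ennreal p) T (\<lambda>t. Lnorm (ennreal \<beta>) Y (\<lambda>y. ennreal (f (t, y))))"
        unfolding mixed_norm_eq abs_of_nonneg[OF f0]
      proof (rule Lnorm_mono_AE[OF TY.completion_measurable_Lnorm_slice[OF fI \<beta>']])
        show "AE t in T. Lnorm (ennreal \<beta>) Y (\<lambda>y. ennreal (f (t, y)) * indicator U' (t, y)) \<le> Lnorm (ennreal \<beta>) Y (\<lambda>y. ennreal (f (t, y)))"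
          using TY.AE_measurable_slice[OF fI]
          by eventually_elim (auto intro!: Lnorm_mono_AE simp: indicator_def)
      qed
      have "f \<in> mixed_space (ennreal p) (ennreal \<beta>) T Y U'"
        unfolding mixed_space_def using fU le_less_trans[OF le fin] by simp
      from C[OF this] have "Lnorm (ennreal q) T (\<lambda>t. Lnorm (ennreal \<alpha>) Y (\<lambda>y. (ennreal \<bar>f (t, y)\<bar> * indicator U' (t, y)) * W1 (t, y)))
          \<le> ennreal C * mixed_norm (ennreal p) (ennreal \<beta>) T Y U' (\<lambda>z. ennreal \<bar>f z\<bar>)"
        unfolding comp[OF fU] .
      also have "(\<lambda>t. Lnorm (ennreal \<alpha>) Y (\<lambda>y. (ennreal \<bar>f (t, y)\<bar> * indicator U' (t, y)) * W1 (t, y)))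
          = (\<lambda>t. Lnorm (ennreal \<alpha>) Y (\<lambda>y. ennreal (f (t, y)) * W1 (t, y)))"
      proof -
        have "(ennreal \<bar>f z\<bar> * indicator U' z) * W1 z = ennreal (f z) * W1 z" for z
          using f0[of z] by (simp add: W1_def indicator_def)
        then show ?thesis by simp
      qed
      also have "ennreal C * mixed_norm (ennreal p) (ennreal \<beta>) T Y U' (\<lambda>z. ennreal \<bar>f z\<bar>)
          \<le> ennreal C * Lnorm (ennreal p) T (\<lambda>t. Lnorm (ennreal \<beta>) Y (\<lambda>y. ennreal (f (t, y))))"
        using le by (rule mult_left_mono) simp
      finally show "Lnorm (ennreal q) T (\<lambda>t. Lnorm (ennreal \<alpha>) Y (\<lambda>y. ennreal (f (t, y)) * W1 (t, y)))
          \<le> ennreal C * Lnorm (ennreal p) T (\<lambda>t. Lnorm (ennreal \<beta>) Y (\<lambda>y. ennreal (f (t, y))))" .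
    qed simp
    then show "in_mixed_space \<kappa> \<gamma> T Y U' ?W0"
      unfolding in_mixed_space_def norm_W using meas_W by blast
  next
    assume "in_mixed_space \<kappa> \<gamma> T Y U' ?W0"
    then have fin: "Lnorm \<kappa> T (\<lambda>t. Lnorm \<gamma> Y (\<lambda>y. W1 (t, y))) < \<infinity>"
      unfolding in_mixed_space_def norm_W by blast
    define D where "D = enn2real (Lnorm \<kappa> T (\<lambda>t. Lnorm \<gamma> Y (\<lambda>y. W1 (t, y))))"
    have D: "Lnorm \<kappa> T (\<lambda>t. Lnorm \<gamma> Y (\<lambda>y. W1 (t, y))) = ennreal D"
      using fin by (simp add: D_def)
    have "f \<circ> \<phi> \<in> mixed_space (ennreal q) (ennreal \<alpha>) S X U \<and>
        mixed_norm (ennreal q) (ennreal \<alpha>) S X U (\<lambda>z. ennreal \<bar>(f \<circ> \<phi>) z\<bar>)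
          \<le> ennreal D * mixed_norm (ennreal p) (ennreal \<beta>) T Y U' (\<lambda>z. ennreal \<bar>f z\<bar>)"
      if f: "f \<in> mixed_space (ennreal p) (ennreal \<beta>) T Y U'" for f
    proof -
      have fU: "f \<in> borel_measurable (restrict_space TYc U')"
        and ffin: "mixed_norm (ennreal p) (ennreal \<beta>) T Y U' (\<lambda>z. ennreal \<bar>f z\<bar>) < \<infinity>"
        using f by (auto simp: mixed_space_def)
      have fI: "(\<lambda>z. ennreal \<bar>f z\<bar> * indicator U' z) \<in> borel_measurable TYc"
      proof -
        have "(\<lambda>z. ennreal \<bar>f z\<bar>) \<in> borel_measurable (restrict_space TYc U')" using fU by measurable
        then show ?thesis by (rule iffD1[OF borel_measurable_restrict_space_iff_ennreal[OF U'']])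
      qed
      have le: "mixed_norm (ennreal q) (ennreal \<alpha>) S X U (\<lambda>z. ennreal \<bar>(f \<circ> \<phi>) z\<bar>)
          \<le> ennreal D * mixed_norm (ennreal p) (ennreal \<beta>) T Y U' (\<lambda>z. ennreal \<bar>f z\<bar>)"
        unfolding comp[OF fU] mixed_norm_eq[of _ _ T] D[symmetric]
        using TY.Lnorm_Lnorm_holder[OF fI W1 q0 q(2) \<alpha>0 \<alpha>(2) \<kappa> \<gamma>] by (simp only: mult.commute)
      have "f \<circ> \<phi> \<in> borel_measurable (restrict_space SXc U)"
        unfolding comp_def by (rule measurable_compose[OF \<phi>_measurable_completion fU])
      moreover have "ennreal D * mixed_norm (ennreal p) (ennreal \<beta>) T Y U' (\<lambda>z. ennreal \<bar>f z\<bar>) < \<infinity>"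
        using ffin by (simp add: ennreal_mult_less_top)
      ultimately show ?thesis
        unfolding mixed_space_def using le le_less_trans[OF le] by blast
    qed
    then show ?L unfolding induces_bounded_composition_operator_def by blast
  qed
qed

end

theorem theorem6p2:
  fixes S :: "'s measure" and X :: "'x measure" and T :: "'t measure" and Y :: "'y measure"
    and dS :: "'s \<Rightarrow> 's \<Rightarrow> real" and dX :: "'x \<Rightarrow> 'x \<Rightarrow> real"
    and dT :: "'t \<Rightarrow> 't \<Rightarrow> real" and dY :: "'y \<Rightarrow> 'y \<Rightarrow> real"
    and U :: "('s \<times> 'x) set" and U' :: "('t \<times> 'y) set"
    and \<phi> :: "'s \<times> 'x \<Rightarrow> 't \<times> 'y" and \<psi> :: "'s \<Rightarrow> 't" and \<xi> :: "'s \<Rightarrow> 'x \<Rightarrow> 'y"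
    and p q \<alpha> \<beta> :: real and \<kappa> \<gamma> :: ennreal
    and J\<psi> :: "'t \<Rightarrow> ennreal" and J\<xi> :: "'s \<Rightarrow> 'y \<Rightarrow> ennreal"
  defines "J\<psi> \<equiv> volume_deriv_inv S (space S) \<psi> T dT"
    and "J\<xi> \<equiv> (\<lambda>s. volume_deriv_inv X (slice U s) (\<xi> s) Y dY)"
  assumes "1 \<le> q" "q \<le> p" "1 \<le> \<alpha>" "\<alpha> \<le> \<beta>"
    and "\<gamma> = (if \<alpha> < \<beta> then ennreal (\<beta> * \<alpha> / (\<beta> - \<alpha>)) else \<infinity>)"
    and "\<kappa> = (if q < p then ennreal (p * q / (p - q)) else \<infinity>)"
    and "homogeneous_space S dS" "homogeneous_space X dX"
    and "homogeneous_space T dT" "homogeneous_space Y dY"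
    and "U \<in> sets (completion (S \<Otimes>\<^sub>M X))" "U' \<in> sets (completion (T \<Otimes>\<^sub>M Y))"
    and "\<phi> \<in> U \<rightarrow> U'"
    and "\<phi> \<in> restrict_space (completion (S \<Otimes>\<^sub>M X)) U \<rightarrow>\<^sub>M (T \<Otimes>\<^sub>M Y)"
    and "\<psi> \<in> completion S \<rightarrow>\<^sub>M T"
    and "\<forall>A\<in>sets S. \<psi> ` A \<in> sets (completion T)"
    and "AE t in T. J\<psi> t = RN_deriv T (distr (completion S) T \<psi>) t"
    and A1: "preserves_priority S X U T Y \<phi> \<psi> \<xi>"
    and A2: "\<forall>t\<in>\<psi> ` space S.
      Lnorm_on \<gamma> Y (slice U' t) (\<lambda>y. epowr (J\<xi> (inv_into (space S) \<psi> t) y) (1 / \<alpha>)) < \<infinity>"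
    and A3: "inj_on \<psi> (space S)" "luzin_N S (space S) \<psi> T"
  shows "induces_bounded_composition_operator \<phi> (ennreal p) (ennreal \<beta>) T Y U'
           (ennreal q) (ennreal \<alpha>) S X U \<longleftrightarrow>
    in_mixed_space \<kappa> \<gamma> T Y U'
      (\<lambda>(t, y). if t \<in> \<psi> ` space S
         then epowr (J\<psi> t) (1 / q) * epowr (J\<xi> (inv_into (space S) \<psi> t) y) (1 / \<alpha>)
         else 0)"
proof -
  obtain c1 c2 where Y: "homogeneous Y dY c1 c2"
    using homogeneous_spaceE[OF \<open>homogeneous_space Y dY\<close>] by blast
  have "sigma_finite_measure S" "sigma_finite_measure X" "sigma_finite_measure T"
    using \<open>homogeneous_space S dS\<close> \<open>homogeneous_space X dX\<close> \<open>homogeneous_space T dT\<close>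
    unfolding homogeneous_space_def by blast+
  then interpret pm: priority_map S X T Y dY c1 c2 U U' \<phi> \<psi> \<xi>
    using assms Y unfolding preserves_priority_def
    by (intro priority_map.intro priority_map_axioms.intro pair_sigma_finite.intro) auto
  show ?thesis
    unfolding J\<xi>_def
    by (rule pm.composition_operator_iff) (use assms in \<open>simp_all add: J\<xi>_def\<close>)
qed

end
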